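(* Let $R$ be an admissible ring and let $\mathcal{J}$ be a regular fractional ideal of $R$. (1) For every regular fractional ideal $\mathcal{I}$ of $R$ and all $\alpha,\beta\in\mathbb{Z}^r$ with $\alpha+\beta=c(\mathcal{J})$, one has $$\ell\left(\frac{\mathcal{I}(\alpha)}{\mathcal{I}(\alpha+e_i)}\right)+\ell\left(\frac{(\mathcal{J}:\mathcal{I})(\beta-e_i)}{(\mathcal{J}:\mathcal{I})(\beta)}\right)\leq 1\qquad\text{for every } i\in I=\{1,\ldots,r\}.$$ (2) Equality holds in this inequality for every $i\in I$, every $\alpha,\beta\in\mathbb{Z}^r$ with $\alpha+\beta=c(\mathcal{J})$ and every regular fractional ideal $\mathcal{I}$ of $R$ if and only if $\mathcal{J}$ is a canonical ideal.
   Context: Admissible rings: a noetherian, Cohen–Macaulay, one-dimensional local ring $(R,\mathfrak{M})$ with total ring of fractions $Q$ is admissible if it is analytically reduced (its $\mathfrak{M}$-adic completion is reduced), residually rational (each valuation ring of $Q$ over $R$ has residue field equal to $R/\mathfrak{M}$), and $\#(R/\mathfrak{M})\geq r$, where $r$ is the number of valuation rings of $Q$ over $R$. All these valuation rings are discrete (they correspond to the maximal ideals of the integral closure of $R$ in $Q$); let $v_1,\ldots,v_r$ be the associated valuations $Q\to\mathbb{Z}\cup\{\infty\}$. Put $I=\{1,\ldots,r\}$, let $Q^{reg}$ be the set of regular elements of $Q$, and define $v:Q^{reg}\to\mathbb{Z}^r$ by $v(h)=(v_1(h),\ldots,v_r(h))$. $\mathbb{Z}^r$ has the componentwise partial order $\leq$.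 A fractional ideal is an $R$-submodule $\mathcal{I}$ of $Q$ such that $d\,\mathcal{I}\subset R$ for some regular $d\in R$; it is regular if it contains a regular element of $Q$. For regular fractional ideals, $\mathcal{J}:\mathcal{I}=\{x\in Q:\ x\mathcal{I}\subset\mathcal{J}\}$, which is again a regular fractional ideal. A regular fractional ideal $\mathcal{J}$ is a canonical ideal if $\mathcal{J}:(\mathcal{J}:\mathcal{I})=\mathcal{I}$ for every regular fractional ideal $\mathcal{I}$. The value set of a regular fractional ideal $\mathcal{I}$ is $E(\mathcal{I})=v(\mathcal{I}\cap Q^{reg})\subset\mathbb{Z}^r$. Its conductor $c(\mathcal{I})$ is the unique least element $\gamma\in E(\mathcal{I})$ such that $\gamma+\mathbb{N}^r\subset E(\mathcal{I})$ (with $0\in\mathbb{N}$; such an element exists). $e_i\in\mathbb{Z}^r$ is the $i$-th standard basis vector. For $\alpha\in\mathbb{Z}^r$, $\mathcal{I}(\alpha)=\{h\in\mathcal{I}:\ v_i(h)\geq\alpha_i \text{ for all } i\in I\}$, an $R$-submodule of $\mathcal{I}$. $\ell(M)$ denotes the length of an $R$-module $M$. *)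

theory Defs
  imports
    "HOL-Analysis.Finite_Cartesian_Product"
    "HOL-Library.Extended"
    "HOL-Library.Extended_Nat"
    "HOL-Library.Equipollence"
    "HOL-Algebra.Algebra"
begin

section \<open>Local rings, dimension, depth, completion\<close>

definition regular_elements :: "('a, 'm) ring_scheme \<Rightarrow> 'a set" where
  "regular_elements A =
     {x \<in> carrier A. \<forall>y\<in>carrier A. x \<otimes>\<^bsub>A\<^esub> y = \<zero>\<^bsub>A\<^esub> \<longrightarrow> y = \<zero>\<^bsub>A\<^esub>}"

definition reduced_ring :: "('a, 'm) ring_scheme \<Rightarrow> bool" where
  "reduced_ring A \<longleftrightarrow> (\<forall>x\<in>carrier A. \<forall>n::nat. x [^]\<^bsub>A\<^esub> n = \<zero>\<^bsub>A\<^esub> \<longrightarrow> x = \<zero>\<^bsub>A\<^esub>)"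

definition is_local_ring :: "('a, 'm) ring_scheme \<Rightarrow> 'a set \<Rightarrow> bool" where
  "is_local_ring A M \<longleftrightarrow> cring A \<and> maximalideal M A \<and> (\<forall>N. maximalideal N A \<longrightarrow> N = M)"

definition krull_dim :: "('a, 'm) ring_scheme \<Rightarrow> enat" where
  "krull_dim A = Sup {enat n | n P. (\<forall>i\<le>n. primeideal (P i) A) \<and> (\<forall>i<n. P i \<subset> P (Suc i))}"

definition regular_sequence :: "('a, 'm) ring_scheme \<Rightarrow> 'a list \<Rightarrow> bool" where
  "regular_sequence A xs \<longleftrightarrow>
     set xs \<subseteq> carrier A \<and> Idl\<^bsub>A\<^esub> (set xs) \<noteq> carrier A \<and>
     (\<forall>i<length xs. \<forall>y\<in>carrier A.
        xs ! i \<otimes>\<^bsub>A\<^esub> y \<in> Idl\<^bsub>A\<^esub> (set (take i xs)) \<longrightarrow> y \<in> Idl\<^bsub>A\<^esub> (set (take i xs)))"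

definition depth :: "('a, 'm) ring_scheme \<Rightarrow> 'a set \<Rightarrow> enat" where
  "depth A M = Sup {enat (length xs) | xs. set xs \<subseteq> M \<and> regular_sequence A xs}"

definition cohen_macaulay :: "('a, 'm) ring_scheme \<Rightarrow> 'a set \<Rightarrow> bool" where
  "cohen_macaulay A M \<longleftrightarrow> depth A M = krull_dim A"

text \<open>
  The completion is the inverse limit of the rings \<open>A/M\<^sup>n\<close>; its elements are sequences of
  cosets, and compatibility of two consecutive cosets is inclusion.
\<close>

definition quot_pow :: "('a, 'm) ring_scheme \<Rightarrow> 'a set \<Rightarrow> nat \<Rightarrow> 'a set ring" where
  "quot_pow A M n = A Quot (M [^]\<^bsub>ideals_set A\<^esub> n)"

definition adic_completion :: "('a, 'm) ring_scheme \<Rightarrow> 'a set \<Rightarrow> (nat \<Rightarrow> 'a set) ring" where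
  "adic_completion A M =
     \<lparr>carrier = {x. \<forall>n. x n \<in> carrier (quot_pow A M n) \<and> x (Suc n) \<subseteq> x n},
      monoid.mult = (\<lambda>x y n. x n \<otimes>\<^bsub>quot_pow A M n\<^esub> y n),
      monoid.one = (\<lambda>n. \<one>\<^bsub>quot_pow A M n\<^esub>),
      ring.zero = (\<lambda>n. \<zero>\<^bsub>quot_pow A M n\<^esub>),
      ring.add = (\<lambda>x y n. x n \<oplus>\<^bsub>quot_pow A M n\<^esub> y n)\<rparr>"

section \<open>Length of modules\<close>

definition module_length :: "('a, 'm) ring_scheme \<Rightarrow> ('a, 'b, 'n) module_scheme \<Rightarrow> enat" where
  "module_length A P =
     Sup {enat n | n C. (\<forall>i\<le>n. submodule (C i) A P) \<and> (\<forall>i<n. C i \<subset> C (Suc i))}"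

text \<open>The library's module records extend ring records; \<open>mult\<close> and \<open>one\<close> play no role.\<close>

definition quot_module :: "('a, 'b, 'n) module_scheme \<Rightarrow> 'b set \<Rightarrow> ('a, 'b set) module" where
  "quot_module P N =
     \<lparr>carrier = a_rcosets\<^bsub>P\<^esub> N, monoid.mult = undefined, monoid.one = undefined,
      ring.zero = N, ring.add = set_add P,
      smult = (\<lambda>a C. \<Union>x\<in>C. N +>\<^bsub>P\<^esub> (a \<odot>\<^bsub>P\<^esub> x))\<rparr>"

definition ring_module :: "('a, 'm) ring_scheme \<Rightarrow> ('a, 'a) module" where
  "ring_module Q =
     \<lparr>carrier = carrier Q, monoid.mult = monoid.mult Q, monoid.one = \<one>\<^bsub>Q\<^esub>,
      ring.zero = \<zero>\<^bsub>Q\<^esub>, ring.add = ring.add Q,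
      smult = monoid.mult Q\<rparr>"

section \<open>Admissible rings\<close>

text \<open>
  Throughout, \<open>R\<close> is a subset of the ring \<open>Q\<close>, regarded as a ring with the operations of \<open>Q\<close>.
\<close>

abbreviation sub_ring :: "('a, 'm) ring_scheme \<Rightarrow> 'a set \<Rightarrow> ('a, 'm) ring_scheme" where
  "sub_ring Q R \<equiv> Q\<lparr>carrier := R\<rparr>"

definition total_ring_of_fractions :: "('a, 'm) ring_scheme \<Rightarrow> 'a set \<Rightarrow> bool" where
  "total_ring_of_fractions Q R \<longleftrightarrow>
     cring Q \<and> subring R Q \<and>
     regular_elements (sub_ring Q R) \<subseteq> Units Q \<and>
     (\<forall>q\<in>carrier Q. \<exists>s\<in>regular_elements (sub_ring Q R). s \<otimes>\<^bsub>Q\<^esub> q \<in> R)"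

definition valuation_rings_over :: "('a, 'm) ring_scheme \<Rightarrow> 'a set \<Rightarrow> 'a set set" where
  "valuation_rings_over Q R =
     {V. subring V Q \<and> R \<subseteq> V \<and> V \<noteq> carrier Q \<and>
         (\<forall>x\<in>carrier Q - V. \<forall>y\<in>carrier Q - V. x \<otimes>\<^bsub>Q\<^esub> y \<notin> V)}"

text \<open>
  If \<open>Q\<close> is not a field, a valuation ring need not be local; its residue field is taken modulo
  the ideal of elements of positive value, which can be described without the valuation as follows
  (Manis). It is the unique maximal ideal of \<open>V\<close> containing a regular element of \<open>Q\<close>.
\<close>

definition valuation_ideal :: "('a, 'm) ring_scheme \<Rightarrow> 'a set \<Rightarrow> 'a set" where
  "valuation_ideal Q V = {x \<in> V. \<exists>y\<in>carrier Q - V. x \<otimes>\<^bsub>Q\<^esub> y \<in> V}"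

text \<open>The map below is the natural map \<open>R/M \<rightarrow> V/\<mm>\<close>, \<open>a + M \<mapsto> a + \<mm>\<close>.\<close>

definition residually_rational :: "('a, 'm) ring_scheme \<Rightarrow> 'a set \<Rightarrow> 'a set \<Rightarrow> bool" where
  "residually_rational Q R M \<longleftrightarrow>
     (\<forall>V\<in>valuation_rings_over Q R.
        (\<lambda>C. valuation_ideal Q V <+>\<^bsub>Q\<^esub> C)
          \<in> ring_iso (sub_ring Q R Quot M) (sub_ring Q V Quot valuation_ideal Q V))"

definition admissible :: "('a, 'm) ring_scheme \<Rightarrow> 'a set \<Rightarrow> 'a set \<Rightarrow> bool" where
  "admissible Q R M \<longleftrightarrow>
     total_ring_of_fractions Q R \<and>
     is_local_ring (sub_ring Q R) M \<and>
     noetherian_ring (sub_ring Q R) \<and>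
     krull_dim (sub_ring Q R) = 1 \<and>
     cohen_macaulay (sub_ring Q R) M \<and>
     reduced_ring (adic_completion (sub_ring Q R) M) \<and>
     residually_rational Q R M \<and>
     valuation_rings_over Q R \<lesssim> carrier (sub_ring Q R Quot M)"

section \<open>Valuations\<close>

text \<open>
  The value group is exactly the integers. Such a \<open>w\<close> is determined on \<open>Q\<close> by its ring
  \<open>{x. w x \<ge> 0}\<close>.
\<close>

definition discrete_valuation :: "('a, 'm) ring_scheme \<Rightarrow> ('a \<Rightarrow> int extended) \<Rightarrow> bool" where
  "discrete_valuation Q w \<longleftrightarrow>
     w ` carrier Q = insert Pinf (range Fin) \<and>
     w \<zero>\<^bsub>Q\<^esub> = Pinf \<and> w \<one>\<^bsub>Q\<^esub> = 0 \<and>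
     (\<forall>x\<in>carrier Q. \<forall>y\<in>carrier Q. w (x \<otimes>\<^bsub>Q\<^esub> y) = w x + w y) \<and>
     (\<forall>x\<in>carrier Q. \<forall>y\<in>carrier Q. min (w x) (w y) \<le> w (x \<oplus>\<^bsub>Q\<^esub> y))"

definition valuation_ring_of :: "('a, 'm) ring_scheme \<Rightarrow> ('a \<Rightarrow> int extended) \<Rightarrow> 'a set" where
  "valuation_ring_of Q w = {x \<in> carrier Q. 0 \<le> w x}"

text \<open>
  \<open>v\<close> lists, without repetition, the valuations associated with the valuation rings of \<open>Q\<close>
  over \<open>R\<close>. The index type plays the role of \<open>{1,\<dots>,r}\<close>.
\<close>

definition associated_valuations ::
    "('a, 'm) ring_scheme \<Rightarrow> 'a set \<Rightarrow> ('n::finite \<Rightarrow> 'a \<Rightarrow> int extended) \<Rightarrow> bool" where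
  "associated_valuations Q R v \<longleftrightarrow>
     (\<forall>i. discrete_valuation Q (v i)) \<and>
     bij_betw (\<lambda>i. valuation_ring_of Q (v i)) UNIV (valuation_rings_over Q R)"

section \<open>Fractional ideals and value sets\<close>

definition fractional_ideal :: "('a, 'm) ring_scheme \<Rightarrow> 'a set \<Rightarrow> 'a set \<Rightarrow> bool" where
  "fractional_ideal Q R I \<longleftrightarrow>
     submodule I (sub_ring Q R) (ring_module Q) \<and>
     (\<exists>d\<in>regular_elements (sub_ring Q R). \<forall>x\<in>I. d \<otimes>\<^bsub>Q\<^esub> x \<in> R)"

definition regular_fractional_ideal :: "('a, 'm) ring_scheme \<Rightarrow> 'a set \<Rightarrow> 'a set \<Rightarrow> bool" where
  "regular_fractional_ideal Q R I \<longleftrightarrow> fractional_ideal Q R I \<and> I \<inter> regular_elements Q \<noteq> {}"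

definition colon :: "('a, 'm) ring_scheme \<Rightarrow> 'a set \<Rightarrow> 'a set \<Rightarrow> 'a set" where
  "colon Q J I = {x \<in> carrier Q. \<forall>y\<in>I. x \<otimes>\<^bsub>Q\<^esub> y \<in> J}"

definition canonical_ideal :: "('a, 'm) ring_scheme \<Rightarrow> 'a set \<Rightarrow> 'a set \<Rightarrow> bool" where
  "canonical_ideal Q R J \<longleftrightarrow>
     regular_fractional_ideal Q R J \<and>
     (\<forall>I. regular_fractional_ideal Q R I \<longrightarrow> colon Q J (colon Q J I) = I)"

definition value_set ::
    "('a, 'm) ring_scheme \<Rightarrow> ('n::finite \<Rightarrow> 'a \<Rightarrow> int extended) \<Rightarrow> 'a set \<Rightarrow> (int ^ 'n) set" where
  "value_set Q v I = {\<alpha>. \<exists>h \<in> I \<inter> regular_elements Q. \<forall>i. v i h = Fin (\<alpha> $ i)}"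

definition conductor ::
    "('a, 'm) ring_scheme \<Rightarrow> ('n::finite \<Rightarrow> 'a \<Rightarrow> int extended) \<Rightarrow> 'a set \<Rightarrow> int ^ 'n" where
  "conductor Q v I =
     (LEAST \<gamma>. \<gamma> \<in> value_set Q v I \<and> (\<forall>\<delta>. 0 \<le> \<delta> \<longrightarrow> \<gamma> + \<delta> \<in> value_set Q v I))"

definition truncation ::
    "('n::finite \<Rightarrow> 'a \<Rightarrow> int extended) \<Rightarrow> 'a set \<Rightarrow> int ^ 'n \<Rightarrow> 'a set" where
  "truncation v I \<alpha> = {h \<in> I. \<forall>i. Fin (\<alpha> $ i) \<le> v i h}"

text \<open>The length over \<open>R\<close> of \<open>I(\<alpha>)/I(\<beta>)\<close>, for \<open>\<alpha> \<le> \<beta>\<close>.\<close>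

definition truncation_quot_length ::
    "('a, 'm) ring_scheme \<Rightarrow> 'a set \<Rightarrow> ('n::finite \<Rightarrow> 'a \<Rightarrow> int extended) \<Rightarrow>
     'a set \<Rightarrow> int ^ 'n \<Rightarrow> int ^ 'n \<Rightarrow> enat" where
  "truncation_quot_length Q R v I \<alpha> \<beta> =
     module_length (sub_ring Q R)
       (quot_module ((ring_module Q)\<lparr>carrier := truncation v I \<alpha>\<rparr>) (truncation v I \<beta>))"

end

theory Submission
  imports Defs
begin

text \<open>
  For \<open>\<alpha>\<close> in \<open>\<int>\<^sup>r\<close> put \<open>Q(\<alpha>) = {x. v x \<ge> \<alpha>}\<close>. Residual rationality makes each length in the inequality
  \<open>0\<close> or \<open>1\<close>, according to whether some element with \<open>v x \<ge> \<alpha>\<close> has \<open>i\<close>-th value exactly \<open>\<alpha>\<^sub>i\<close> (a jump),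
  and it lets one raise values one at a time, so that \<open>c(J)\<close> is the least \<open>\<gamma>\<close> with \<open>Q(\<gamma>) \<subseteq> J\<close> and
  \<open>J : Q(\<alpha>) = Q(c(J) - \<alpha>)\<close>. Two simultaneous jumps multiply to an element of \<open>J\<close> that would give
  \<open>Q(c(J) - e\<^sub>i) \<subseteq> J\<close>. If \<open>J\<close> is canonical and \<open>J : I\<close> has no jump, then dualizing
  \<open>J : (I + Q(\<alpha> + e\<^sub>i)) = J : (I + Q(\<alpha>))\<close> yields a jump of \<open>I\<close>; conversely, equality everywhere forces
  \<open>I\<close> and \<open>J : (J : I)\<close> to have the same jumps, hence to coincide.

  All this needs some \<open>Q(\<gamma>) \<subseteq> R\<close>. Let \<open>t \<in> M\<close> be regular and \<open>W\<close> the intersection of the valuation rings.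
  Elements of \<open>W\<close> are integral over \<open>R\<close>, so their powers have bounded denominators. If no \<open>t\<^sup>k W\<close> lay in
  \<open>R\<close>, a limit of elements of \<open>R \<inter> t\<^sup>k W\<close> would be a nonzero element of the completion whose powers are
  divisible by high powers of \<open>t\<close>; as the completion has dimension one, it would be nilpotent.
\<close>

section \<open>Prime ideals and one-dimensional local rings\<close>

text \<open>\<open>Q\<close> need not be a field, so a valuation may be infinite on nonzero
  elements. Hence valuation rings are produced by running Chevalley's extension argument modulo a
  prime ideal of \<open>Q\<close>, whose quotient is a field because primes of \<open>Q\<close> miss
  \<open>t\<close> and \<open>R\<close> has dimension one; and an element can be inverted only once
  all its values are finite.

  The bound on the number of valuation rings serves one purpose: if \<open>x\<close> has a pole at
  one place, some \<open>b\<close> in \<open>R\<close> avoids the residues of \<open>x\<close> at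
  the other places, so \<open>x - b\<close> is a unit with no positive value, and its inverse
  separates two places. From this come elements with any prescribed vector of values.

  The nilpotency of the limit \<open>x\<close> is a race of exponents. Inverting \<open>t\<close>
  makes the completion artinian, so \<open>t^a x^j\<close> is a multiple of \<open>x^(j+1)\<close>
  for some \<open>a\<close> and \<open>j\<close>, hence \<open>t^(a m) x^j\<close> is a multiple of
  \<open>x^(j+m)\<close>. Taking the limit inside \<open>t^(a+1) W\<close> makes
  \<open>x^(j+m)\<close> divisible by \<open>t^((a+1)(j+m))\<close> up to a constant, so
  \<open>x^j\<close> is divisible by every power of \<open>t\<close>.\<close>

no_notation Sum_Type.Plus (infixr \<open><+>\<close> 65)

context cring
begin

text \<open>
  These rules turn every term into a difference of two sums of products and every equation into
  an equation between sums of products, so that simplification decides identities of commutative rings.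
\<close>

lemma diff_norm:
  assumes "a \<in> carrier R" "b \<in> carrier R" "c \<in> carrier R"
  shows "a \<oplus> (b \<ominus> c) = (a \<oplus> b) \<ominus> c" "(a \<ominus> b) \<oplus> c = (a \<oplus> c) \<ominus> b"
    "a \<ominus> (b \<ominus> c) = (a \<oplus> c) \<ominus> b" "(a \<ominus> b) \<ominus> c = a \<ominus> (b \<oplus> c)"
    "a \<otimes> (b \<ominus> c) = a \<otimes> b \<ominus> a \<otimes> c" "(a \<ominus> b) \<otimes> c = a \<otimes> c \<ominus> b \<otimes> c"
    "a \<ominus> b = c \<longleftrightarrow> a = c \<oplus> b" "c = a \<ominus> b \<longleftrightarrow> c \<oplus> b = a"
proof -
  show "a \<oplus> (b \<ominus> c) = (a \<oplus> b) \<ominus> c" "(a \<ominus> b) \<oplus> c = (a \<oplus> c) \<ominus> b"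
    "a \<ominus> (b \<ominus> c) = (a \<oplus> c) \<ominus> b" "(a \<ominus> b) \<ominus> c = a \<ominus> (b \<oplus> c)"
    "a \<otimes> (b \<ominus> c) = a \<otimes> b \<ominus> a \<otimes> c" "(a \<ominus> b) \<otimes> c = a \<otimes> c \<ominus> b \<otimes> c"
    using assms by (simp_all add: a_minus_def r_distr l_distr r_minus l_minus minus_add a_ac)
  show "a \<ominus> b = c \<longleftrightarrow> a = c \<oplus> b" "c = a \<ominus> b \<longleftrightarrow> c \<oplus> b = a"
    using assms by (auto simp: a_minus_def a_assoc l_neg r_neg)
qed

lemma uminus_norm: "a \<in> carrier R \<Longrightarrow> \<ominus> a = \<zero> \<ominus> a"
  by (simp add: a_minus_def)

lemmas ring_norm = diff_norm uminus_norm l_distr r_distr a_ac m_ac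

lemma ideal_carr: "ideal I R \<Longrightarrow> x \<in> I \<Longrightarrow> x \<in> carrier R"
  by (rule ideal.Icarr)

lemma ideal_zero: "ideal I R \<Longrightarrow> \<zero> \<in> I"
  by (simp add: additive_subgroup.zero_closed ideal.axioms(1))

lemma ideal_add: "ideal I R \<Longrightarrow> x \<in> I \<Longrightarrow> y \<in> I \<Longrightarrow> x \<oplus> y \<in> I"
  by (simp add: additive_subgroup.a_closed ideal.axioms(1))

lemma ideal_uminus: "ideal I R \<Longrightarrow> x \<in> I \<Longrightarrow> \<ominus> x \<in> I"
  by (simp add: additive_subgroup.a_inv_closed ideal.axioms(1))

lemma ideal_diff: "ideal I R \<Longrightarrow> x \<in> I \<Longrightarrow> y \<in> I \<Longrightarrow> x \<ominus> y \<in> I"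
  by (simp add: a_minus_def ideal_add ideal_uminus)

lemma ideal_l: "ideal I R \<Longrightarrow> x \<in> I \<Longrightarrow> a \<in> carrier R \<Longrightarrow> a \<otimes> x \<in> I"
  by (rule ideal.I_l_closed)

lemma ideal_r: "ideal I R \<Longrightarrow> x \<in> I \<Longrightarrow> a \<in> carrier R \<Longrightarrow> x \<otimes> a \<in> I"
  by (rule ideal.I_r_closed)

lemma ideal_diff_iff:
  assumes "ideal I R" "x \<in> carrier R" "y \<in> carrier R" "x \<ominus> y \<in> I"
  shows "x \<in> I \<longleftrightarrow> y \<in> I"
proof -
  have x: "x \<in> carrier R" and y: "y \<in> carrier R" using assms by auto
  have "x = (x \<ominus> y) \<oplus> y" by (insert x y, simp add: ring_norm)
  moreover have "y = x \<ominus> (x \<ominus> y)" by (insert x y, simp add: ring_norm)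
  ultimately show ?thesis
    using assms ideal_add ideal_diff by metis
qed

lemma idealI':
  assumes "I \<subseteq> carrier R" "\<zero> \<in> I"
    and "\<And>x y. x \<in> I \<Longrightarrow> y \<in> I \<Longrightarrow> x \<oplus> y \<in> I"
    and "\<And>a x. a \<in> carrier R \<Longrightarrow> x \<in> I \<Longrightarrow> a \<otimes> x \<in> I"
  shows "ideal I R"
proof (rule idealI[OF ring_axioms])
  show "subgroup I (add_monoid R)"
  proof (rule add.subgroupI)
    fix a assume "a \<in> I"
    then have "\<ominus> \<one> \<otimes> a \<in> I" using assms(4) by simp
    then show "\<ominus> a \<in> I" using \<open>a \<in> I\<close> assms(1) by (simp add: l_minus subset_iff)
  qed (use assms in auto)
next
  fix a x assume *: "a \<in> I" "x \<in> carrier R"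
  then show "x \<otimes> a \<in> I" by (rule assms(4)[rotated])
  then show "a \<otimes> x \<in> I" using * assms(1) by (simp add: m_comm subset_iff)
qed

lemma PIdl_mem: "x \<in> PIdl a \<longleftrightarrow> (\<exists>r\<in>carrier R. x = r \<otimes> a)"
  by (auto simp: cgenideal_def)

lemma ideal_sum_mem: "x \<in> I <+> J \<longleftrightarrow> (\<exists>i\<in>I. \<exists>j\<in>J. x = i \<oplus> j)"
  by (auto simp: set_add_def')

lemma PIdl_sum_mem: "z \<in> PIdl y <+> I \<longleftrightarrow> (\<exists>c\<in>carrier R. \<exists>h\<in>I. z = c \<otimes> y \<oplus> h)"
  unfolding ideal_sum_mem Bex_def PIdl_mem by blast

lemma ideal_sum_leftI:
  assumes "ideal I R" "ideal J R" "x \<in> I" shows "x \<in> I <+> J"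
  unfolding ideal_sum_mem using ideal_zero[OF assms(2)] ideal_carr[OF assms(1,3)] assms(3)
  by (metis r_zero)

lemma ideal_sum_rightI:
  assumes "ideal I R" "ideal J R" "x \<in> J" shows "x \<in> I <+> J"
  unfolding ideal_sum_mem using ideal_zero[OF assms(1)] ideal_carr[OF assms(2,3)] assms(3)
  by (metis l_zero)

lemma pow_diff_ideal:
  assumes "ideal I R" "x \<in> carrier R" "y \<in> carrier R" "x \<ominus> y \<in> I"
  shows "x [^] (n::nat) \<ominus> y [^] n \<in> I"
proof (induction n)
  case 0
  then show ?case using ideal_zero[OF assms(1)] by (simp add: a_minus_def r_neg)
next
  case (Suc n)
  have x: "x \<in> carrier R" and y: "y \<in> carrier R" using assms by auto
  define a b where "a = x [^] n" and "b = y [^] n"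
  have a: "a \<in> carrier R" and b: "b \<in> carrier R" using x y a_def b_def by auto
  have "a \<otimes> x \<ominus> b \<otimes> y = (a \<ominus> b) \<otimes> x \<oplus> b \<otimes> (x \<ominus> y)" by (insert a b x y, simp add: ring_norm)
  moreover have "\<dots> \<in> I"
    using Suc a_def b_def assms a b by (intro ideal_add ideal_r ideal_l) auto
  ultimately show ?case by (simp add: a_def b_def)
qed

lemma exists_maximal_disjoint_ideal:
  assumes I: "ideal I R" "I \<inter> S = {}"
  obtains P where "ideal P R" "I \<subseteq> P" "P \<inter> S = {}"
    "\<And>J. ideal J R \<Longrightarrow> P \<subseteq> J \<Longrightarrow> J \<inter> S = {} \<Longrightarrow> J = P"
proof -
  let ?A = "{J. ideal J R \<and> I \<subseteq> J \<and> J \<inter> S = {}}"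
  have "\<exists>P\<in>?A. \<forall>J\<in>?A. P \<subseteq> J \<longrightarrow> J = P"
  proof (rule subset_Zorn_nonempty)
    show "?A \<noteq> {}" using I by auto
    fix C assume C: "C \<noteq> {}" "subset.chain ?A C"
    then have "subset.chain {I. ideal I R} C"
      unfolding pred_on.chain_def by auto
    from chain_Union_is_ideal[OF this] C(1) have "ideal (\<Union>C) R" by simp
    then show "\<Union>C \<in> ?A" using C unfolding pred_on.chain_def by blast
  qed
  then show ?thesis using that by (smt (verit) mem_Collect_eq order_trans)
qed

text \<open>An ideal maximal among those avoiding a multiplicative set is prime: if \<open>a\<close>
  and \<open>b\<close> lie outside it, adjoining either one meets \<open>S\<close>, and the product
  of the two meeting points is, modulo \<open>P\<close>, a multiple of
  \<open>a \<otimes> b\<close>.\<close>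

lemma exists_prime_disjoint:
  assumes I: "ideal I R" "I \<inter> S = {}" and S: "\<one> \<in> S"
    "\<And>x y. x \<in> S \<Longrightarrow> y \<in> S \<Longrightarrow> x \<otimes> y \<in> S"
  obtains P where "primeideal P R" "I \<subseteq> P" "P \<inter> S = {}"
proof -
  obtain P where P: "ideal P R" "I \<subseteq> P" "P \<inter> S = {}"
    and max: "\<And>J. ideal J R \<Longrightarrow> P \<subseteq> J \<Longrightarrow> J \<inter> S = {} \<Longrightarrow> J = P"
    using exists_maximal_disjoint_ideal[OF I] by blast
  have meet: "\<exists>p\<in>P. \<exists>r\<in>carrier R. p \<oplus> r \<otimes> x \<in> S" if x: "x \<in> carrier R" "x \<notin> P" for x
  proof (rule ccontr)
    assume *: "\<not> ?thesis"
    let ?J = "P <+> PIdl x"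
    have id: "ideal ?J R" using P(1) cgenideal_ideal[OF x(1)] add_ideals by blast
    have sub: "P \<subseteq> ?J" using ideal_sum_leftI P(1) cgenideal_ideal[OF x(1)] by blast
    have "?J \<inter> S = {}" using * by (auto simp: ideal_sum_mem PIdl_mem)
    then have "?J = P" using max id sub by blast
    moreover have "x \<in> ?J"
      by (rule ideal_sum_rightI[OF P(1) cgenideal_ideal[OF x(1)] cgenideal_self[OF x(1)]])
    ultimately show False using x by simp
  qed
  have "primeideal P R"
  proof (rule primeidealI[OF P(1) is_cring])
    show "carrier R \<noteq> P" using S(1) P(3) by auto
  next
    fix a b assume a: "a \<in> carrier R" and b: "b \<in> carrier R" and ab: "a \<otimes> b \<in> P"
    show "a \<in> P \<or> b \<in> P"
    proof (rule ccontr)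
      assume "\<not> ?thesis"
      then obtain p r q s where p: "p \<in> P" and r: "r \<in> carrier R" and pr: "p \<oplus> r \<otimes> a \<in> S"
        and q: "q \<in> P" and s: "s \<in> carrier R" and qs: "q \<oplus> s \<otimes> b \<in> S"
        using meet a b by meson
      have p': "p \<in> carrier R" and q': "q \<in> carrier R" using p q ideal_carr P(1) by auto
      have "(p \<oplus> r \<otimes> a) \<otimes> (q \<oplus> s \<otimes> b) = p \<otimes> (q \<oplus> s \<otimes> b) \<oplus> (r \<otimes> a \<otimes> q \<oplus> (r \<otimes> s) \<otimes> (a \<otimes> b))"
        by (insert a b r s p' q', simp add: ring_norm)
      moreover have "\<dots> \<in> P"
        using P(1) p q a b r s p' q' ab
        by (intro ideal_add[OF P(1)] ideal_r[OF P(1) p] ideal_l[OF P(1) q] ideal_l[OF P(1) ab]) auto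
      ultimately show False using S(2)[OF pr qs] P(3) by auto
    qed
  qed
  then show ?thesis using P that by blast
qed

lemma nonunit_in_maximalideal:
  assumes "ideal I R" "\<one> \<notin> I"
  obtains N where "maximalideal N R" "I \<subseteq> N"
proof -
  obtain P where P: "ideal P R" "I \<subseteq> P" "P \<inter> {\<one>} = {}"
    and max: "\<And>J. ideal J R \<Longrightarrow> P \<subseteq> J \<Longrightarrow> J \<inter> {\<one>} = {} \<Longrightarrow> J = P"
    using exists_maximal_disjoint_ideal[of I "{\<one>}"] assms by auto
  have "maximalideal P R"
  proof (rule maximalidealI[OF P(1)])
    show "carrier R \<noteq> P" using P(3) by auto
    show "J = P \<or> J = carrier R" if "ideal J R" "P \<subseteq> J" "J \<subseteq> carrier R" for J
      using max[OF that(1,2)] ideal.one_imp_carrier[OF that(1)] by blast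
  qed
  then show ?thesis using P that by blast
qed

end

lemma (in noetherian_ring) noetherian_maximal:
  assumes "I \<in> F" "\<And>I. I \<in> F \<Longrightarrow> ideal I R"
  obtains P where "P \<in> F" "\<And>J. J \<in> F \<Longrightarrow> P \<subseteq> J \<Longrightarrow> J = P"
proof -
  have "\<exists>P\<in>F. \<forall>J\<in>F. P \<subseteq> J \<longrightarrow> J = P"
  proof (rule subset_Zorn_nonempty)
    fix C assume C: "C \<noteq> {}" "subset.chain F C"
    then have "subset.chain {I. ideal I R} C"
      using assms(2) unfolding pred_on.chain_def by auto
    from ideal_chain_is_trivial[OF C(1) this] show "\<Union>C \<in> F"
      using C unfolding pred_on.chain_def by blast
  qed (use assms in auto)
  then show ?thesis using that by blast
qed

text \<open>Dimension at most one is encoded as the absence of strict chains of three primes, and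
  positive depth as a fixed non-zero-divisor \<open>t\<close> in \<open>M\<close>. All later limits
  and denominators are measured by powers of this one \<open>t\<close>.\<close>

locale local_dim_one = cring R + noetherian_ring R for R (structure) +
  fixes M t
  assumes maximal: "maximalideal M R"
    and local: "maximalideal N R \<Longrightarrow> N = M"
    and no_chain: "primeideal P0 R \<Longrightarrow> primeideal P1 R \<Longrightarrow> primeideal P2 R \<Longrightarrow> P0 \<subset> P1 \<Longrightarrow> \<not> P1 \<subset> P2"
    and tM: "t \<in> M"
    and t_reg: "y \<in> carrier R \<Longrightarrow> t \<otimes> y = \<zero> \<Longrightarrow> y = \<zero>"
begin

lemma M_ideal: "ideal M R"
  using maximal by (simp add: maximalideal_def)

lemma M_prime: "primeideal M R"
  by (rule maximalideal_prime[OF maximal])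

lemma t_carr [simp]: "t \<in> carrier R"
  using ideal_carr[OF M_ideal tM] .

lemma proper_ideal_le_M:
  assumes "ideal I R" "\<one> \<notin> I" shows "I \<subseteq> M"
  using nonunit_in_maximalideal[OF assms] local by metis

lemma prime_le_M: "primeideal P R \<Longrightarrow> P \<subseteq> M"
  using proper_ideal_le_M ideal.one_imp_carrier
  by (metis primeideal.I_notcarr primeideal.axioms(1))

lemma unit_if_notin_M:
  assumes a: "a \<in> carrier R" and "a \<notin> M"
  obtains b where "b \<in> carrier R" "a \<otimes> b = \<one>"
proof -
  have "\<one> \<in> PIdl a"
    using proper_ideal_le_M[OF cgenideal_ideal[OF a]] cgenideal_self[OF a] assms(2) by blast
  then show ?thesis using that a by (auto simp: PIdl_mem m_comm)
qed

text \<open>The elements \<open>s [^] k \<otimes> x\<close> with \<open>x\<close> outside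
  \<open>P\<close> form a multiplicative set without zero, as \<open>s\<close> is regular. A prime
  avoiding it is contained in \<open>P\<close> and misses \<open>s\<close>, hence is strictly
  smaller; if \<open>P\<close> were not \<open>M\<close>, this would give a chain of three
  primes.\<close>

lemma prime_with_regular_is_M:
  assumes P: "primeideal P R" and s: "s \<in> P" and reg: "\<And>y. y \<in> carrier R \<Longrightarrow> s \<otimes> y = \<zero> \<Longrightarrow> y = \<zero>"
  shows "P = M"
proof (rule ccontr)
  assume ne: "P \<noteq> M"
  have Pi: "ideal P R" using P by (simp add: primeideal_def)
  have s': "s \<in> carrier R" using ideal_carr[OF Pi s] .
  let ?S = "{s [^] k \<otimes> x | (k::nat) x. x \<in> carrier R - P}"
  have pw: "y = \<zero>" if "y \<in> carrier R" "s [^] (k::nat) \<otimes> y = \<zero>" for k y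
    using that
  proof (induction k arbitrary: y)
    case (Suc k)
    then have "s [^] k \<otimes> (s \<otimes> y) = \<zero>" using s' by (simp add: m_assoc)
    then show ?case using Suc s' reg by blast
  qed auto
  have "\<one> \<notin> P" using P ideal.one_imp_carrier[OF Pi] by (metis primeideal.I_notcarr)
  obtain P0 where P0: "primeideal P0 R" "P0 \<inter> ?S = {}"
  proof (rule exists_prime_disjoint[OF zeroideal, of ?S])
    show "{\<zero>} \<inter> ?S = {}" using pw[OF _ sym] ideal_zero[OF Pi] by fastforce
    have "\<one> = s [^] (0::nat) \<otimes> \<one>" by simp
    then show "\<one> \<in> ?S" using \<open>\<one> \<notin> P\<close> by blast
    fix x y assume "x \<in> ?S" "y \<in> ?S"
    then obtain k a l b where x: "x = s [^] (k::nat) \<otimes> a" "a \<in> carrier R - P"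
      and y: "y = s [^] (l::nat) \<otimes> b" "b \<in> carrier R - P" by blast
    have "x \<otimes> y = (s [^] k \<otimes> s [^] l) \<otimes> (a \<otimes> b)"
      using s' x y by (simp add: m_ac)
    also have "\<dots> = s [^] (k + l) \<otimes> (a \<otimes> b)" using s' by (simp add: nat_pow_mult)
    finally show "x \<otimes> y \<in> ?S" using x y primeideal.I_prime[OF P, of a b] by blast
  qed blast
  have "P0 \<subseteq> P"
  proof
    fix x assume x: "x \<in> P0"
    show "x \<in> P"
    proof (rule ccontr)
      assume "x \<notin> P"
      have "x \<in> carrier R" using x P0(1) ideal_carr by (metis primeideal.axioms(1))
      moreover from this have "x = s [^] (0::nat) \<otimes> x" by simp
      ultimately have "x \<in> ?S" using \<open>x \<notin> P\<close> by blast
      then show False using P0(2) x by blast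
    qed
  qed
  moreover have "s \<notin> P0"
  proof
    assume "s \<in> P0"
    moreover have "s = s [^] (1::nat) \<otimes> \<one>" using s' by simp
    then have "s \<in> ?S" using \<open>\<one> \<notin> P\<close> by blast
    ultimately show False using P0(2) by blast
  qed
  ultimately have "P0 \<subset> P" using s by blast
  moreover have "P \<subset> M" using prime_le_M[OF P] ne by blast
  ultimately show False using no_chain[OF P0(1) P M_prime] by blast
qed

lemma prime_with_t_is_M: "primeideal P R \<Longrightarrow> t \<in> P \<Longrightarrow> P = M"
  using prime_with_regular_is_M t_reg by blast

lemma t_pow_in_ideal:
  assumes I: "ideal I R" and P: "\<And>P. primeideal P R \<Longrightarrow> I \<subseteq> P \<Longrightarrow> t \<in> P"
  shows "\<exists>m::nat. t [^] m \<in> I"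
proof (rule ccontr)
  assume "\<not> ?thesis"
  then have dis: "I \<inter> range (\<lambda>m::nat. t [^] m) = {}" by blast
  have "\<one> \<in> range (\<lambda>m::nat. t [^] m)" by (rule range_eqI[of _ _ 0]) simp
  moreover have "x \<otimes> y \<in> range (\<lambda>m::nat. t [^] m)"
    if "x \<in> range (\<lambda>m::nat. t [^] m)" "y \<in> range (\<lambda>m::nat. t [^] m)" for x y
    using that by (auto simp: nat_pow_mult)
  ultimately obtain P where "primeideal P R" "I \<subseteq> P" "P \<inter> range (\<lambda>m::nat. t [^] m) = {}"
    using exists_prime_disjoint[OF I dis] by metis
  moreover have "t \<in> range (\<lambda>m::nat. t [^] m)" by (rule range_eqI[of _ _ 1]) simp
  ultimately show False using P by blast
qed

lemma t_pow_in_regular_ideal: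
  assumes I: "ideal I R" and s: "s \<in> I" "\<And>y. y \<in> carrier R \<Longrightarrow> s \<otimes> y = \<zero> \<Longrightarrow> y = \<zero>"
  shows "\<exists>m::nat. t [^] m \<in> I"
  using t_pow_in_ideal[OF I] prime_with_regular_is_M s tM by blast

text \<open>In the one-dimensional domain \<open>R/P\<close> every nonzero element divides a power
  of \<open>t\<close>: a prime containing \<open>P\<close> and \<open>a\<close> is strictly larger
  than \<open>P\<close>, so by the chain condition it is \<open>M\<close> and contains
  \<open>t\<close>. This later makes the quotient of \<open>Q\<close> by a prime a field.\<close>

lemma t_pow_in_prime_adjoin:
  assumes P: "primeideal P R" "t \<notin> P" and a: "a \<in> carrier R" "a \<notin> P"
  shows "\<exists>m::nat. \<exists>p\<in>P. \<exists>r\<in>carrier R. t [^] m = p \<oplus> r \<otimes> a"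
proof -
  have Pi: "ideal P R" using P by (simp add: primeideal_def)
  note id = Pi cgenideal_ideal[OF a(1)]
  have "t \<in> P'" if P': "primeideal P' R" "P <+> PIdl a \<subseteq> P'" for P'
  proof (rule ccontr)
    assume t: "t \<notin> P'"
    have "P \<subseteq> P'" using P'(2) ideal_sum_leftI[OF id] by blast
    moreover have "a \<in> P'" using P'(2) ideal_sum_rightI[OF id cgenideal_self[OF a(1)]] by blast
    ultimately have "P \<subset> P'" using a by blast
    moreover have "P' \<subset> M" using t tM prime_le_M[OF P'(1)] by blast
    ultimately show False using no_chain[OF P(1) P'(1) M_prime] by blast
  qed
  then obtain m :: nat where "t [^] m \<in> P <+> PIdl a"
    using t_pow_in_ideal[OF add_ideals[OF id]] by blast
  then show ?thesis unfolding ideal_sum_mem Bex_def PIdl_mem by blast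
qed

section \<open>Descending chains and the completion\<close>

abbreviation tp :: "nat \<Rightarrow> 'a set" where "tp n \<equiv> PIdl (t [^] n)"

lemma tp_ideal: "ideal (tp n) R"
  by (simp add: cgenideal_ideal)

lemma tp_carr: "x \<in> tp n \<Longrightarrow> x \<in> carrier R"
  using ideal_carr[OF tp_ideal] .

lemma tp_0: "tp 0 = carrier R"
  by (auto simp: PIdl_mem)

lemma tp_antimono: "m \<le> n \<Longrightarrow> tp n \<subseteq> tp m"
proof
  fix x assume "m \<le> n" "x \<in> tp n"
  then obtain r where r: "r \<in> carrier R" "x = r \<otimes> t [^] n" by (auto simp: PIdl_mem)
  moreover have "t [^] n = t [^] (n - m) \<otimes> t [^] m" using \<open>m \<le> n\<close> by (simp add: nat_pow_mult)
  ultimately have "x = (r \<otimes> t [^] (n - m)) \<otimes> t [^] m" by (simp add: m_assoc)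
  with r show "x \<in> tp m" unfolding PIdl_mem by (intro bexI[of _ "r \<otimes> t [^] (n - m)"]) auto
qed

lemma t_pow_reg: "y \<in> carrier R \<Longrightarrow> t [^] (n::nat) \<otimes> y = \<zero> \<Longrightarrow> y = \<zero>"
proof (induction n arbitrary: y)
  case (Suc n)
  then have "t [^] n \<otimes> (t \<otimes> y) = \<zero>" by (simp add: m_assoc)
  then have "t \<otimes> y = \<zero>" using Suc.IH[of "t \<otimes> y"] Suc.prems by simp
  then show ?case using Suc.prems(1) t_reg[of y] by simp
qed auto

lemma t_pow_cancel:
  assumes x: "x \<in> carrier R" and "t [^] (n::nat) \<otimes> x \<in> tp (n + m)"
  shows "x \<in> tp m"
proof -
  obtain r where r: "r \<in> carrier R" and eq: "t [^] n \<otimes> x = r \<otimes> t [^] (n + m)"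
    using assms by (auto simp: PIdl_mem)
  have "t [^] n \<otimes> (x \<ominus> r \<otimes> t [^] m) = t [^] n \<otimes> x \<ominus> r \<otimes> t [^] (n + m)"
    using x r by (simp add: a_minus_def r_distr r_minus m_lcomm nat_pow_mult)
  also have "\<dots> = \<zero>" using eq x r by (simp add: r_right_minus_eq)
  finally have "x \<ominus> r \<otimes> t [^] m = \<zero>" using t_pow_reg x r by simp
  then have "x = r \<otimes> t [^] m" using x r by (simp add: r_right_minus_eq)
  then show ?thesis using r unfolding PIdl_mem by blast
qed

lemma t_pow_mem_tp: "t [^] n \<in> tp n"
  by (simp add: cgenideal_self)

lemma t_pow_in_prime: "primeideal P R \<Longrightarrow> t [^] (n::nat) \<in> P \<Longrightarrow> t \<in> P"
proof (induction n)
  case 0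
  then show ?case
    by (metis Group.nat_pow_0 ideal.one_imp_carrier primeideal.I_notcarr primeideal.axioms(1))
next
  case (Suc n)
  then show ?case using primeideal.I_prime[of P R "t [^] n" t] by auto
qed

text \<open>This says that \<open>R/I\<close> is artinian, in terms of ideals of \<open>R\<close> so
  that no quotient ring appears.\<close>

definition dcc_above :: "'a set \<Rightarrow> bool" where
  "dcc_above I \<longleftrightarrow> (\<forall>D. (\<forall>k. ideal (D k) R \<and> I \<subseteq> D k \<and> D (Suc k) \<subseteq> D k) \<longrightarrow> (\<exists>k::nat. \<forall>m\<ge>k. D m = D k))"

lemma dcc_aboveD:
  assumes "dcc_above I" "\<And>k. ideal (D k) R" "\<And>k. I \<subseteq> D k" "\<And>k. D (Suc k) \<subseteq> D k"
  obtains k :: nat where "\<And>m. m \<ge> k \<Longrightarrow> D m = D k"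
  using assms unfolding dcc_above_def by metis

text \<open>\<open>(I + Rx)/I\<close> is zero or a copy of \<open>R/M\<close>, so a chain above
  \<open>I\<close> either contains \<open>x\<close> throughout or eventually meets
  \<open>I + Rx\<close> only in \<open>I\<close>. In both cases its tail is determined by the ideals
  \<open>D k <+> PIdl x\<close>.\<close>

lemma dcc_above_simple_extension:
  assumes a: "ideal I R" and x: "x \<in> carrier R" "\<And>m. m \<in> M \<Longrightarrow> m \<otimes> x \<in> I"
    and dcc: "dcc_above (I <+> PIdl x)"
  shows "dcc_above I"
  unfolding dcc_above_def
proof (intro allI impI)
  fix D :: "nat \<Rightarrow> 'a set"
  assume D: "\<forall>k. ideal (D k) R \<and> I \<subseteq> D k \<and> D (Suc k) \<subseteq> D k"
  then have Di: "\<And>k. ideal (D k) R" and ID: "\<And>k. I \<subseteq> D k" by auto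
  have anti: "D m \<subseteq> D k" if "k \<le> m" for k m
    using lift_Suc_antimono_le[of D k m] D that by blast
  note px = cgenideal_ideal[OF x(1)]
  have "x \<in> I <+> PIdl x" by (rule ideal_sum_rightI[OF a px cgenideal_self[OF x(1)]])
  obtain k0 where k0: "\<And>m. m \<ge> k0 \<Longrightarrow> D m <+> PIdl x = D k0 <+> PIdl x"
  proof (rule dcc_aboveD[OF dcc, of "\<lambda>k. D k <+> PIdl x"])
    show "ideal (D k <+> PIdl x) R" for k by (rule add_ideals[OF Di px])
    show "I <+> PIdl x \<subseteq> D k <+> PIdl x" for k using ID unfolding ideal_sum_mem subset_iff by blast
    show "D (Suc k) <+> PIdl x \<subseteq> D k <+> PIdl x" for k
      using anti[of k "Suc k"] by (fastforce simp: ideal_sum_mem)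
  qed blast
  show "\<exists>k. \<forall>m\<ge>k. D m = D k"
  proof (cases "\<forall>k. x \<in> D k")
    case True
    have "D k <+> PIdl x \<subseteq> D k" for k
    proof
      fix z assume "z \<in> D k <+> PIdl x"
      then obtain d r where z: "z = d \<oplus> r \<otimes> x" "d \<in> D k" "r \<in> carrier R"
        by (auto simp: ideal_sum_mem PIdl_mem)
      then show "z \<in> D k" using ideal_add[OF Di z(2) ideal_l[OF Di _ z(3)]] True by blast
    qed
    then have "D k <+> PIdl x = D k" for k
      using ideal_sum_leftI[OF Di px] by blast
    then show ?thesis using k0 by metis
  next
    case False
    then obtain k1 where k1: "x \<notin> D k1" by blast
    define k where "k = max k0 k1"
    have xk: "x \<notin> D k" using k1 anti[of k1 k] by (auto simp: k_def)
    have "D k \<subseteq> D m" if m: "m \<ge> k" for m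
    proof
      fix d assume d: "d \<in> D k"
      then have "d \<in> D m <+> PIdl x"
        using k0[of k] k0[of m] m ideal_sum_leftI[OF Di px d] by (auto simp: k_def)
      then obtain d' b where d': "d' \<in> D m" and b: "b \<in> carrier R" and eq: "d = d' \<oplus> b \<otimes> x"
        by (auto simp: ideal_sum_mem PIdl_mem)
      note C = ideal_carr[OF Di d] ideal_carr[OF Di d'] b x(1)
      have "b \<otimes> x = d \<ominus> d'"
        unfolding eq by (insert C, simp add: ring_norm)
      then have bx: "b \<otimes> x \<in> D k" using ideal_diff[OF Di d] d' anti[OF m] by auto
      \<comment> \<open>A unit \<open>b\<close> would put \<open>x\<close> itself into
        \<open>D k\<close>. Once \<open>b\<close> lies in \<open>M\<close>, the product
        \<open>b \<otimes> x\<close> falls into \<open>I\<close>, hence into the later ideal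
        \<open>D m\<close>.\<close>
      have "b \<in> M"
      proof (rule ccontr)
        assume "b \<notin> M"
        then obtain c where c: "c \<in> carrier R" "b \<otimes> c = \<one>" using unit_if_notin_M b by blast
        have "x = c \<otimes> (b \<otimes> x)" using c b x(1) by (metis m_assoc m_comm l_one)
        then show False using ideal_l[OF Di bx c(1)] xk by simp
      qed
      then show "d \<in> D m" using eq ideal_add[OF Di d'] x(2) ID by blast
    qed
    then show ?thesis using anti by blast
  qed
qed

text \<open>Noetherian induction on a largest failing ideal \<open>I\<close>. A maximal colon ideal
  \<open>(I : x)\<close> with \<open>x\<close> outside \<open>I\<close> is prime; it contains
  \<open>t [^] n\<close> and is therefore \<open>M\<close>. So \<open>x\<close> spans a simple
  submodule of \<open>R/I\<close>, and the chain condition descends from \<open>I + Rx\<close> to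
  \<open>I\<close>.\<close>

lemma dcc_above_tp: "dcc_above (tp n)"
proof (rule ccontr)
  assume not: "\<not> dcc_above (tp n)"
  let ?F = "{I. ideal I R \<and> tp n \<subseteq> I \<and> \<not> dcc_above I}"
  have "tp n \<in> ?F" using not tp_ideal by blast
  from noetherian_maximal[OF this] obtain I where I: "I \<in> ?F"
    and max: "\<And>J. J \<in> ?F \<Longrightarrow> I \<subseteq> J \<Longrightarrow> J = I" by (metis (no_types, lifting) mem_Collect_eq)
  have Ii: "ideal I R" and tI: "tp n \<subseteq> I" and nd: "\<not> dcc_above I" using I by auto
  have "I \<noteq> carrier R"
  proof
    assume "I = carrier R"
    have "D k = carrier R" if "\<And>k. ideal (D k) R \<and> I \<subseteq> D k \<and> D (Suc k) \<subseteq> D k" for D and k :: nat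
      using that[of k] \<open>I = carrier R\<close> ideal_carr[of "D k"] by blast
    then have "dcc_above I" unfolding dcc_above_def by metis
    with nd show False ..
  qed
  then obtain x0 where x0: "x0 \<in> carrier R" "x0 \<notin> I" using ideal_carr[OF Ii] by blast
  define col where "col x = {r \<in> carrier R. r \<otimes> x \<in> I}" for x
  have coli: "ideal (col x) R" if "x \<in> carrier R" for x
    unfolding col_def using that
    by (intro idealI') (auto simp: l_distr m_assoc ideal_zero[OF Ii] intro: ideal_add[OF Ii] ideal_l[OF Ii])
  let ?G = "{col x | x. x \<in> carrier R \<and> x \<notin> I}"
  have "col x0 \<in> ?G" using x0 by blast
  from noetherian_maximal[OF this] obtain P where PG: "P \<in> ?G"
    and Pmax: "\<And>J. J \<in> ?G \<Longrightarrow> P \<subseteq> J \<Longrightarrow> J = P" using coli by (smt (verit) mem_Collect_eq)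
  then obtain x where x: "x \<in> carrier R" "x \<notin> I" and P: "P = col x" by blast
  have "primeideal P R"
  proof (rule primeidealI)
    show "ideal P R" using P coli x by simp
    have "\<one> \<notin> P" using x by (simp add: P col_def)
    then show "carrier R \<noteq> P" by auto
    fix a b assume a: "a \<in> carrier R" and b: "b \<in> carrier R" and ab: "a \<otimes> b \<in> P"
    show "a \<in> P \<or> b \<in> P"
    proof (rule disjCI)
      assume "b \<notin> P"
      then have bx: "b \<otimes> x \<notin> I" using b by (simp add: P col_def)
      have "P \<subseteq> col (b \<otimes> x)"
      proof
        fix r assume "r \<in> P"
        then have r: "r \<in> carrier R" "r \<otimes> x \<in> I" by (auto simp: P col_def)
        then have "r \<otimes> (b \<otimes> x) = b \<otimes> (r \<otimes> x)" using b x(1) by (simp add: m_ac)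
        then show "r \<in> col (b \<otimes> x)" using r ideal_l[OF Ii r(2) b] by (simp add: col_def)
      qed
      then have "col (b \<otimes> x) = P" using Pmax bx b x(1) by blast
      moreover have "a \<in> col (b \<otimes> x)" using ab a b x(1) by (auto simp: P col_def m_assoc)
      ultimately show "a \<in> P" by simp
    qed
  qed (rule is_cring)
  moreover have "t [^] n \<in> P"
    using tI t_pow_mem_tp x(1) ideal_r[OF Ii] by (auto simp: P col_def)
  ultimately have PM: "P = M" using t_pow_in_prime prime_with_t_is_M by blast
  let ?J = "I <+> PIdl x"
  note px = cgenideal_ideal[OF x(1)]
  have "I \<subseteq> ?J" using ideal_sum_leftI[OF Ii px] by blast
  moreover have "x \<in> ?J" by (rule ideal_sum_rightI[OF Ii px cgenideal_self[OF x(1)]])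
  ultimately have "dcc_above ?J" using max[of ?J] add_ideals[OF Ii px] x(2) tI by blast
  moreover have "m \<otimes> x \<in> I" if "m \<in> M" for m using that PM by (auto simp: P col_def)
  ultimately show False using dcc_above_simple_extension[OF Ii x(1)] nd by blast
qed

section \<open>Powers of \<open>M\<close> against powers of \<open>t\<close>\<close>

abbreviation mp :: "nat \<Rightarrow> 'a set" where "mp n \<equiv> M [^]\<^bsub>ideals_set R\<^esub> n"

lemma ideals_set_monoid: "monoid (ideals_set R)"
  using ideals_set_is_comm_monoid by (simp add: comm_monoid_def)

lemma mp_ideal: "ideal (mp n) R"
  using monoid.nat_pow_closed[OF ideals_set_monoid, of M n] M_ideal by (simp add: ideals_set_def)

lemma mp_Suc: "mp (Suc n) = mp n \<cdot> M"
  by (simp add: ideals_set_def)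

lemma mp_add: "mp (m + n) = mp m \<cdot> mp n"
  using monoid.nat_pow_mult[OF ideals_set_monoid, of M m n] M_ideal by (simp add: ideals_set_def)

lemma mp_Suc_subset: "mp (Suc n) \<subseteq> mp n"
  unfolding mp_Suc using ideal_prod_inter[OF mp_ideal M_ideal] by blast

lemma t_pow_in_mp: "t [^] (n::nat) \<in> mp n"
proof (induction n)
  case 0
  then show ?case by (simp add: ideals_set_def)
next
  case (Suc n)
  then show ?case unfolding mp_Suc using ideal_prod.prod[of "t [^] n" "mp n" t M R] tM by simp
qed

lemma tp_le_mp: "tp n \<subseteq> mp n"
  using cgenideal_minimal[OF mp_ideal t_pow_in_mp] .

text \<open>This links the completion, taken along \<open>M\<close>, to the estimates, made with
  \<open>t\<close>. An ideal above \<open>tp 1\<close> that is maximal among those containing no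
  power of \<open>M\<close> is prime, since two powers of \<open>M\<close> multiply to a third;
  being a prime that contains \<open>t\<close>, it is \<open>M\<close>, which is absurd.\<close>

lemma mp_le_tp_1: "\<exists>s. mp s \<subseteq> tp 1"
proof (rule ccontr)
  assume not: "\<not> ?thesis"
  let ?F = "{I. ideal I R \<and> tp 1 \<subseteq> I \<and> (\<forall>s. \<not> mp s \<subseteq> I)}"
  have "tp 1 \<in> ?F" using not tp_ideal by blast
  from noetherian_maximal[OF this] obtain I where I: "I \<in> ?F"
    and max: "\<And>J. J \<in> ?F \<Longrightarrow> I \<subseteq> J \<Longrightarrow> J = I" by (metis (no_types, lifting) mem_Collect_eq)
  have Ii: "ideal I R" and tI: "tp 1 \<subseteq> I" and nd: "\<And>s. \<not> mp s \<subseteq> I" using I by auto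
  have adj: "\<exists>s. mp s \<subseteq> I <+> PIdl x" if x: "x \<in> carrier R" "x \<notin> I" for x
  proof -
    note px = cgenideal_ideal[OF x(1)]
    have "I \<subseteq> I <+> PIdl x" using ideal_sum_leftI[OF Ii px] by blast
    moreover have "x \<in> I <+> PIdl x" by (rule ideal_sum_rightI[OF Ii px cgenideal_self[OF x(1)]])
    ultimately show ?thesis using max[of "I <+> PIdl x"] add_ideals[OF Ii px] x(2) tI by blast
  qed
  have "primeideal I R"
  proof (rule primeidealI[OF Ii is_cring])
    show "carrier R \<noteq> I" using nd[of 0] by (auto simp: ideals_set_def)
    fix a b assume a: "a \<in> carrier R" and b: "b \<in> carrier R" and ab: "a \<otimes> b \<in> I"
    show "a \<in> I \<or> b \<in> I"
    proof (rule ccontr)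
      assume "\<not> ?thesis"
      then obtain r s where r: "mp r \<subseteq> I <+> PIdl a" and s: "mp s \<subseteq> I <+> PIdl b"
        using adj a b by meson
      have "z \<in> I" if "z \<in> mp r \<cdot> mp s" for z
        using that
      proof (induction rule: ideal_prod.induct)
        case (prod x y)
        then obtain p c q d where x: "x = p \<oplus> c \<otimes> a" "p \<in> I" "c \<in> carrier R"
          and y: "y = q \<oplus> d \<otimes> b" "q \<in> I" "d \<in> carrier R"
          using r s by (auto simp: ideal_sum_mem PIdl_mem dest!: subsetD)
        note C = a b x(3) y(3) ideal_carr[OF Ii x(2)] ideal_carr[OF Ii y(2)]
        have "x \<otimes> y = p \<otimes> (q \<oplus> d \<otimes> b) \<oplus> (c \<otimes> a \<otimes> q \<oplus> (c \<otimes> d) \<otimes> (a \<otimes> b))"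
          unfolding x(1) y(1) by (insert C, simp add: ring_norm)
        also have "\<dots> \<in> I" using C
          by (intro ideal_add[OF Ii] ideal_r[OF Ii x(2)] ideal_l[OF Ii y(2)] ideal_l[OF Ii ab]) auto
        finally show ?case .
      next
        case (sum s1 s2)
        then show ?case using ideal_add[OF Ii] by blast
      qed
      then show False using nd[of "r + s"] mp_add by blast
    qed
  qed
  then have "I = M" using prime_with_t_is_M tI t_pow_mem_tp[of 1] by auto
  moreover have "mp 1 \<subseteq> M"
    using mp_Suc[of 0] ideal_prod_inter[OF mp_ideal[of 0] M_ideal] by simp
  ultimately show False using nd by blast
qed

text \<open>
  Elements of the completion are represented by sequences that are Cauchy for the
  powers of \<open>t\<close>, which is legitimate because these are cofinal with the powers of \<open>M\<close>.
\<close>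

definition t_cauchy :: "(nat \<Rightarrow> 'a) \<Rightarrow> bool" where
  "t_cauchy a \<longleftrightarrow> (\<forall>n. a n \<in> carrier R \<and> a (Suc n) \<ominus> a n \<in> tp n)"

lemma t_cauchyD: "t_cauchy a \<Longrightarrow> a n \<in> carrier R" "t_cauchy a \<Longrightarrow> a (Suc n) \<ominus> a n \<in> tp n"
  by (auto simp: t_cauchy_def)

lemma t_cauchy_le: "t_cauchy a \<Longrightarrow> m \<le> n \<Longrightarrow> a n \<ominus> a m \<in> tp m"
proof (induction n)
  case 0
  then show ?case using ideal_zero[OF tp_ideal, of 0] t_cauchyD(1)[of a 0] by (simp add: a_minus_def r_neg)
next
  case (Suc n)
  show ?case
  proof (cases "m = Suc n")
    case True
    then show ?thesis using ideal_zero[OF tp_ideal, of "Suc n"] t_cauchyD(1)[of a "Suc n"] Suc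
      by (simp add: a_minus_def r_neg)
  next
    case False
    then have "m \<le> n" using Suc by simp
    define p q r where "p = a (Suc n)" and "q = a n" and "r = a m"
    have C: "p \<in> carrier R" "q \<in> carrier R" "r \<in> carrier R"
      using t_cauchyD(1)[OF Suc.prems(1)] by (auto simp: p_def q_def r_def)
    have "p \<ominus> r = (p \<ominus> q) \<oplus> (q \<ominus> r)" by (insert C, simp add: ring_norm)
    moreover have "p \<ominus> q \<in> tp m"
      using t_cauchyD(2)[OF Suc.prems(1), of n] tp_antimono[OF \<open>m \<le> n\<close>] by (auto simp: p_def q_def)
    moreover have "q \<ominus> r \<in> tp m" using Suc \<open>m \<le> n\<close> by (simp add: q_def r_def)
    ultimately show ?thesis using ideal_add[OF tp_ideal] by (simp add: p_def r_def)
  qed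
qed

lemma completion_nat_pow:
  assumes "\<And>n. a n \<in> carrier R"
  shows "(\<lambda>n. mp n +> a n) [^]\<^bsub>adic_completion R M\<^esub> (k::nat) = (\<lambda>n. mp n +> (a n [^] k))"
proof (induction k)
  case 0
  then show ?case by (simp add: adic_completion_def quot_pow_def FactRing_def)
next
  case (Suc k)
  have "rcoset_mult R (mp n) (mp n +> a n [^] k) (mp n +> a n) = mp n +> (a n [^] k \<otimes> a n)" for n
    using ideal.rcoset_mult_add[OF mp_ideal] assms by simp
  then show ?case using Suc by (simp add: adic_completion_def quot_pow_def FactRing_def)
qed

text \<open>Reducedness of the completion is brought in here. The cosets of the \<open>a n\<close>
  form an element of the completion, and its \<open>k\<close>-th power vanishes because
  \<open>tp n\<close> lies in \<open>mp n\<close>. The conclusion concerns \<open>mp n\<close>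
  because the completion is the \<open>M\<close>-adic one.\<close>

lemma nilpotent_t_cauchy:
  assumes red: "reduced_ring (adic_completion R M)"
    and a: "t_cauchy a" and nil: "\<And>n. a n [^] (k::nat) \<in> tp n"
  shows "a n \<in> mp n"
proof -
  define x where "x n = mp n +> a n" for n
  have ac: "\<And>n. a n \<in> carrier R" using t_cauchyD(1)[OF a] .
  have "x (Suc n) \<subseteq> x n" for n
  proof
    fix z assume "z \<in> x (Suc n)"
    then obtain h where h: "h \<in> mp (Suc n)" "z = h \<oplus> a (Suc n)"
      by (auto simp: x_def a_r_coset_def r_coset_def)
    define p q where "p = a (Suc n)" and "q = a n"
    have C: "h \<in> carrier R" "p \<in> carrier R" "q \<in> carrier R"
      using ac ideal_carr[OF mp_ideal h(1)] by (auto simp: p_def q_def)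
    have "z = (h \<oplus> (p \<ominus> q)) \<oplus> q" unfolding h(2) p_def[symmetric]
      by (insert C, simp add: ring_norm)
    moreover have "h \<oplus> (p \<ominus> q) \<in> mp n"
      using h(1) mp_Suc_subset t_cauchyD(2)[OF a, of n] tp_le_mp[of n]
      by (auto simp: p_def q_def intro!: ideal_add[OF mp_ideal])
    ultimately show "z \<in> x n" by (auto simp: x_def a_r_coset_def r_coset_def q_def)
  qed
  moreover have "x n \<in> a_rcosets (mp n)" for n
    using ac by (auto simp: x_def A_RCOSETS_def')
  ultimately have "x \<in> carrier (adic_completion R M)"
    by (simp add: adic_completion_def quot_pow_def FactRing_def)
  moreover have "x [^]\<^bsub>adic_completion R M\<^esub> k = \<zero>\<^bsub>adic_completion R M\<^esub>"
  proof -
    have "mp n +> (a n [^] k) = mp n" for n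
      using nil tp_le_mp ring.a_rcos_zero[OF ring_axioms mp_ideal] by blast
    then show ?thesis unfolding x_def completion_nat_pow[OF ac]
      by (simp add: adic_completion_def quot_pow_def FactRing_def)
  qed
  ultimately have "x = \<zero>\<^bsub>adic_completion R M\<^esub>" using red unfolding reduced_ring_def by blast
  then have "mp n +> a n = mp n"
    by (metis (no_types, lifting) FactRing_def adic_completion_def quot_pow_def ring.simps(1) x_def)
  then show ?thesis using ideal.rcos_const_imp_mem[OF mp_ideal ac] by simp
qed

section \<open>Operations on Cauchy sequences\<close>

lemma t_cauchy_add:
  assumes "t_cauchy a" "t_cauchy b" shows "t_cauchy (\<lambda>n. a n \<oplus> b n)"
  unfolding t_cauchy_def
proof (intro allI conjI)
  fix n
  define p q r s where "p = a (Suc n)" and "q = a n" and "r = b (Suc n)" and "s = b n"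
  have C: "p \<in> carrier R" "q \<in> carrier R" "r \<in> carrier R" "s \<in> carrier R"
    using t_cauchyD(1)[OF assms(1)] t_cauchyD(1)[OF assms(2)] by (auto simp: p_def q_def r_def s_def)
  have "(p \<oplus> r) \<ominus> (q \<oplus> s) = (p \<ominus> q) \<oplus> (r \<ominus> s)" by (insert C, simp add: ring_norm)
  moreover have "\<dots> \<in> tp n"
    unfolding p_def q_def r_def s_def
    by (rule ideal_add[OF tp_ideal t_cauchyD(2)[OF assms(1)] t_cauchyD(2)[OF assms(2)]])
  ultimately show "a (Suc n) \<oplus> b (Suc n) \<ominus> (a n \<oplus> b n) \<in> tp n"
    by (simp add: p_def q_def r_def s_def)
  show "a n \<oplus> b n \<in> carrier R" using C by (simp add: q_def s_def)
qed

lemma t_cauchy_smult: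
  assumes "t_cauchy a" "c \<in> carrier R" shows "t_cauchy (\<lambda>n. c \<otimes> a n)"
  unfolding t_cauchy_def
proof (intro allI conjI)
  fix n
  show "c \<otimes> a n \<in> carrier R" using t_cauchyD(1)[OF assms(1)] assms(2) by simp
  have "c \<otimes> a (Suc n) \<ominus> c \<otimes> a n = c \<otimes> (a (Suc n) \<ominus> a n)"
    using t_cauchyD(1)[OF assms(1)] assms(2) by (simp add: a_minus_def r_distr r_minus)
  then show "c \<otimes> a (Suc n) \<ominus> c \<otimes> a n \<in> tp n"
    using ideal_l[OF tp_ideal t_cauchyD(2)[OF assms(1)] assms(2)] by simp
qed

lemma t_cauchy_diff:
  assumes "t_cauchy a" "t_cauchy b" shows "t_cauchy (\<lambda>n. a n \<ominus> b n)"
proof -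
  have "a n \<ominus> b n = a n \<oplus> (\<ominus> \<one>) \<otimes> b n" for n
    using t_cauchyD(1)[OF assms(1)] t_cauchyD(1)[OF assms(2)] by (simp add: a_minus_def l_minus)
  then show ?thesis
    using t_cauchy_add[OF assms(1) t_cauchy_smult[OF assms(2), of "\<ominus> \<one>"]] by simp
qed

lemma t_cauchy_zero: "t_cauchy (\<lambda>n. \<zero>)"
  using ideal_zero[OF tp_ideal] by (simp add: t_cauchy_def a_minus_def)

lemma t_cauchy_pow:
  assumes "t_cauchy a" shows "t_cauchy (\<lambda>n. a n [^] (j::nat))"
  unfolding t_cauchy_def
  using t_cauchyD[OF assms] pow_diff_ideal[OF tp_ideal] by simp

text \<open>This is the compactness argument behind Chevalley's theorem on descending chains in a
  complete local ring. Modulo each \<open>t^n\<close> the chain is stationary from an index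
  \<open>\<kappa> n\<close> on, so an element of \<open>D (\<kappa> n)\<close> lies in every
  \<open>D k\<close> modulo \<open>t^n\<close>; an element of \<open>tp n\<close> therefore corrects
  it to one in \<open>D (\<kappa> (Suc n))\<close>.\<close>

lemma decreasing_ideals_limit:
  assumes D: "\<And>k. ideal (D k) R" "\<And>k. D (Suc k) \<subseteq> D k" and not: "\<And>k. \<not> D k \<subseteq> tp 1"
  obtains x where "t_cauchy x" "x 1 \<notin> tp 1" "\<And>n k. x n \<in> D k <+> tp n"
proof -
  have anti: "D m \<subseteq> D k" if "k \<le> m" for k m
    using lift_Suc_antimono_le[of D k m] D(2) that by blast
  have "\<exists>\<kappa>. \<forall>k. D \<kappa> \<subseteq> D k <+> tp n" for n
  proof -
    obtain \<kappa> where \<kappa>: "\<And>m. m \<ge> \<kappa> \<Longrightarrow> D m <+> tp n = D \<kappa> <+> tp n"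
    proof (rule dcc_aboveD[OF dcc_above_tp[of n], where D = "\<lambda>k. D k <+> tp n"])
      show "ideal (D k <+> tp n) R" for k by (rule add_ideals[OF D(1) tp_ideal])
      show "tp n \<subseteq> D k <+> tp n" for k using ideal_sum_rightI[OF D(1) tp_ideal] by blast
      show "D (Suc k) <+> tp n \<subseteq> D k <+> tp n" for k
        using D(2)[of k] unfolding ideal_sum_mem subset_iff by blast
    qed blast
    have "D \<kappa> \<subseteq> D k <+> tp n" for k
    proof (cases "\<kappa> \<le> k")
      case True
      then show ?thesis using \<kappa>[OF True] ideal_sum_leftI[OF D(1) tp_ideal] by blast
    next
      case False
      then show ?thesis using anti[of k \<kappa>] ideal_sum_leftI[OF D(1) tp_ideal] by force
    qed
    then show ?thesis by blast
  qed
  then obtain \<kappa> where \<kappa>: "\<And>n k. D (\<kappa> n) \<subseteq> D k <+> tp n" by metis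
  \<comment> \<open>Staying outside \<open>tp 1\<close> is demanded from index 1 on: the step from 0
    to 1 is unconstrained, since \<open>tp 0\<close> is the whole ring, and afterwards congruence
    modulo \<open>t\<close> preserves the property.\<close>
  let ?P = "\<lambda>n x. x \<in> carrier R \<and> (\<forall>k. x \<in> D k <+> tp n) \<and> (n \<ge> 1 \<longrightarrow> x \<notin> tp 1)"
  have "\<exists>x. \<forall>n. ?P n (x n) \<and> x (Suc n) \<ominus> x n \<in> tp n"
  proof (rule dependent_nat_choice)
    show "\<exists>x. ?P 0 x"
      using ideal_zero[OF add_ideals[OF D(1) tp_ideal[of 0]]] by (intro exI[of _ \<zero>]) simp
    fix x n assume x: "?P n x"
    show "\<exists>y. ?P (Suc n) y \<and> y \<ominus> x \<in> tp n"
    proof (cases "n = 0")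
      case True
      obtain d where d: "d \<in> D (\<kappa> 1)" "d \<notin> tp 1" using not by blast
      have "d \<in> carrier R" using ideal_carr[OF D(1) d(1)] .
      moreover from this have "d \<ominus> x \<in> tp 0" using x unfolding tp_0 by simp
      ultimately show ?thesis using d \<kappa>[of 1] True by (intro exI[of _ d]) auto
    next
      case False
      obtain d h where d: "d \<in> D (\<kappa> (Suc n))" and h: "h \<in> tp n" and xe: "x = d \<oplus> h"
        using x unfolding ideal_sum_mem by blast
      have C: "d \<in> carrier R" "h \<in> carrier R" using ideal_carr[OF D(1) d] tp_carr[OF h] by auto
      have "d \<ominus> x = \<ominus> h" unfolding xe by (insert C, simp add: ring_norm)
      then have dx: "d \<ominus> x \<in> tp n" using ideal_uminus[OF tp_ideal h] by simp
      moreover have "d \<notin> tp 1"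
      proof -
        have "d \<ominus> x \<in> tp 1" using dx tp_antimono[of 1 n] False by auto
        moreover have "x \<notin> tp 1" using x False by (simp add: Suc_le_eq)
        ultimately show ?thesis using ideal_diff_iff[OF tp_ideal C(1), of x 1] x by blast
      qed
      ultimately show ?thesis using d \<kappa>[of "Suc n"] C by (intro exI[of _ d]) auto
    qed
  qed
  then obtain x where x: "\<And>n. ?P n (x n)" "\<And>n. x (Suc n) \<ominus> x n \<in> tp n" by blast
  show ?thesis
    by (rule that[of x]) (use x in \<open>auto simp: t_cauchy_def\<close>)
qed

text \<open>
  A version of Fitting's lemma in the completion: after inverting \<open>t\<close>, the principal
  ideals generated by the powers of \<open>x\<close> become stationary. The sets \<open>W j a\<close> describe the
  saturated ideals \<open>(x\<^sup>j : t\<^sup>a)\<close> modulo \<open>t\<close>.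
\<close>

lemma t_cauchy_fitting:
  assumes x: "t_cauchy x"
  obtains a j :: nat where "\<And>n. t [^] a \<otimes> x n [^] j \<in> PIdl (x n [^] Suc j) <+> tp n"
proof -
  have xc [simp]: "x n \<in> carrier R" for n using t_cauchyD(1)[OF x] .
  define J where "J j n = PIdl (x n [^] (j::nat)) <+> tp n" for j n
  have pI: "ideal (PIdl (x n [^] (j::nat))) R" for j n by (simp add: cgenideal_ideal)
  have Ji: "ideal (J j n) R" for j n unfolding J_def by (rule add_ideals[OF pI tp_ideal])
  have tJ: "tp n \<subseteq> J j n" for j n unfolding J_def using ideal_sum_rightI[OF pI tp_ideal] by blast
  have xJ: "x n [^] j \<in> J j n" for j n
    unfolding J_def by (rule ideal_sum_leftI[OF pI tp_ideal]) (simp add: cgenideal_self)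
  have Jmin: "J j n \<subseteq> I" if "ideal I R" "tp n \<subseteq> I" "x n [^] j \<in> I" for I j n
    using cgenideal_minimal[OF that(1,3)] that(2) ideal_add[OF that(1)] unfolding J_def ideal_sum_mem subset_iff by blast
  have JSuc: "J (Suc j) n \<subseteq> J j n" for j n
    by (rule Jmin[OF Ji tJ]) (use ideal_r[OF Ji xJ] in simp)
  have Jshift: "J j (Suc n) \<subseteq> J j n" for j n
  proof (rule Jmin[OF Ji])
    show "tp (Suc n) \<subseteq> J j n" by (rule order_trans[OF tp_antimono tJ]) simp
    have "x (Suc n) [^] j \<ominus> x n [^] j \<in> J j n"
      by (rule subsetD[OF tJ pow_diff_ideal[OF tp_ideal xc xc t_cauchyD(2)[OF x]]])
    then show "x (Suc n) [^] j \<in> J j n"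
      using ideal_diff_iff[OF Ji nat_pow_closed[OF xc] nat_pow_closed[OF xc]] xJ by blast
  qed
  \<comment> \<open>\<open>w\<close> represents an element of the completion lying in
    \<open>(x^j : t^a)\<close>. \<open>W\<close> keeps its residue modulo \<open>t\<close>, so that
    \<open>W j a\<close> is an ideal of \<open>R\<close> above \<open>tp 1\<close> and both chain
    conditions apply to it.\<close>
  define G where "G j a w \<longleftrightarrow> t_cauchy w \<and> (\<forall>N. t [^] (a::nat) \<otimes> w N \<in> J j N)" for j a w
  define W where "W j a = {u \<in> carrier R. \<exists>w. G j a w \<and> w 1 \<ominus> u \<in> tp 1}" for j a
  have GD: "w N \<in> carrier R" if "G j a w" for j a w N using that t_cauchyD(1) by (auto simp: G_def)
  have Gadd: "G j a (\<lambda>n. w n \<oplus> w' n)" if "G j a w" "G j a w'" for j a w w'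
    using that t_cauchy_add ideal_add[OF Ji] GD[OF that(1)] GD[OF that(2)]
    unfolding G_def by (simp add: r_distr)
  have Gsmult: "G j a (\<lambda>n. c \<otimes> w n)" if "G j a w" "c \<in> carrier R" for j a w c
    using that t_cauchy_smult ideal_l[OF Ji] GD[OF that(1)]
    unfolding G_def by (simp add: m_lcomm)
  have G0: "G j a (\<lambda>n. \<zero>)" for j a using t_cauchy_zero ideal_zero[OF Ji] by (simp add: G_def)
  have Gmono: "G j (b + a) w" if "G j a w" for j a b w
    using that ideal_l[OF Ji, of _ _ _ "t [^] b"] GD[OF that]
    unfolding G_def by (simp add: m_assoc flip: nat_pow_mult)
  have GSuc: "G j a w" if "G (Suc j) a w" for j a w using that JSuc unfolding G_def by blast
  have tW: "tp 1 \<subseteq> W j a" for j a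
  proof
    fix u assume u: "u \<in> tp 1"
    have "\<zero> \<ominus> u \<in> tp 1" using ideal_diff[OF tp_ideal ideal_zero[OF tp_ideal] u] .
    then show "u \<in> W j a" using tp_carr[OF u] G0[of j a] by (auto simp: W_def)
  qed
  have Wi: "ideal (W j a) R" for j a
  proof (rule idealI')
    show "W j a \<subseteq> carrier R" by (auto simp: W_def)
    show "\<zero> \<in> W j a" using tW ideal_zero[OF tp_ideal] by blast
  next
    fix u u' assume "u \<in> W j a" "u' \<in> W j a"
    then obtain w w' where w: "G j a w" "w 1 \<ominus> u \<in> tp 1" "G j a w'" "w' 1 \<ominus> u' \<in> tp 1"
      and u: "u \<in> carrier R" "u' \<in> carrier R" by (auto simp: W_def)
    define p q where "p = w 1" and "q = w' 1"
    have C: "p \<in> carrier R" "q \<in> carrier R" "u \<in> carrier R" "u' \<in> carrier R"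
      using GD[OF w(1)] GD[OF w(3)] u by (auto simp: p_def q_def)
    have "(p \<oplus> q) \<ominus> (u \<oplus> u') = (p \<ominus> u) \<oplus> (q \<ominus> u')" by (insert C, simp add: ring_norm)
    then have "(p \<oplus> q) \<ominus> (u \<oplus> u') \<in> tp 1" using ideal_add[OF tp_ideal w(2) w(4)] by (simp add: p_def q_def)
    then show "u \<oplus> u' \<in> W j a" using u Gadd[OF w(1,3)] by (auto simp: W_def p_def q_def)
  next
    fix c u assume c: "c \<in> carrier R" and "u \<in> W j a"
    then obtain w where w: "G j a w" "w 1 \<ominus> u \<in> tp 1" and u: "u \<in> carrier R" by (auto simp: W_def)
    have "c \<otimes> w 1 \<ominus> c \<otimes> u = c \<otimes> (w 1 \<ominus> u)"
      using c u GD[OF w(1)] by (simp add: a_minus_def r_distr r_minus)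
    then have "c \<otimes> w 1 \<ominus> c \<otimes> u \<in> tp 1" using ideal_l[OF tp_ideal w(2) c] by simp
    then show "c \<otimes> u \<in> W j a" using u c Gsmult[OF w(1) c] by (auto simp: W_def)
  qed
  have Wmono: "W j a \<subseteq> W j (b + a)" for j a b unfolding W_def using Gmono by blast
  have "\<exists>a. \<forall>b. W j b \<subseteq> W j a" for j
  proof -
    have "W j 0 \<in> range (W j)" by blast
    from noetherian_maximal[OF this] obtain P where P: "P \<in> range (W j)"
      and max: "\<And>I. I \<in> range (W j) \<Longrightarrow> P \<subseteq> I \<Longrightarrow> I = P" using Wi by (metis rangeE)
    then obtain a where a: "P = W j a" by blast
    have "W j b \<subseteq> W j a" for b
      using max[of "W j (b + a)"] Wmono[of j a b] Wmono[of j b a] a by (simp add: add.commute)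
    then show ?thesis by blast
  qed
  then obtain A where A: "\<And>j b. W j b \<subseteq> W j (A j)" by metis
  obtain k where k: "\<And>m. m \<ge> k \<Longrightarrow> W m (A m) = W k (A k)"
  proof (rule dcc_aboveD[OF dcc_above_tp[of 1], where D = "\<lambda>j. W j (A j)"])
    show "W (Suc j) (A (Suc j)) \<subseteq> W j (A j)" for j
    proof -
      have "W (Suc j) (A (Suc j)) \<subseteq> W j (A (Suc j))" unfolding W_def using GSuc by blast
      then show ?thesis using A[of j "A (Suc j)"] by blast
    qed
  qed (use Wi tW in auto)
  \<comment> \<open>\<open>A j\<close> is where \<open>W j\<close> stops growing in its exponent,
    and \<open>k\<close> is where \<open>W j (A j)\<close> stops shrinking. So one exponent
    \<open>a\<close> at level \<open>Suc k\<close> serves every \<open>b\<close> at level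
    \<open>k\<close>.\<close>
  define a where "a = A (Suc k)"
  have key: "W k b \<subseteq> W (Suc k) a" for b using A[of k b] k[of "Suc k"] by (simp add: a_def)
  \<comment> \<open>A \<open>t\<close>-adic expansion: \<open>z'\<close> agrees modulo
    \<open>t\<close> with some \<open>w\<close> in \<open>(x^(k+1) : t^a)\<close>, and
    \<open>(z' - w)/t\<close> is treated next. Its own exponent \<open>b'\<close> grows in each
    round, which is harmless because \<open>a\<close> does not depend on it.\<close>
  have tele: "\<exists>s z' b'. G k b' z' \<and> (\<forall>N. s N \<in> carrier R \<and> t [^] a \<otimes> s N \<in> J (Suc k) N)
      \<and> (\<forall>N. z N \<ominus> (s N \<oplus> t [^] n \<otimes> z' N) \<in> tp N)" if z: "G k b z" for z b and n :: nat
  proof (induction n)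
    case 0
    have "z N \<ominus> (\<zero> \<oplus> t [^] (0::nat) \<otimes> z N) \<in> tp N" for N
      using GD[OF z] ideal_zero[OF tp_ideal] by (simp add: a_minus_def r_neg)
    then show ?case using z ideal_zero[OF Ji]
      by (intro exI[of _ "\<lambda>N. \<zero>"] exI[of _ z] exI[of _ b]) auto
  next
    case (Suc n)
    then obtain s z' b' where z': "G k b' z'" and s: "\<And>N. s N \<in> carrier R" "\<And>N. t [^] a \<otimes> s N \<in> J (Suc k) N"
      and zs: "\<And>N. z N \<ominus> (s N \<oplus> t [^] n \<otimes> z' N) \<in> tp N" by blast
    have zc: "z N \<in> carrier R" and z'c: "z' N \<in> carrier R" for N using GD[OF z] GD[OF z'] by auto
    have "z' 1 \<in> W k b'" using z' z'c ideal_zero[OF tp_ideal, of 1]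
      by (auto simp: W_def a_minus_def r_neg intro!: exI[of _ z'])
    then obtain w where w: "G (Suc k) a w" "w 1 \<ominus> z' 1 \<in> tp 1" using key by (auto simp: W_def)
    have wc: "w N \<in> carrier R" for N using GD[OF w(1)] .
    define y where "y N = z' N \<ominus> w N" for N
    have yc: "y N \<in> carrier R" for N using z'c wc by (simp add: y_def)
    have ycau: "t_cauchy y" unfolding y_def using z' w by (auto simp: G_def intro: t_cauchy_diff)
    have "y 1 = \<ominus> (w 1 \<ominus> z' 1)" using z'c wc unfolding y_def by (simp add: a_minus_def minus_add a_comm)
    then have "y 1 \<in> tp 1" using ideal_uminus[OF tp_ideal w(2)] by simp
    moreover have "y (Suc N) \<ominus> y 1 \<in> tp 1" for N using t_cauchy_le[OF ycau, of 1 "Suc N"] by simp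
    ultimately have "y (Suc N) \<in> tp 1" for N using ideal_diff_iff[OF tp_ideal yc yc] by blast
    then have "\<exists>r\<in>carrier R. y (Suc N) = t \<otimes> r" for N by (auto simp: PIdl_mem m_comm)
    \<comment> \<open>Division by \<open>t\<close> costs one power of precision, hence the index
      shift \<open>q N = y (Suc N) / t\<close>, which makes \<open>q\<close> Cauchy again.\<close>
    then obtain q where q: "\<And>N. q N \<in> carrier R" "\<And>N. y (Suc N) = t \<otimes> q N" by metis
    have "G k (b' + a + 1) q"
      unfolding G_def t_cauchy_def
    proof (intro conjI allI)
      fix N
      show "q N \<in> carrier R" by (rule q)
      have "t [^] (1::nat) \<otimes> (q (Suc N) \<ominus> q N) = y (Suc (Suc N)) \<ominus> y (Suc N)"
        using q by (simp add: a_minus_def r_distr r_minus)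
      also have "\<dots> \<in> tp (1 + N)" using t_cauchyD(2)[OF ycau, of "Suc N"] by simp
      finally show "q (Suc N) \<ominus> q N \<in> tp N" using t_pow_cancel q by blast
      have "G k (b' + a) w" using Gmono[OF GSuc[OF w(1)], of b'] .
      moreover have "G k (b' + a) z'" using Gmono[OF z', of a] by (simp add: add.commute)
      ultimately have "t [^] (b' + a) \<otimes> z' (Suc N) \<ominus> t [^] (b' + a) \<otimes> w (Suc N) \<in> J k (Suc N)"
        using ideal_diff[OF Ji] by (auto simp: G_def)
      moreover have "t [^] (b' + a + 1) \<otimes> q N = t [^] (b' + a) \<otimes> y (Suc N)"
        using q by (simp add: m_assoc)
      ultimately show "t [^] (b' + a + 1) \<otimes> q N \<in> J k N"
        using Jshift[of k N] z'c wc by (auto simp: y_def a_minus_def r_distr r_minus)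
    qed
    moreover have "s N \<oplus> t [^] n \<otimes> w N \<in> carrier R \<and> t [^] a \<otimes> (s N \<oplus> t [^] n \<otimes> w N) \<in> J (Suc k) N" for N
    proof -
      have "t [^] a \<otimes> (s N \<oplus> t [^] n \<otimes> w N) = t [^] a \<otimes> s N \<oplus> t [^] n \<otimes> (t [^] a \<otimes> w N)"
        using s wc by (simp add: r_distr m_lcomm)
      then show ?thesis using s wc ideal_add[OF Ji s(2) ideal_l[OF Ji]] w(1) by (simp add: G_def)
    qed
    moreover have "z N \<ominus> ((s N \<oplus> t [^] n \<otimes> w N) \<oplus> t [^] Suc n \<otimes> q N) \<in> tp N" for N
    proof -
      define zz ss tt ww yy zz' where d: "zz = z N" "ss = s N" "tt = t [^] n" "ww = w N" "yy = y (Suc N)" "zz' = z' N"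
      have C: "zz \<in> carrier R" "ss \<in> carrier R" "tt \<in> carrier R" "ww \<in> carrier R" "yy \<in> carrier R" "zz' \<in> carrier R"
        using zc s wc yc z'c by (auto simp: d)
      have "zz \<ominus> ((ss \<oplus> tt \<otimes> ww) \<oplus> tt \<otimes> yy) = (zz \<ominus> (ss \<oplus> tt \<otimes> zz')) \<ominus> tt \<otimes> (yy \<ominus> (zz' \<ominus> ww))"
        by (insert C, simp add: ring_norm)
      also have "\<dots> \<in> tp N"
        using ideal_diff[OF tp_ideal zs ideal_l[OF tp_ideal t_cauchyD(2)[OF ycau]]] C(3)
        by (simp add: d y_def)
      finally show ?thesis using q by (simp add: d m_assoc)
    qed
    ultimately show ?case
      by (intro exI[of _ "\<lambda>N. s N \<oplus> t [^] n \<otimes> w N"] exI[of _ q] exI[of _ "b' + a + 1"]) blast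
  qed
  show ?thesis
  proof (rule that[of a k])
    fix n
    \<comment> \<open>Starting from \<open>x^k\<close> and using \<open>n\<close> rounds, the
      remainder \<open>t^n z'\<close> is absorbed by \<open>tp n\<close>.\<close>
    have "G k 0 (\<lambda>N. x N [^] k)" unfolding G_def using t_cauchy_pow[OF x] xJ by simp
    from tele[OF this, of n] obtain s z' b' where z': "G k b' z'"
      and s: "s n \<in> carrier R" "t [^] a \<otimes> s n \<in> J (Suc k) n"
      and zs: "x n [^] k \<ominus> (s n \<oplus> t [^] n \<otimes> z' n) \<in> tp n" by blast
    have "t [^] n \<otimes> z' n \<in> tp n" using ideal_r[OF tp_ideal t_pow_mem_tp GD[OF z']] .
    then have "x n [^] k \<ominus> (s n \<oplus> t [^] n \<otimes> z' n) \<oplus> t [^] n \<otimes> z' n \<in> tp n"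
      using ideal_add[OF tp_ideal zs] by blast
    moreover have "x n [^] k \<ominus> (s n \<oplus> t [^] n \<otimes> z' n) \<oplus> t [^] n \<otimes> z' n = x n [^] k \<ominus> s n"
    proof -
      define p q r where d: "p = x n [^] k" "q = s n" "r = t [^] n \<otimes> z' n"
      have C: "p \<in> carrier R" "q \<in> carrier R" "r \<in> carrier R" using s GD[OF z'] by (auto simp: d)
      have "p \<ominus> (q \<oplus> r) \<oplus> r = p \<ominus> q" by (insert C, simp add: ring_norm)
      then show ?thesis by (simp add: d)
    qed
    ultimately have "x n [^] k \<ominus> s n \<in> J (Suc k) n" using tJ[of n "Suc k"] by auto
    then have "t [^] a \<otimes> (x n [^] k \<ominus> s n) \<in> J (Suc k) n"
      by (rule ideal_l[OF Ji]) simp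
    then have "t [^] a \<otimes> x n [^] k \<ominus> t [^] a \<otimes> s n \<in> J (Suc k) n"
      using s by (simp add: a_minus_def r_distr r_minus)
    then show "t [^] a \<otimes> x n [^] k \<in> PIdl (x n [^] Suc k) <+> tp n"
      using ideal_diff_iff[OF Ji _ _ , of "t [^] a \<otimes> x n [^] k" "t [^] a \<otimes> s n" "Suc k" n] s
      unfolding J_def by simp
  qed
qed

text \<open>By \<open>fit\<close>, multiplying \<open>x^j\<close> by \<open>t^a\<close> buys one
  more factor \<open>x\<close>, which by \<open>growth\<close> is worth \<open>t^(a+1)\<close>.
  After \<open>m\<close> rounds \<open>x^j\<close> has gained \<open>t^m\<close> up to the constant
  \<open>B\<close>, and \<open>m\<close> is arbitrary.\<close>

lemma t_cauchy_pow_null: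
  fixes a j B :: nat
  assumes x: "t_cauchy x"
    and fit: "\<And>n. t [^] a \<otimes> x n [^] j \<in> PIdl (x n [^] Suc j) <+> tp n"
    and growth: "\<And>N n. N \<ge> Suc a \<Longrightarrow> t [^] B \<otimes> x N [^] n \<in> tp (Suc a * n)"
  shows "x n [^] j \<in> tp n"
proof -
  have xc [simp]: "x n \<in> carrier R" for n using t_cauchyD(1)[OF x] .
  have pI: "ideal (PIdl (x n [^] (j::nat))) R" for j n by (simp add: cgenideal_ideal)
  have iter: "t [^] (a * m) \<otimes> x N [^] j \<in> PIdl (x N [^] (j + m)) <+> tp N" for N and m :: nat
  proof (induction m)
    case 0
    then show ?case using ideal_sum_leftI[OF pI tp_ideal] by (simp add: cgenideal_self)
  next
    case (Suc m)
    note id = add_ideals[OF pI tp_ideal]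
    from Suc obtain c h where c: "c \<in> carrier R" and h: "h \<in> tp N"
      and eq: "t [^] (a * m) \<otimes> x N [^] j = c \<otimes> x N [^] (j + m) \<oplus> h"
      unfolding PIdl_sum_mem by blast
    from fit[of N] obtain e h' where e: "e \<in> carrier R" and h': "h' \<in> tp N"
      and eq': "t [^] a \<otimes> x N [^] j = e \<otimes> x N [^] Suc j \<oplus> h'"
      unfolding PIdl_sum_mem by blast
    note hc = tp_carr[OF h] tp_carr[OF h']
    have "t [^] (a * Suc m) \<otimes> x N [^] j = t [^] a \<otimes> (t [^] (a * m) \<otimes> x N [^] j)"
      by (simp add: nat_pow_mult flip: m_assoc)
    also have "\<dots> = c \<otimes> x N [^] m \<otimes> (t [^] a \<otimes> x N [^] j) \<oplus> t [^] a \<otimes> h"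
      unfolding eq using c hc by (simp add: r_distr m_ac flip: nat_pow_mult)
    also have "\<dots> = (c \<otimes> x N [^] m \<otimes> e \<otimes> x N [^] Suc j) \<oplus> (c \<otimes> x N [^] m \<otimes> h' \<oplus> t [^] a \<otimes> h)"
      unfolding eq' using c e hc by (simp add: r_distr m_assoc a_assoc)
    also have "c \<otimes> x N [^] m \<otimes> e \<otimes> x N [^] Suc j = (c \<otimes> e) \<otimes> x N [^] (j + Suc m)"
      using c e by (simp add: m_ac flip: nat_pow_mult)
    also have "(c \<otimes> e) \<otimes> x N [^] (j + Suc m) \<oplus> (c \<otimes> x N [^] m \<otimes> h' \<oplus> t [^] a \<otimes> h) \<in> PIdl (x N [^] (j + Suc m)) <+> tp N"
      unfolding PIdl_sum_mem
    proof (rule bexI[of _ "c \<otimes> e"], rule bexI, rule refl)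
      show "c \<otimes> x N [^] m \<otimes> h' \<oplus> t [^] a \<otimes> h \<in> tp N"
        using c by (intro ideal_add[OF tp_ideal ideal_l[OF tp_ideal h'] ideal_l[OF tp_ideal h]]) auto
    qed (use c e in auto)
    finally show ?case .
  qed
  \<comment> \<open>With this \<open>m\<close> the surplus \<open>(a+1)(j+m) - (B + a m)\<close> is
    at least \<open>n\<close>.\<close>
  define m where "m = n + B"
  \<comment> \<open>\<open>N\<close> is large enough for the error term in \<open>tp N\<close> to be
    divisible by \<open>t^((a+1)(j+m))\<close> and for \<open>growth\<close> to apply; at the end
    the result passes from \<open>x N\<close> to \<open>x n\<close> by congruence modulo
    \<open>tp n\<close>.\<close>
  define N where "N = Suc a * (j + m) + Suc a"
  have Nn: "n \<le> N" by (simp add: N_def m_def)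
  from iter[of m N] obtain c h where c: "c \<in> carrier R" and h: "h \<in> tp N"
    and eq: "t [^] (a * m) \<otimes> x N [^] j = c \<otimes> x N [^] (j + m) \<oplus> h"
    unfolding PIdl_sum_mem by blast
  let ?T = "tp (Suc a * (j + m))"
  have h': "h \<in> ?T" using h tp_antimono[of "Suc a * (j + m)" N] by (auto simp: N_def)
  have "t [^] (B + a * m) \<otimes> x N [^] j = t [^] B \<otimes> (t [^] (a * m) \<otimes> x N [^] j)"
    by (simp add: nat_pow_mult flip: m_assoc)
  also have "\<dots> = c \<otimes> (t [^] B \<otimes> x N [^] (j + m)) \<oplus> t [^] B \<otimes> h"
    unfolding eq using c tp_carr[OF h] by (simp add: r_distr m_lcomm)
  also have "\<dots> \<in> ?T"
  proof (rule ideal_add[OF tp_ideal])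
    have "Suc a \<le> N" by (simp add: N_def)
    from growth[OF this] show "c \<otimes> (t [^] B \<otimes> x N [^] (j + m)) \<in> ?T"
      using ideal_l[OF tp_ideal _ c] by blast
    show "t [^] B \<otimes> h \<in> ?T" using ideal_l[OF tp_ideal h'] by simp
  qed
  also have "?T \<subseteq> tp ((B + a * m) + n)" by (rule tp_antimono) (simp add: m_def algebra_simps)
  finally have "x N [^] j \<in> tp n" by (rule t_pow_cancel[rotated]) simp
  then show ?thesis
    using pow_diff_ideal[OF tp_ideal xc xc t_cauchy_le[OF x Nn]]
      ideal_diff_iff[OF tp_ideal nat_pow_closed[OF xc] nat_pow_closed[OF xc]] by blast
qed

text \<open>Growth is imposed on the whole coset \<open>d + t^k R\<close> because the limit
  \<open>x\<close> produced from a counterexample is known only modulo \<open>t^k\<close>: all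
  \<open>x N\<close> with \<open>N \<ge> k\<close> lie in one such coset.\<close>

lemma decreasing_ideals_le_tp_1:
  assumes red: "reduced_ring (adic_completion R M)"
    and D: "\<And>k. ideal (D k) R" "\<And>k. D (Suc k) \<subseteq> D k"
    and growth: "\<And>k d. d \<in> D k \<Longrightarrow> \<exists>B::nat. \<forall>n. \<forall>r\<in>carrier R. t [^] B \<otimes> (d \<oplus> t [^] k \<otimes> r) [^] n \<in> tp (k * n)"
  shows "\<exists>k. D k \<subseteq> tp 1"
proof (rule ccontr)
  assume "\<not> ?thesis"
  then obtain x where x: "t_cauchy x" and x1: "x 1 \<notin> tp 1" and xD: "\<And>n k. x n \<in> D k <+> tp n"
    using decreasing_ideals_limit[of D] D by metis
  have xc [simp]: "x n \<in> carrier R" for n using t_cauchyD(1)[OF x] .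
  obtain a j :: nat where fit: "\<And>n. t [^] a \<otimes> x n [^] j \<in> PIdl (x n [^] Suc j) <+> tp n"
    by (rule t_cauchy_fitting[OF x]) (rule that)
  \<comment> \<open>The growth rate has to exceed the cost \<open>a\<close> of one Fitting
    step.\<close>
  define k where "k = Suc a"
  obtain d h where d: "d \<in> D k" and h: "h \<in> tp k" and xk: "x k = d \<oplus> h"
    using xD[of k k] unfolding ideal_sum_mem by blast
  obtain B :: nat where B: "\<And>n r. r \<in> carrier R \<Longrightarrow> t [^] B \<otimes> (d \<oplus> t [^] k \<otimes> r) [^] n \<in> tp (k * n)"
    using growth[OF d] by blast
  have "t [^] B \<otimes> x N [^] n \<in> tp (Suc a * n)" if N: "N \<ge> Suc a" for N n
  proof -
    define y where "y = x N"
    have C: "d \<in> carrier R" "h \<in> carrier R" "y \<in> carrier R"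
      using ideal_carr[OF D(1) d] tp_carr[OF h] by (auto simp: y_def)
    have "(y \<ominus> (d \<oplus> h)) \<oplus> h \<in> tp k"
      using ideal_add[OF tp_ideal t_cauchy_le[OF x, of k N] h] N by (simp add: k_def y_def flip: xk)
    also have "(y \<ominus> (d \<oplus> h)) \<oplus> h = y \<ominus> d" by (insert C, simp add: ring_norm)
    finally obtain r where r: "r \<in> carrier R" "y \<ominus> d = t [^] k \<otimes> r" by (auto simp: PIdl_mem m_comm)
    have "d \<oplus> (y \<ominus> d) = y" by (insert C, simp add: ring_norm)
    then show ?thesis using B[OF r(1), of n] r(2) by (simp add: k_def y_def)
  qed
  from nilpotent_t_cauchy[OF red x t_cauchy_pow_null[OF x fit this]]
  have mp: "x n \<in> mp n" for n by blast
  \<comment> \<open>This turns \<open>M\<close>-adic vanishing of \<open>x\<close> into divisibility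
    by \<open>t\<close>, against \<open>x 1 \<notin> tp 1\<close>.\<close>
  obtain s where s: "mp s \<subseteq> tp 1" using mp_le_tp_1 by blast
  have "mp (Suc s) \<subseteq> mp s" by (rule mp_Suc_subset)
  then have "x (Suc s) \<in> tp 1" using mp[of "Suc s"] s by blast
  moreover have "x (Suc s) \<ominus> x 1 \<in> tp 1" using t_cauchy_le[OF x, of 1 "Suc s"] by simp
  ultimately show False using x1 ideal_diff_iff[OF tp_ideal xc xc] by blast
qed

end

section \<open>Existence of valuation rings\<close>

context cring
begin

text \<open>These are values at \<open>x\<close> of polynomials over \<open>A\<close> of degree less
  than \<open>n\<close>. With the strict bound, integrality of \<open>y\<close> over
  \<open>A\<close> reads \<open>y [^] n \<in> poly_lt A y n\<close>, and degree arguments stay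
  inside the ambient ring.\<close>

primrec poly_lt :: "'a set \<Rightarrow> 'a \<Rightarrow> nat \<Rightarrow> 'a set" where
  "poly_lt A x 0 = {\<zero>}"
| "poly_lt A x (Suc n) = {f \<oplus> a \<otimes> x [^] n | f a. f \<in> poly_lt A x n \<and> a \<in> A}"

lemma subring_plus_ideal:
  assumes B: "subring B R" and N: "ideal N R"
  shows "subring (B <+> N) R"
proof (rule subringI)
  note BC = subringE(1)[OF B, THEN subsetD] and NC = ideal_carr[OF N]
  show "B <+> N \<subseteq> carrier R" using BC NC by (auto simp: ideal_sum_mem)
  show "\<one> \<in> B <+> N"
    unfolding ideal_sum_mem using subringE(3)[OF B] ideal_zero[OF N] by (metis r_zero one_closed)
next
  note BC = subringE(1)[OF B, THEN subsetD] and NC = ideal_carr[OF N]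
  fix h assume "h \<in> B <+> N"
  then obtain b n where h: "h = b \<oplus> n" "b \<in> B" "n \<in> N" by (auto simp: ideal_sum_mem)
  then have "\<ominus> h = \<ominus> b \<oplus> \<ominus> n" using BC NC by (simp add: minus_add)
  then show "\<ominus> h \<in> B <+> N"
    unfolding ideal_sum_mem using subringE(5)[OF B] ideal_uminus[OF N] h by blast
  fix k assume "k \<in> B <+> N"
  then obtain c m where k: "k = c \<oplus> m" "c \<in> B" "m \<in> N" by (auto simp: ideal_sum_mem)
  note C = BC[OF h(2)] BC[OF k(2)] NC[OF h(3)] NC[OF k(3)]
  have "h \<oplus> k = (b \<oplus> c) \<oplus> (n \<oplus> m)" unfolding h k by (insert C, simp add: ring_norm)
  then show "h \<oplus> k \<in> B <+> N"
    unfolding ideal_sum_mem using subringE(7)[OF B] ideal_add[OF N] h k by blast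
  have "h \<otimes> k = b \<otimes> c \<oplus> (b \<otimes> m \<oplus> n \<otimes> (c \<oplus> m))" unfolding h k by (insert C, simp add: ring_norm)
  moreover have "b \<otimes> m \<oplus> n \<otimes> (c \<oplus> m) \<in> N"
    using h k C by (intro ideal_add[OF N] ideal_l[OF N k(3)] ideal_r[OF N h(3)]) auto
  ultimately show "h \<otimes> k \<in> B <+> N"
    unfolding ideal_sum_mem using subringE(6)[OF B] h k by blast
qed

lemma subring_minus: "subring A R \<Longrightarrow> a \<in> A \<Longrightarrow> b \<in> A \<Longrightarrow> a \<ominus> b \<in> A"
  by (simp add: a_minus_def subringE(5,7))

lemma subring_pow: "subring A R \<Longrightarrow> a \<in> A \<Longrightarrow> a [^] (n::nat) \<in> A"
  by (induction n) (auto simp: subringE(3,6))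

context
  fixes A x
  assumes A: "subring A R" and x: "x \<in> carrier R"
begin

lemma poly_lt_carr: "f \<in> poly_lt A x n \<Longrightarrow> f \<in> carrier R"
  using x subringE(1)[OF A] by (induction n arbitrary: f) auto

lemma poly_lt_zero: "\<zero> \<in> poly_lt A x n"
proof (induction n)
  case (Suc n)
  have "\<zero> = \<zero> \<oplus> \<zero> \<otimes> x [^] n" using x by simp
  then show ?case using Suc subringE(2)[OF A] by auto
qed simp

lemma poly_lt_Suc: "poly_lt A x n \<subseteq> poly_lt A x (Suc n)"
proof
  fix f assume f: "f \<in> poly_lt A x n"
  have "f = f \<oplus> \<zero> \<otimes> x [^] n" using x poly_lt_carr[OF f] by simp
  then show "f \<in> poly_lt A x (Suc n)" using f subringE(2)[OF A] by auto
qed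

lemma poly_lt_mono: "m \<le> n \<Longrightarrow> poly_lt A x m \<subseteq> poly_lt A x n"
  by (rule lift_Suc_mono_le[of "poly_lt A x"]) (use poly_lt_Suc in auto)

lemma poly_lt_add: "f \<in> poly_lt A x n \<Longrightarrow> g \<in> poly_lt A x n \<Longrightarrow> f \<oplus> g \<in> poly_lt A x n"
proof (induction n arbitrary: f g)
  case (Suc n)
  then obtain f' a g' b where f: "f = f' \<oplus> a \<otimes> x [^] n" "f' \<in> poly_lt A x n" "a \<in> A"
    and g: "g = g' \<oplus> b \<otimes> x [^] n" "g' \<in> poly_lt A x n" "b \<in> A" by auto
  define y where "y = x [^] n"
  have C: "f' \<in> carrier R" "g' \<in> carrier R" "a \<in> carrier R" "b \<in> carrier R" "y \<in> carrier R"
    using poly_lt_carr f g subringE(1)[OF A] x by (auto simp: y_def)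
  have "f \<oplus> g = (f' \<oplus> g') \<oplus> (a \<oplus> b) \<otimes> y"
    unfolding f g y_def[symmetric] by (insert C, simp add: ring_norm)
  then show ?case using Suc.IH[OF f(2) g(2)] subringE(7)[OF A f(3) g(3)] by (auto simp: y_def)
qed simp

lemma poly_lt_smult: "f \<in> poly_lt A x n \<Longrightarrow> a \<in> A \<Longrightarrow> a \<otimes> f \<in> poly_lt A x n"
proof (induction n arbitrary: f)
  case (Suc n)
  then obtain f' b where f: "f = f' \<oplus> b \<otimes> x [^] n" "f' \<in> poly_lt A x n" "b \<in> A" by auto
  have C: "f' \<in> carrier R" "a \<in> carrier R" "b \<in> carrier R"
    using poly_lt_carr f subringE(1)[OF A] Suc.prems by auto
  have "a \<otimes> f = a \<otimes> f' \<oplus> (a \<otimes> b) \<otimes> x [^] n" using C x by (simp add: f r_distr m_assoc)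
  then show ?case using Suc.IH[OF f(2) Suc.prems(2)] subringE(6)[OF A Suc.prems(2) f(3)] by auto
qed (use subringE(1)[OF A] in auto)

lemma poly_lt_uminus: "f \<in> poly_lt A x n \<Longrightarrow> \<ominus> f \<in> poly_lt A x n"
  using poly_lt_smult[of f n "\<ominus> \<one>"] subringE(3,5)[OF A] poly_lt_carr[of f n] by (simp add: l_minus)

lemma poly_lt_monom: "a \<in> A \<Longrightarrow> k < n \<Longrightarrow> a \<otimes> x [^] k \<in> poly_lt A x n"
proof -
  assume a: "a \<in> A" and k: "k < n"
  have "a \<otimes> x [^] k = \<zero> \<oplus> a \<otimes> x [^] k" using a x subringE(1)[OF A] by auto
  then have "a \<otimes> x [^] k \<in> poly_lt A x (Suc k)" using a poly_lt_zero by auto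
  then show ?thesis using poly_lt_mono[of "Suc k" n] k by auto
qed

lemma poly_lt_const: "a \<in> A \<Longrightarrow> 0 < n \<Longrightarrow> a \<in> poly_lt A x n"
  using poly_lt_monom[of a 0 n] subringE(1)[OF A] by auto

lemma poly_lt_shift: "f \<in> poly_lt A x n \<Longrightarrow> x \<otimes> f \<in> poly_lt A x (Suc n)"
proof (induction n arbitrary: f)
  case 0
  then show ?case using x poly_lt_zero[of "Suc 0"] by simp
next
  case (Suc n)
  then obtain f' b where f: "f = f' \<oplus> b \<otimes> x [^] n" "f' \<in> poly_lt A x n" "b \<in> A" by auto
  have C: "f' \<in> carrier R" "b \<in> carrier R" using poly_lt_carr f subringE(1)[OF A] by auto
  have "x \<otimes> f = x \<otimes> f' \<oplus> b \<otimes> x [^] Suc n" using C x by (simp add: f r_distr m_ac)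
  then show ?case
    using poly_lt_add[OF subsetD[OF poly_lt_Suc Suc.IH[OF f(2)]] poly_lt_monom[OF f(3), of "Suc n"]] by simp
qed

lemma poly_lt_shift_pow: "f \<in> poly_lt A x n \<Longrightarrow> x [^] m \<otimes> f \<in> poly_lt A x (m + n)"
proof (induction m)
  case (Suc m)
  have "x [^] Suc m \<otimes> f = x \<otimes> (x [^] m \<otimes> f)"
    using x poly_lt_carr[OF Suc.prems] by (simp add: m_ac)
  then show ?case using poly_lt_shift[OF Suc.IH[OF Suc.prems]] by simp
qed (simp add: poly_lt_carr)

lemma poly_lt_mult: "f \<in> poly_lt A x m \<Longrightarrow> g \<in> poly_lt A x n \<Longrightarrow> f \<otimes> g \<in> poly_lt A x (m + n)"
proof (induction m arbitrary: f)
  case 0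
  then show ?case using poly_lt_carr[of g n] poly_lt_zero by simp
next
  case (Suc m)
  then obtain f' b where f: "f = f' \<oplus> b \<otimes> x [^] m" "f' \<in> poly_lt A x m" "b \<in> A" by auto
  have C: "f' \<in> carrier R" "b \<in> carrier R" "g \<in> carrier R" using poly_lt_carr f Suc.prems subringE(1)[OF A] by auto
  have "f \<otimes> g = f' \<otimes> g \<oplus> b \<otimes> (x [^] m \<otimes> g)" using C x by (simp add: f l_distr m_assoc)
  then have "f \<otimes> g \<in> poly_lt A x (m + n)"
    using poly_lt_add[OF Suc.IH[OF f(2) Suc.prems(2)] poly_lt_smult[OF poly_lt_shift_pow[OF Suc.prems(2), of m] f(3)]] by simp
  then show ?case using poly_lt_Suc[of "m + n"] by auto
qed

text \<open>The recursion of \<open>poly_lt\<close> exposes the top coefficient; the degree descent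
  for valuation rings must also split off the constant term.\<close>

lemma poly_lt_bottom:
  "f \<in> poly_lt A x (Suc n) \<Longrightarrow> \<exists>a\<in>A. \<exists>g\<in>poly_lt A x n. f = a \<oplus> x \<otimes> g"
proof (induction n arbitrary: f)
  case 0
  then obtain a where a: "a \<in> A" "f = a" using subringE(1)[OF A] by auto
  have "a = a \<oplus> x \<otimes> \<zero>" using a x subringE(1)[OF A] by auto
  then show ?case using a by auto
next
  case (Suc n)
  then obtain f' b where f: "f = f' \<oplus> b \<otimes> x [^] Suc n" "f' \<in> poly_lt A x (Suc n)" "b \<in> A" by force
  from Suc.IH[OF f(2)] obtain a g where a: "a \<in> A" and g: "g \<in> poly_lt A x n" and f': "f' = a \<oplus> x \<otimes> g" by blast
  have C: "a \<in> carrier R" "b \<in> carrier R" "g \<in> carrier R" using poly_lt_carr[OF g] f a subringE(1)[OF A] by auto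
  have "f = a \<oplus> x \<otimes> (g \<oplus> b \<otimes> x [^] n)" using C x by (simp add: f f' r_distr m_ac a_assoc)
  moreover have "g \<oplus> b \<otimes> x [^] n \<in> poly_lt A x (Suc n)" using g f(3) by auto
  ultimately show ?case using a by blast
qed

lemma adjoin_subring: "subring (\<Union>n. poly_lt A x n) R"
proof (rule subringI)
  show "(\<Union>n. poly_lt A x n) \<subseteq> carrier R" using poly_lt_carr by blast
  show "\<one> \<in> (\<Union>n. poly_lt A x n)" by (rule UN_I[of 1]) (simp_all only: UNIV_I poly_lt_const[OF subringE(3)[OF A]] zero_less_one)
next
  fix h assume "h \<in> (\<Union>n. poly_lt A x n)"
  then obtain m where h: "h \<in> poly_lt A x m" by blast
  then show "\<ominus> h \<in> (\<Union>n. poly_lt A x n)" using poly_lt_uminus by blast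
  fix k assume "k \<in> (\<Union>n. poly_lt A x n)"
  then obtain n where k: "k \<in> poly_lt A x n" by blast
  show "h \<otimes> k \<in> (\<Union>n. poly_lt A x n)" using poly_lt_mult[OF h k] by blast
  have "h \<in> poly_lt A x (m + n)" "k \<in> poly_lt A x (m + n)"
    using h k poly_lt_mono[of m "m + n"] poly_lt_mono[of n "m + n"] by auto
  then show "h \<oplus> k \<in> (\<Union>n. poly_lt A x n)" using poly_lt_add by blast
qed

lemma adjoin_superset: "A \<subseteq> (\<Union>n. poly_lt A x n)"
  by (intro subsetI UN_I[of 1]) (simp_all only: UNIV_I poly_lt_const zero_less_one)

lemma adjoin_mem: "x \<in> (\<Union>n. poly_lt A x n)"
  using poly_lt_monom[OF subringE(3)[OF A], of 1 2] x by auto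

end

text \<open>With \<open>x \<otimes> y\<close> in \<open>A\<close>, a monomial
  \<open>x^n y^(k+1)\<close> with \<open>k < n\<close> collapses to
  \<open>(x y)^(k+1) x^(n-k-1)\<close>. The extra factor \<open>y\<close> is what brings the degree
  in \<open>x\<close> below \<open>n\<close>.\<close>

lemma poly_lt_reverse:
  assumes A: "subring A R" and x: "x \<in> carrier R" and y: "y \<in> carrier R" and xy: "x \<otimes> y \<in> A"
  shows "g \<in> poly_lt A y m \<Longrightarrow> m \<le> n \<Longrightarrow> x [^] n \<otimes> (y \<otimes> g) \<in> poly_lt A x n"
proof (induction m arbitrary: g)
  case 0
  then show ?case using x y poly_lt_zero[OF A x] by simp
next
  case (Suc m)
  then obtain f b where f: "g = f \<oplus> b \<otimes> y [^] m" "f \<in> poly_lt A y m" "b \<in> A" by auto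
  have C: "f \<in> carrier R" "b \<in> carrier R" using poly_lt_carr[OF A y f(2)] f subringE(1)[OF A] by auto
  have n: "x [^] n = x [^] Suc m \<otimes> x [^] (n - Suc m)" using Suc.prems(2) nat_pow_mult[OF x, of "Suc m" "n - Suc m"] by simp
  have "(x \<otimes> y) [^] Suc m = x [^] Suc m \<otimes> y [^] Suc m" using x y nat_pow_distrib by blast
  then have "x [^] n \<otimes> (y \<otimes> (b \<otimes> y [^] m)) = (b \<otimes> (x \<otimes> y) [^] Suc m) \<otimes> x [^] (n - Suc m)"
    unfolding n using x y C by (simp add: m_ac)
  moreover have "\<dots> \<in> poly_lt A x n"
    using Suc.prems(2) by (intro poly_lt_monom[OF A x]) (auto intro: subringE(6)[OF A] f(3) subring_pow[OF A xy] xy simp del: nat_pow_Suc)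
  moreover have "x [^] n \<otimes> (y \<otimes> g) = x [^] n \<otimes> (y \<otimes> f) \<oplus> x [^] n \<otimes> (y \<otimes> (b \<otimes> y [^] m))"
    unfolding f using x y C by (simp add: r_distr)
  ultimately show ?case using poly_lt_add[OF A x Suc.IH[OF f(2)]] Suc.prems(2) by simp
qed

text \<open>Chevalley's argument in the field \<open>R/N\<close>, with congruences modulo
  \<open>N\<close> in place of the quotient. \<open>V\<close> is a maximal subring above
  \<open>A0\<close> without \<open>s\<close>. As \<open>s\<close> inverts \<open>t\<close> modulo
  \<open>N\<close>, its absence forces \<open>t\<close> into the Jacobson radical of
  \<open>V/N\<close>, and then maximality does not tolerate two outside elements with product in
  \<open>V\<close>.\<close>

lemma chevalley_valuation_ring:
  assumes N: "ideal N R" and fld: "\<And>q. q \<in> carrier R \<Longrightarrow> q \<notin> N \<Longrightarrow> \<exists>z\<in>carrier R. q \<otimes> z \<ominus> \<one> \<in> N"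
    and A0: "subring A0 R" "N \<subseteq> A0" "t \<in> A0"
    and s: "s \<in> carrier R" "s \<notin> A0" "t \<otimes> s \<ominus> \<one> \<in> N"
  obtains V where "subring V R" "A0 \<subseteq> V" "s \<notin> V"
    "\<And>x y. x \<in> carrier R - V \<Longrightarrow> y \<in> carrier R - V \<Longrightarrow> x \<otimes> y \<notin> V"
proof -
  let ?F = "{A. subring A R \<and> A0 \<subseteq> A \<and> s \<notin> A}"
  have "\<exists>A\<in>?F. \<forall>B\<in>?F. A \<subseteq> B \<longrightarrow> B = A"
  proof (rule subset_Zorn_nonempty)
    show "?F \<noteq> {}" using A0 s by auto
    fix C assume C: "C \<noteq> {}" "subset.chain ?F C"
    have CF: "\<And>B. B \<in> C \<Longrightarrow> subring B R \<and> A0 \<subseteq> B \<and> s \<notin> B"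
      and ch: "\<And>B D. B \<in> C \<Longrightarrow> D \<in> C \<Longrightarrow> B \<subseteq> D \<or> D \<subseteq> B"
      using C(2) unfolding pred_on.chain_def by auto
    obtain B0 where B0: "B0 \<in> C" using C(1) by blast
    have "subring (\<Union>C) R"
    proof (rule subringI)
      show "\<Union>C \<subseteq> carrier R" using CF subringE(1)[of _ R] by blast
      show "\<one> \<in> \<Union>C" using CF[OF B0] subringE(3)[of B0 R] B0 by blast
    next
      fix h assume "h \<in> \<Union>C"
      then obtain B where B: "B \<in> C" "h \<in> B" by blast
      then show "\<ominus> h \<in> \<Union>C" using CF[OF B(1)] subringE(5)[of B R h] by blast
      fix k assume "k \<in> \<Union>C"
      then obtain D where D: "D \<in> C" "k \<in> D" by blast
      obtain E where E: "E \<in> C" "h \<in> E" "k \<in> E" using ch[OF B(1) D(1)] B D by blast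
      then show "h \<otimes> k \<in> \<Union>C" "h \<oplus> k \<in> \<Union>C"
        using CF[OF E(1)] subringE(6)[of E R h k] subringE(7)[of E R h k] by auto
    qed
    then show "\<Union>C \<in> ?F" using CF B0 by blast
  qed
  then obtain A where A: "subring A R" and A0A: "A0 \<subseteq> A" and sA: "s \<notin> A"
    and max: "\<And>B. subring B R \<Longrightarrow> A \<subseteq> B \<Longrightarrow> s \<notin> B \<Longrightarrow> B = A" by (smt (verit) mem_Collect_eq order_trans)
  note AC = subringE(1)[OF A, THEN subsetD] and NC = ideal_carr[OF N]
  have NA: "N \<subseteq> A" and tA: "t \<in> A" using A0 A0A by auto
  have ex: "\<exists>n. s \<in> poly_lt A x n" if x: "x \<in> carrier R" "x \<notin> A" for x
    using max[OF adjoin_subring[OF A x(1)] adjoin_superset[OF A x(1)]] adjoin_mem[OF A x(1)] x(2) by blast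
  \<comment> \<open>Otherwise the inverse \<open>z\<close> of \<open>q = 1 - t a\<close> lies
    outside \<open>A\<close>, so maximality writes \<open>s\<close> as a polynomial in
    \<open>z\<close>. Multiplication by \<open>q^n\<close> clears it and gives
    \<open>q^n s \<in> A\<close>; since \<open>q^n = 1 - t c\<close> and \<open>t s\<close> is 1
    modulo \<open>N\<close>, also \<open>s \<in> A\<close>.\<close>
  have inv: "\<exists>z\<in>A. (\<one> \<ominus> t \<otimes> a) \<otimes> z \<ominus> \<one> \<in> N" if a: "a \<in> A" for a
  proof -
    define q where "q = \<one> \<ominus> t \<otimes> a"
    have qA: "q \<in> A" unfolding q_def using subring_minus[OF A subringE(3)[OF A] subringE(6)[OF A tA a]] .
    note C = AC[OF tA] AC[OF a] s(1) AC[OF qA]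
    have "q \<notin> N"
    proof
      assume "q \<in> N"
      have "s = s \<otimes> q \<oplus> (a \<oplus> a \<otimes> (t \<otimes> s \<ominus> \<one>))"
        unfolding q_def by (insert C, simp add: ring_norm)
      moreover have "s \<otimes> q \<in> A" using ideal_l[OF N \<open>q \<in> N\<close> s(1)] NA by blast
      moreover have "a \<otimes> (t \<otimes> s \<ominus> \<one>) \<in> A" using ideal_l[OF N s(3)] NA C by blast
      ultimately have "s \<in> A" using subringE(7)[OF A] a by metis
      with sA show False ..
    qed
    then obtain z where z: "z \<in> carrier R" "q \<otimes> z \<ominus> \<one> \<in> N" using fld C by blast
    have "(q \<otimes> z \<ominus> \<one>) \<oplus> \<one> \<in> A" using z(2) NA subringE(3,7)[OF A] by blast
    also have "(q \<otimes> z \<ominus> \<one>) \<oplus> \<one> = q \<otimes> z" by (insert C z(1), simp add: ring_norm)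
    finally have qz: "q \<otimes> z \<in> A" .
    have red: "q [^] n \<otimes> f \<in> A" if "f \<in> poly_lt A z n" for f n
      using that
    proof (induction n arbitrary: f)
      case 0
      then show ?case using C subringE(2)[OF A] by simp
    next
      case (Suc n)
      then obtain g b where f: "f = g \<oplus> b \<otimes> z [^] n" "g \<in> poly_lt A z n" "b \<in> A" by auto
      have D: "g \<in> carrier R" "b \<in> carrier R" using poly_lt_carr[OF A z(1) f(2)] AC f by auto
      have "(q \<otimes> z) [^] n = q [^] n \<otimes> z [^] n" using C z nat_pow_distrib by blast
      then have "q [^] Suc n \<otimes> f = q \<otimes> (q [^] n \<otimes> g) \<oplus> q \<otimes> (b \<otimes> (q \<otimes> z) [^] n)"
        unfolding f using C D z by (simp add: r_distr m_ac)
      moreover have "q \<otimes> (b \<otimes> (q \<otimes> z) [^] n) \<in> A"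
        using subringE(6)[OF A qA subringE(6)[OF A f(3) subring_pow[OF A qz]]] .
      moreover have "q \<otimes> (q [^] n \<otimes> g) \<in> A" using subringE(6)[OF A qA Suc.IH[OF f(2)]] .
      ultimately show ?case using subringE(7)[OF A] by simp
    qed
    have pw: "\<exists>c\<in>A. q [^] n = \<one> \<ominus> t \<otimes> c" for n :: nat
    proof (induction n)
      case 0
      have "\<one> = \<one> \<ominus> t \<otimes> \<zero>" using C by (simp add: a_minus_def)
      then show ?case using subringE(2)[OF A] by auto
    next
      case (Suc n)
      then obtain c where c: "c \<in> A" "q [^] n = \<one> \<ominus> t \<otimes> c" by blast
      have D: "c \<in> carrier R" using AC c by blast
      have "q [^] Suc n = (\<one> \<ominus> t \<otimes> c) \<otimes> (\<one> \<ominus> t \<otimes> a)" using c by (simp add: q_def)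
      also have "\<dots> = \<one> \<ominus> t \<otimes> (c \<oplus> a \<ominus> t \<otimes> c \<otimes> a)" by (insert C D, simp add: ring_norm)
      moreover have "c \<oplus> a \<ominus> t \<otimes> c \<otimes> a \<in> A"
        using subring_minus[OF A subringE(7)[OF A c(1) a] subringE(6)[OF A subringE(6)[OF A tA c(1)] a]] .
      ultimately show ?case by auto
    qed
    have "s \<notin> poly_lt A z n" for n
    proof
      assume "s \<in> poly_lt A z n"
      from red[OF this] have qs: "q [^] n \<otimes> s \<in> A" .
      obtain c where c: "c \<in> A" "q [^] n = \<one> \<ominus> t \<otimes> c" using pw by blast
      have D: "c \<in> carrier R" using AC c by blast
      have "s = (\<one> \<ominus> t \<otimes> c) \<otimes> s \<oplus> (c \<otimes> (t \<otimes> s \<ominus> \<one>) \<oplus> c)"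
        by (insert C D, simp add: ring_norm)
      moreover have "c \<otimes> (t \<otimes> s \<ominus> \<one>) \<in> A" using ideal_l[OF N s(3) D] NA by blast
      ultimately have "s \<in> A" using qs c subringE(7)[OF A] by metis
      with sA show False ..
    qed
    then have "z \<in> A" using ex[OF z(1)] by blast
    then show ?thesis using z(2) by (auto simp: q_def)
  qed
  \<comment> \<open>A degree descent. From \<open>s = b + y g\<close> and \<open>t s = 1\<close>
    modulo \<open>N\<close> one gets \<open>1 = y g'\<close> modulo \<open>N\<close> after inverting
    \<open>1 - t b\<close>. Inserting \<open>y g'\<close> into the leading term of \<open>s\<close>
    lowers the degree by \<open>poly_lt_reverse\<close>, against the minimality of
    \<open>n\<close>.\<close>
  have main: False
    if x: "x \<in> carrier R" "x \<notin> A" and y: "y \<in> carrier R" "y \<notin> A" and xy: "x \<otimes> y \<in> A"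
      and n: "s \<in> poly_lt A x n" "\<And>k. k < n \<Longrightarrow> s \<notin> poly_lt A x k"
      and m: "s \<in> poly_lt A y m" and mn: "m \<le> n" for x y n m
  proof -
    have s0: "s \<noteq> \<zero>" using sA subringE(2)[OF A] by blast
    obtain m' where m': "m = Suc m'" using m s0 by (cases m) auto
    obtain n' where n': "n = Suc n'" using n s0 by (cases n) auto
    obtain b g where b: "b \<in> A" and g: "g \<in> poly_lt A y m'" and sb: "s = b \<oplus> y \<otimes> g"
      using poly_lt_bottom[OF A y(1)] m m' by blast
    obtain z where z: "z \<in> A" and zN: "(\<one> \<ominus> t \<otimes> b) \<otimes> z \<ominus> \<one> \<in> N" using inv[OF b] by blast
    obtain f a where f: "f \<in> poly_lt A x n'" and a: "a \<in> A" and sf: "s = f \<oplus> a \<otimes> x [^] n'"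
      using n n' by auto
    \<comment> \<open>Positivity ensures that constants, in particular the error term in
      \<open>N\<close>, have degree less than \<open>n'\<close>.\<close>
    have n'0: "0 < n'"
    proof (rule ccontr)
      assume "\<not> 0 < n'"
      then have "s = a" using f sf a AC by simp
      with a sA show False by simp
    qed
    define g' where "g' = (z \<otimes> t) \<otimes> g"
    have g': "g' \<in> poly_lt A y m'" unfolding g'_def
      by (rule poly_lt_smult[OF A y(1) g subringE(6)[OF A z tA]])
    have gc: "g \<in> carrier R" using poly_lt_carr[OF A y(1) g] .
    have g'c: "g' \<in> carrier R" using poly_lt_carr[OF A y(1) g'] .
    note C = AC[OF b] AC[OF z] AC[OF tA] gc y(1) s(1)
    have "\<one> \<ominus> y \<otimes> g' = \<ominus> ((\<one> \<ominus> t \<otimes> b) \<otimes> z \<ominus> \<one>) \<ominus> z \<otimes> (t \<otimes> (y \<otimes> g) \<ominus> (\<one> \<ominus> t \<otimes> b))"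
      unfolding g'_def by (insert C, simp add: ring_norm)
    moreover have "t \<otimes> (y \<otimes> g) \<ominus> (\<one> \<ominus> t \<otimes> b) = t \<otimes> s \<ominus> \<one>"
      unfolding sb by (insert C, simp add: ring_norm)
    ultimately have yg: "\<one> \<ominus> y \<otimes> g' \<in> N"
      using ideal_diff[OF N ideal_uminus[OF N zN] ideal_l[OF N s(3)]] C by simp
    define p where "p = x [^] n'"
    have p: "p \<in> carrier R" using x by (simp add: p_def)
    note D = AC[OF a] p y(1) g'c poly_lt_carr[OF A x(1) f]
    have "s = f \<oplus> (a \<otimes> (p \<otimes> (y \<otimes> g')) \<oplus> (a \<otimes> p) \<otimes> (\<one> \<ominus> y \<otimes> g'))"
      unfolding sf p_def[symmetric] by (insert D, simp add: ring_norm)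
    moreover have "a \<otimes> (p \<otimes> (y \<otimes> g')) \<in> poly_lt A x n'"
      unfolding p_def using mn m' n'
      by (intro poly_lt_smult[OF A x(1) _ a] poly_lt_reverse[OF A x(1) y(1) xy g']) simp
    moreover have "(a \<otimes> p) \<otimes> (\<one> \<ominus> y \<otimes> g') \<in> N" using ideal_l[OF N yg] D by simp
    then have "(a \<otimes> p) \<otimes> (\<one> \<ominus> y \<otimes> g') \<in> poly_lt A x n'"
      using poly_lt_const[OF A x(1) _ n'0] NA by blast
    ultimately have "s \<in> poly_lt A x n'" using f poly_lt_add[OF A x(1)] by metis
    then show False using n(2)[of n'] n' by simp
  qed
  show ?thesis
  proof (rule that[OF A A0A sA])
    fix x y assume x: "x \<in> carrier R - A" and y: "y \<in> carrier R - A"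
    show "x \<otimes> y \<notin> A"
    proof
      assume xy: "x \<otimes> y \<in> A"
      define n where "n = (LEAST n. s \<in> poly_lt A x n)"
      define m where "m = (LEAST n. s \<in> poly_lt A y n)"
      have n: "s \<in> poly_lt A x n" "\<And>k. k < n \<Longrightarrow> s \<notin> poly_lt A x k"
        unfolding n_def using ex[of x] x by (auto intro: LeastI_ex dest: not_less_Least)
      have m: "s \<in> poly_lt A y m" "\<And>k. k < m \<Longrightarrow> s \<notin> poly_lt A y k"
        unfolding m_def using ex[of y] y by (auto intro: LeastI_ex dest: not_less_Least)
      have "y \<otimes> x \<in> A" using xy x y by (simp add: m_comm)
      then show False using main[of x y n m] main[of y x m n] x y xy n m
        by (metis DiffD1 DiffD2 nat_le_linear)
    qed
  qed
qed

end

section \<open>The intersection of the valuation rings\<close>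

text \<open>The total ring of fractions is \<open>R\<close> with the single element \<open>t\<close>
  inverted: by dimension one every regular element of \<open>R\<close> divides a power of
  \<open>t\<close>, so powers of \<open>t\<close> suffice as denominators.\<close>

locale frac_ring = cring Q for Q (structure) +
  fixes R M t
  assumes R_sub: "subring R Q"
    and loc: "local_dim_one (sub_ring Q R) M t"
    and t_unit: "t \<in> Units Q"
    and frac: "q \<in> carrier Q \<Longrightarrow> \<exists>n::nat. t [^] n \<otimes> q \<in> R"

sublocale frac_ring \<subseteq> L: local_dim_one "sub_ring Q R" M t
  by (rule loc)

context frac_ring
begin

lemma S_pow [simp]: "x [^]\<^bsub>sub_ring Q R\<^esub> (n::nat) = x [^] n"
  by (induction n) auto

lemma R_carr: "x \<in> R \<Longrightarrow> x \<in> carrier Q"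
  using subringE(1)[OF R_sub] by blast

lemma tR: "t \<in> R"
  using L.t_carr by simp

lemma tc: "t \<in> carrier Q" "inv t \<in> carrier Q"
  using t_unit by auto

lemma t_inv_pow: "t [^] (n::nat) \<otimes> inv t [^] n = \<one>"
  using nat_pow_distrib[OF tc, of n] t_unit by simp

lemma S_minus: "x \<in> R \<Longrightarrow> \<ominus>\<^bsub>sub_ring Q R\<^esub> x = \<ominus> x"
proof -
  assume x: "x \<in> R"
  then have m: "\<ominus>\<^bsub>sub_ring Q R\<^esub> x \<in> R" using L.a_inv_closed[of x] by simp
  have "\<ominus>\<^bsub>sub_ring Q R\<^esub> x \<oplus> x = \<zero>" using L.l_neg[of x] x by simp
  then show ?thesis using minus_equality[of _ x] R_carr x m by metis
qed

lemma unit_outside_M: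
  assumes "a \<in> R" "a \<notin> M" obtains b where "b \<in> R" "a \<otimes> b = \<one>"
  using L.unit_if_notin_M[of a] assms by auto

lemma M_subset_R: "M \<subseteq> R"
  using L.ideal_carr[OF L.M_ideal] by auto

lemma one_notin_M: "\<one> \<notin> M"
proof
  assume "\<one> \<in> M"
  then have "M = R" using ideal.one_imp_carrier[OF L.M_ideal] by simp
  then show False using maximalideal.I_notcarr[OF L.maximal] by simp
qed

lemma prime_contract:
  assumes N: "primeideal N Q" shows "primeideal (N \<inter> R) (sub_ring Q R)"
proof -
  have Ni: "ideal N Q" using N by (simp add: primeideal_def)
  have "\<one> \<notin> N" using ideal.one_imp_carrier[OF Ni] primeideal.I_notcarr[OF N] by blast
  show ?thesis
  proof (rule primeidealI[OF _ L.is_cring])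
    show "ideal (N \<inter> R) (sub_ring Q R)"
      by (rule L.idealI')
        (auto simp: ideal_zero[OF Ni] subringE[OF R_sub] ideal_add[OF Ni] ideal_l[OF Ni] R_carr)
    show "carrier (sub_ring Q R) \<noteq> N \<inter> R"
      using \<open>\<one> \<notin> N\<close> subringE(3)[OF R_sub] by auto
  next
    fix a b assume "a \<in> carrier (sub_ring Q R)" "b \<in> carrier (sub_ring Q R)"
      "a \<otimes>\<^bsub>sub_ring Q R\<^esub> b \<in> N \<inter> R"
    then show "a \<in> N \<inter> R \<or> b \<in> N \<inter> R" using primeideal.I_prime[OF N, of a b] R_carr by auto
  qed
qed

text \<open>\<open>Q\<close> has dimension zero. A multiple \<open>t^k q\<close> lies in
  \<open>R\<close> outside \<open>N\<close>, and together with \<open>N \<inter> R\<close> it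
  generates an ideal containing a power of \<open>t\<close>, which is a unit of
  \<open>Q\<close>.\<close>

lemma prime_inverse:
  assumes N: "primeideal N Q" and q: "q \<in> carrier Q" "q \<notin> N"
  shows "\<exists>z\<in>carrier Q. q \<otimes> z \<ominus> \<one> \<in> N"
proof -
  have Ni: "ideal N Q" using N by (simp add: primeideal_def)
  have one: "\<one> \<notin> N" using ideal.one_imp_carrier[OF Ni] primeideal.I_notcarr[OF N] by blast
  have tn: "t [^] n \<notin> N" for n :: nat
    using ideal_r[OF Ni, of "t [^] n" "inv t [^] n"] t_inv_pow tc one by force
  obtain k :: nat where k: "t [^] k \<otimes> q \<in> R" using frac[OF q(1)] by blast
  have "t [^] k \<otimes> q \<notin> N" using primeideal.I_prime[OF N, of "t [^] k" q] tn q tc by auto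
  moreover have "t \<notin> N" using tn[of 1] tc by simp
  ultimately obtain m :: nat and p r where p: "p \<in> N" "p \<in> R" and r: "r \<in> R"
    and eq: "t [^] m = p \<oplus> r \<otimes> (t [^] k \<otimes> q)"
    using L.t_pow_in_prime_adjoin[OF prime_contract[OF N], of "t [^] k \<otimes> q"] k by auto
  define w z where "w = inv t [^] m" and "z = r \<otimes> t [^] k \<otimes> w"
  have w: "w \<in> carrier Q" using tc by (simp add: w_def)
  have z: "z \<in> carrier Q" using w R_carr r tc by (simp add: z_def)
  define T where "T = t [^] k"
  have C: "p \<in> carrier Q" "r \<in> carrier Q" "w \<in> carrier Q" "q \<in> carrier Q" "T \<in> carrier Q"
    using R_carr p r w q tc by (auto simp: T_def)
  have "q \<otimes> z = (p \<oplus> r \<otimes> (T \<otimes> q)) \<otimes> w \<ominus> p \<otimes> w"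
    unfolding z_def T_def[symmetric] by (insert C, simp add: ring_norm)
  also have "(p \<oplus> r \<otimes> (T \<otimes> q)) \<otimes> w = \<one>"
    using t_inv_pow[of m] unfolding w_def T_def eq[symmetric] .
  finally have "q \<otimes> z = \<one> \<ominus> p \<otimes> w" .
  moreover have "(\<one> \<ominus> p \<otimes> w) \<ominus> \<one> = \<ominus> (p \<otimes> w)" by (insert C, simp add: ring_norm)
  ultimately show ?thesis using ideal_uminus[OF Ni ideal_r[OF Ni p(1) w]] z by (intro bexI[of _ z]) auto
qed

text \<open>Chevalley's argument is applied modulo a maximal ideal \<open>N\<close> of
  \<open>Q\<close> through \<open>x\<close>, with \<open>t\<close> kept non-invertible. That
  \<open>V\<close> contains a whole ideal of \<open>Q\<close> through \<open>x\<close> is what will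
  force an infinite value of \<open>x\<close>.\<close>

lemma nonunit_valuation_ring:
  assumes x: "x \<in> carrier Q" "x \<notin> Units Q"
  shows "\<exists>V\<in>valuation_rings_over Q R. \<exists>N. ideal N Q \<and> x \<in> N \<and> N \<subseteq> V"
proof -
  have "\<one> \<notin> PIdl x"
  proof
    assume "\<one> \<in> PIdl x"
    then obtain r where "r \<in> carrier Q" "\<one> = r \<otimes> x" by (auto simp: PIdl_mem)
    then show False using x by (metis Units_one_closed m_comm unit_factor)
  qed
  then obtain N where N: "maximalideal N Q" "PIdl x \<subseteq> N"
    using nonunit_in_maximalideal[OF cgenideal_ideal[OF x(1)]] by blast
  have P: "primeideal N Q" by (rule maximalideal_prime[OF N(1)])
  have Ni: "ideal N Q" using P by (simp add: primeideal_def)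
  have one: "\<one> \<notin> N" using ideal.one_imp_carrier[OF Ni] primeideal.I_notcarr[OF P] by blast
  \<comment> \<open>Otherwise \<open>1 - t r\<close> would lie in \<open>N\<close> for some
    \<open>r\<close> in \<open>R\<close>; but it is a unit of \<open>R\<close>, because
    \<open>t\<close> is in the maximal ideal.\<close>
  have not: "inv t \<notin> R <+> N"
  proof
    assume "inv t \<in> R <+> N"
    then obtain r n where r: "r \<in> R" and n: "n \<in> N" and eq: "inv t = r \<oplus> n" by (auto simp: ideal_sum_mem)
    have trM: "t \<otimes> r \<in> M" using L.ideal_r[OF L.M_ideal L.tM, of r] r by simp
    have trR: "t \<otimes> r \<in> R" using subringE(6)[OF R_sub tR r] .
    define b where "b = \<one> \<ominus> t \<otimes> r"
    have bR: "b \<in> R" unfolding b_def using subring_minus[OF R_sub subringE(3)[OF R_sub] trR] .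
    note C = R_carr[OF bR] R_carr[OF r] tc(1) ideal_carr[OF Ni n]
    have "b \<notin> M"
    proof
      assume "b \<in> M"
      have "b \<oplus> t \<otimes> r = \<one>" unfolding b_def by (insert C, simp add: ring_norm)
      moreover have "b \<oplus> t \<otimes> r \<in> M" using L.ideal_add[OF L.M_ideal \<open>b \<in> M\<close> trM] by simp
      ultimately show False using one_notin_M by simp
    qed
    then obtain c where c: "c \<in> R" "b \<otimes> c = \<one>" using unit_outside_M bR by blast
    have "\<one> = t \<otimes> (r \<oplus> n)" using eq t_unit by (metis Units_r_inv)
    then have "b = t \<otimes> (r \<oplus> n) \<ominus> t \<otimes> r" by (simp add: b_def)
    also have "\<dots> = t \<otimes> n" by (insert C, simp add: ring_norm)
    finally have "b \<in> N" using ideal_l[OF Ni n] tc by simp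
    then have "\<one> \<in> N" using ideal_r[OF Ni _ R_carr[OF c(1)]] c(2) by metis
    with one show False ..
  qed
  have sub: "R \<subseteq> R <+> N"
    unfolding subset_iff ideal_sum_mem using ideal_zero[OF Ni] R_carr by (metis r_zero)
  have subN: "N \<subseteq> R <+> N"
    unfolding subset_iff ideal_sum_mem using subringE(2)[OF R_sub] ideal_carr[OF Ni] by (metis l_zero)
  obtain V where V: "subring V Q" "R <+> N \<subseteq> V" "inv t \<notin> V"
    "\<And>x y. x \<in> carrier Q - V \<Longrightarrow> y \<in> carrier Q - V \<Longrightarrow> x \<otimes> y \<notin> V"
  proof (rule chevalley_valuation_ring[OF Ni _ subring_plus_ideal[OF R_sub Ni] subN _ tc(2) not])
    show "t \<in> R <+> N" using sub tR by blast
    show "t \<otimes> inv t \<ominus> \<one> \<in> N" using t_unit ideal_zero[OF Ni] by (simp add: a_minus_def r_neg)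
  qed (use prime_inverse[OF P] in blast)+
  then have "V \<in> valuation_rings_over Q R"
    unfolding valuation_rings_over_def using sub tc by blast
  moreover have "x \<in> N" using N(2) cgenideal_self[OF x(1)] by blast
  ultimately show ?thesis using Ni V(2) subN by blast
qed

text \<open>Clearing denominators where \<open>u\<close> stands for \<open>1/y\<close>: each
  \<open>y^k u^i\<close> with \<open>i < k\<close> is \<open>y^(k-i)\<close> modulo
  \<open>N\<close>, so only nonnegative powers of \<open>y\<close> survive.\<close>

lemma poly_lt_invert:
  assumes N: "ideal N Q" and y: "y \<in> carrier Q" and u: "u \<in> carrier Q" and yu: "y \<otimes> u \<ominus> \<one> \<in> N"
  shows "f \<in> poly_lt R u k \<Longrightarrow> \<exists>g\<in>poly_lt R y (Suc k). y [^] k \<otimes> f \<ominus> g \<in> N"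
proof (induction k arbitrary: f)
  case 0
  then show ?case using poly_lt_zero[OF R_sub y, of 1] ideal_zero[OF N] by (intro bexI[of _ \<zero>]) (auto simp: a_minus_def)
next
  case (Suc k)
  then obtain f' a where f: "f = f' \<oplus> a \<otimes> u [^] k" "f' \<in> poly_lt R u k" "a \<in> R" by auto
  from Suc.IH[OF f(2)] obtain g where g: "g \<in> poly_lt R y (Suc k)" and gN: "y [^] k \<otimes> f' \<ominus> g \<in> N" by blast
  define p q w where "p = y [^] k" and "q = u [^] k" and "w = (y \<otimes> u) [^] k"
  have wpq: "w = p \<otimes> q" using nat_pow_distrib[OF y u] by (simp add: w_def p_def q_def)
  have wN: "w \<ominus> \<one> \<in> N"
    using pow_diff_ideal[OF N _ one_closed yu, of k] y u by (simp add: w_def)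
  have C: "f' \<in> carrier Q" "a \<in> carrier Q" "g \<in> carrier Q" "p \<in> carrier Q" "q \<in> carrier Q"
    using poly_lt_carr[OF R_sub u f(2)] poly_lt_carr[OF R_sub y g] R_carr[OF f(3)] y u by (auto simp: p_def q_def)
  have "p \<otimes> y \<otimes> (f' \<oplus> a \<otimes> q) \<ominus> (y \<otimes> g \<oplus> a \<otimes> y) = y \<otimes> (p \<otimes> f' \<ominus> g) \<oplus> (a \<otimes> y) \<otimes> (p \<otimes> q \<ominus> \<one>)"
    by (insert C y, simp add: ring_norm)
  also have "\<dots> \<in> N"
    using C y gN wN by (intro ideal_add[OF N] ideal_l[OF N]) (auto simp: p_def q_def wpq)
  finally have "y [^] Suc k \<otimes> f \<ominus> (y \<otimes> g \<oplus> a \<otimes> y) \<in> N" by (simp add: f p_def q_def)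
  moreover have "y \<otimes> g \<oplus> a \<otimes> y \<in> poly_lt R y (Suc (Suc k))"
    using poly_lt_add[OF R_sub y poly_lt_shift[OF R_sub y g] poly_lt_monom[OF R_sub y f(3), of 1 "Suc (Suc k)"]] y by simp
  ultimately show ?case by blast
qed

text \<open>If \<open>y\<close> is not integral, the monic expressions in \<open>y\<close> form a
  multiplicative set without zero. A prime \<open>N\<close> avoiding them keeps \<open>y\<close>
  non-integral modulo \<open>N\<close>, so \<open>y\<close> is not in \<open>R[u] + N\<close> for
  the inverse \<open>u\<close> of \<open>y\<close> modulo \<open>N\<close>. Chevalley's argument
  then gives a valuation ring over \<open>R\<close> that omits \<open>y\<close>.\<close>

lemma integral_of_valuation_rings:
  assumes y: "y \<in> carrier Q" and val: "\<And>V. V \<in> valuation_rings_over Q R \<Longrightarrow> y \<in> V"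
  shows "\<exists>n. y [^] n \<in> poly_lt R y n"
proof (rule ccontr)
  assume not: "\<not> ?thesis"
  let ?S = "{y [^] n \<oplus> f | n f. f \<in> poly_lt R y n}"
  note plc = poly_lt_carr[OF R_sub y]
  have "\<zero> \<notin> ?S"
  proof
    assume "\<zero> \<in> ?S"
    then obtain n f where f: "f \<in> poly_lt R y n" "y [^] n \<oplus> f = \<zero>" by auto
    then have "y [^] n = \<ominus> f" using plc y by (metis minus_equality nat_pow_closed)
    then have "y [^] n \<in> poly_lt R y n" using poly_lt_uminus[OF R_sub y f(1)] by simp
    then show False using not by blast
  qed
  obtain N where P: "primeideal N Q" and NS: "N \<inter> ?S = {}"
  proof (rule exists_prime_disjoint[OF zeroideal, of ?S])
    show "{\<zero>} \<inter> ?S = {}" using \<open>\<zero> \<notin> ?S\<close> by blast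
    have "\<one> = y [^] (0::nat) \<oplus> \<zero>" by simp
    then show "\<one> \<in> ?S" using poly_lt_zero[OF R_sub y] by blast
    fix a b assume "a \<in> ?S" "b \<in> ?S"
    then obtain m n f g where a: "a = y [^] m \<oplus> f" "f \<in> poly_lt R y m"
      and b: "b = y [^] n \<oplus> g" "g \<in> poly_lt R y n" by blast
    have C: "f \<in> carrier Q" "g \<in> carrier Q" using plc a b by auto
    have "a \<otimes> b = y [^] (m + n) \<oplus> (y [^] m \<otimes> g \<oplus> y [^] n \<otimes> f \<oplus> f \<otimes> g)"
      using C y by (simp add: a b l_distr r_distr nat_pow_mult[symmetric] m_ac a_ac)
    moreover have "y [^] m \<otimes> g \<oplus> y [^] n \<otimes> f \<oplus> f \<otimes> g \<in> poly_lt R y (m + n)"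
      using poly_lt_shift_pow[OF R_sub y b(2), of m] poly_lt_shift_pow[OF R_sub y a(2), of n]
        poly_lt_mult[OF R_sub y a(2) b(2)]
      by (intro poly_lt_add[OF R_sub y]) (simp_all add: add.commute)
    ultimately show "a \<otimes> b \<in> ?S" by blast
  qed blast
  have Ni: "ideal N Q" using P by (simp add: primeideal_def)
  have "y \<notin> N"
  proof
    assume "y \<in> N"
    moreover have "y = y [^] (1::nat) \<oplus> \<zero>" using y by simp
    then have "y \<in> ?S" using poly_lt_zero[OF R_sub y] by blast
    ultimately show False using NS by blast
  qed
  then obtain u where u: "u \<in> carrier Q" and yu: "y \<otimes> u \<ominus> \<one> \<in> N" using prime_inverse[OF P y] by blast
  let ?B = "\<Union>n. poly_lt R u n"
  note B = adjoin_subring[OF R_sub u]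
  have sub: "?B \<subseteq> ?B <+> N"
    using ideal_zero[OF Ni] poly_lt_carr[OF R_sub u] unfolding subset_iff ideal_sum_mem by (metis UN_E r_zero)
  have subN: "N \<subseteq> ?B <+> N"
    unfolding subset_iff ideal_sum_mem using subringE(2)[OF B] ideal_carr[OF Ni] by (metis l_zero)
  have not: "y \<notin> ?B <+> N"
  proof
    assume "y \<in> ?B <+> N"
    then obtain k f n where f: "f \<in> poly_lt R u k" and n: "n \<in> N" and eq: "y = f \<oplus> n"
      unfolding ideal_sum_mem by blast
    from poly_lt_invert[OF Ni y u yu f] obtain g where g: "g \<in> poly_lt R y (Suc k)"
      and gN: "y [^] k \<otimes> f \<ominus> g \<in> N" by blast
    define p where "p = y [^] k"
    have C: "f \<in> carrier Q" "n \<in> carrier Q" "g \<in> carrier Q" "p \<in> carrier Q"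
      using poly_lt_carr[OF R_sub u f] plc[OF g] ideal_carr[OF Ni n] y by (auto simp: p_def)
    have "p \<otimes> (f \<oplus> n) \<oplus> (\<ominus> g) = (p \<otimes> f \<ominus> g) \<oplus> p \<otimes> n" by (insert C, simp add: ring_norm)
    moreover have "\<dots> \<in> N" using ideal_add[OF Ni gN ideal_l[OF Ni n C(4)]] by (simp add: p_def)
    moreover have "p \<otimes> (f \<oplus> n) \<oplus> (\<ominus> g) = y [^] Suc k \<oplus> (\<ominus> g)" using eq by (simp add: p_def)
    moreover have "y [^] Suc k \<oplus> (\<ominus> g) \<in> ?S" using poly_lt_uminus[OF R_sub y g] by blast
    ultimately show False using NS by auto
  qed
  obtain V where V: "subring V Q" "?B <+> N \<subseteq> V" "y \<notin> V"
    "\<And>x y. x \<in> carrier Q - V \<Longrightarrow> y \<in> carrier Q - V \<Longrightarrow> x \<otimes> y \<notin> V"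
  proof (rule chevalley_valuation_ring[OF Ni _ subring_plus_ideal[OF B Ni] subN _ y not])
    show "u \<in> ?B <+> N" using sub adjoin_mem[OF R_sub u] by blast
    show "u \<otimes> y \<ominus> \<one> \<in> N" using yu u y by (simp add: m_comm)
  qed (use prime_inverse[OF P] in blast)+
  have "R \<subseteq> V" using V(2) sub adjoin_superset[OF R_sub u] by blast
  then have "V \<in> valuation_rings_over Q R"
    unfolding valuation_rings_over_def using V y by blast
  then show False using val V(3) by blast
qed

text \<open>By integrality all powers of \<open>y\<close> lie in the span of the first
  \<open>n\<close> of them, and finitely many generators have a common denominator
  \<open>t^B\<close>.\<close>

lemma power_bounded_of_valuation_rings:
  assumes y: "y \<in> carrier Q" and val: "\<And>V. V \<in> valuation_rings_over Q R \<Longrightarrow> y \<in> V"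
  shows "\<exists>B::nat. \<forall>k::nat. t [^] B \<otimes> y [^] k \<in> R"
proof -
  obtain n where n: "y [^] n \<in> poly_lt R y n" using integral_of_valuation_rings[OF assms] by blast
  note plc = poly_lt_carr[OF R_sub y]
  have closed: "y \<otimes> h \<in> poly_lt R y n" if h: "h \<in> poly_lt R y n" for h
  proof (cases n)
    case 0
    then show ?thesis using h y by simp
  next
    case (Suc m)
    then obtain f a where f: "h = f \<oplus> a \<otimes> y [^] m" "f \<in> poly_lt R y m" "a \<in> R" using h by auto
    have "y \<otimes> h = y \<otimes> f \<oplus> a \<otimes> y [^] n"
      using y plc[OF f(2)] R_carr[OF f(3)] by (simp add: f Suc r_distr m_ac)
    then show ?thesis
      using poly_lt_add[OF R_sub y poly_lt_shift[OF R_sub y f(2)] _] poly_lt_smult[OF R_sub y n f(3)] Suc by simp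
  qed
  have yk: "y [^] k \<in> poly_lt R y n" for k :: nat
  proof (induction k)
    case 0
    show ?case
    proof (cases "n = 0")
      case False
      then show ?thesis using poly_lt_const[OF R_sub y subringE(3)[OF R_sub], of n] by simp
    qed (use n in simp)
  next
    case (Suc k)
    then show ?case using closed[OF Suc] y by (simp add: m_comm)
  qed
  have "\<exists>B::nat. \<forall>h\<in>poly_lt R y m. t [^] B \<otimes> h \<in> R" for m
  proof (induction m)
    case 0
    then show ?case using tc subringE(2)[OF R_sub] by simp
  next
    case (Suc m)
    then obtain B :: nat where B: "\<And>h. h \<in> poly_lt R y m \<Longrightarrow> t [^] B \<otimes> h \<in> R" by blast
    obtain b :: nat where b: "t [^] b \<otimes> y [^] m \<in> R" using frac y by blast
    have "t [^] (B + b) \<otimes> h \<in> R" if h: "h \<in> poly_lt R y (Suc m)" for h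
    proof -
      obtain f a where f: "h = f \<oplus> a \<otimes> y [^] m" "f \<in> poly_lt R y m" "a \<in> R" using h by auto
      have "t [^] (B + b) \<otimes> h = t [^] b \<otimes> (t [^] B \<otimes> f) \<oplus> t [^] B \<otimes> (a \<otimes> (t [^] b \<otimes> y [^] m))"
        using y plc[OF f(2)] R_carr[OF f(3)] tc by (simp add: f r_distr nat_pow_mult[symmetric] m_ac)
      then show ?thesis
        using B[OF f(2)] b f(3) subring_pow[OF R_sub tR] by (simp add: subringE(6,7)[OF R_sub])
    qed
    then show ?case by blast
  qed
  then show ?thesis using yk by blast
qed

text \<open>With \<open>W\<close> the intersection of the valuation rings, it suffices that
  \<open>R \<inter> t^k W\<close> lies in \<open>t R\<close> for some \<open>k\<close>: then the
  least \<open>s\<close> with \<open>t^s y \<in> R\<close> cannot exceed \<open>k\<close>, as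
  otherwise a factor \<open>t\<close> could be cancelled. This is finiteness of the integral closure
  in the form of a common denominator.\<close>

lemma valuation_rings_conductor:
  assumes red: "reduced_ring (adic_completion (sub_ring Q R) M)"
  shows "\<exists>k::nat. \<forall>y\<in>carrier Q. (\<forall>V\<in>valuation_rings_over Q R. y \<in> V) \<longrightarrow> t [^] k \<otimes> y \<in> R"
proof -
  define W where "W = {y \<in> carrier Q. \<forall>V\<in>valuation_rings_over Q R. y \<in> V}"
  have Wadd: "x \<oplus> y \<in> W" and Wmult: "x \<otimes> y \<in> W" if "x \<in> W" "y \<in> W" for x y
    using that unfolding W_def valuation_rings_over_def by (auto intro: subringE(6,7))
  have RW: "R \<subseteq> W" unfolding W_def valuation_rings_over_def using R_carr by auto
  have Wc: "y \<in> W \<Longrightarrow> y \<in> carrier Q" for y by (simp add: W_def)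
  define D where "D k = {x \<in> R. \<exists>y\<in>W. x = t [^] (k::nat) \<otimes> y}" for k
  have "ideal (D k) (sub_ring Q R)" for k
  proof (rule L.idealI')
    show "D k \<subseteq> carrier (sub_ring Q R)" by (auto simp: D_def)
    have "\<zero> = t [^] k \<otimes> \<zero>" using tc by simp
    then show "\<zero>\<^bsub>sub_ring Q R\<^esub> \<in> D k" using subringE(2)[OF R_sub] RW by (auto simp: D_def)
  next
    fix x x' assume "x \<in> D k" "x' \<in> D k"
    then obtain y y' where y: "x \<in> R" "x' \<in> R" "y \<in> W" "y' \<in> W" "x = t [^] k \<otimes> y" "x' = t [^] k \<otimes> y'"
      by (auto simp: D_def)
    then have "x \<oplus> x' = t [^] k \<otimes> (y \<oplus> y')" using tc Wc by (simp add: r_distr)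
    moreover have "x \<oplus> x' \<in> R" using y(1,2) by (rule subringE(7)[OF R_sub])
    ultimately show "x \<oplus>\<^bsub>sub_ring Q R\<^esub> x' \<in> D k" using Wadd[OF y(3,4)] by (auto simp: D_def)
  next
    fix a x assume a: "a \<in> carrier (sub_ring Q R)" and "x \<in> D k"
    then obtain y where y: "x \<in> R" "y \<in> W" "x = t [^] k \<otimes> y" by (auto simp: D_def)
    then have "a \<otimes> x = t [^] k \<otimes> (a \<otimes> y)" using tc Wc a R_carr by (simp add: m_lcomm)
    moreover have "a \<otimes> x \<in> R" using subringE(6)[OF R_sub, of a x] a y(1) by simp
    moreover have "a \<otimes> y \<in> W" using Wmult[of a y] a y(2) RW by auto
    ultimately show "a \<otimes>\<^bsub>sub_ring Q R\<^esub> x \<in> D k" by (auto simp: D_def)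
  qed
  moreover have "D (Suc k) \<subseteq> D k" for k
  proof
    fix x assume "x \<in> D (Suc k)"
    then obtain y where y: "x \<in> R" "y \<in> W" "x = t [^] Suc k \<otimes> y" by (auto simp: D_def)
    then have "x = t [^] k \<otimes> (t \<otimes> y)" using tc Wc by (simp add: m_assoc)
    then show "x \<in> D k" using y Wmult RW tR by (auto simp: D_def)
  qed
  moreover have "\<exists>B::nat. \<forall>n. \<forall>r\<in>carrier (sub_ring Q R).
      t [^]\<^bsub>sub_ring Q R\<^esub> B \<otimes>\<^bsub>sub_ring Q R\<^esub> (d \<oplus>\<^bsub>sub_ring Q R\<^esub> t [^]\<^bsub>sub_ring Q R\<^esub> k \<otimes>\<^bsub>sub_ring Q R\<^esub> r)
        [^]\<^bsub>sub_ring Q R\<^esub> n \<in> L.tp (k * n)" if d: "d \<in> D k" for k d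
  proof -
    obtain y where y: "y \<in> W" "d = t [^] k \<otimes> y" using d by (auto simp: D_def)
    obtain B :: nat where B: "\<And>m::nat. t [^] B \<otimes> y [^] m \<in> R"
      using power_bounded_of_valuation_rings[of y] y by (auto simp: W_def)
    have "t [^] B \<otimes> (d \<oplus> t [^] k \<otimes> r) [^] n \<in> L.tp (k * n)" if r: "r \<in> R" for r and n :: nat
    proof -
      note C = R_carr[OF r] Wc[OF y(1)]
      \<comment> \<open>The factor \<open>y^m\<close> is carried along so that expanding one factor
        \<open>y + r\<close> closes the induction. Thus the \<open>B\<close> found for the powers of
        \<open>y\<close> also serves \<open>y + r\<close>, for every \<open>r\<close> in
        \<open>R\<close>.\<close>
      have shift: "t [^] B \<otimes> ((y \<oplus> r) [^] n \<otimes> y [^] m) \<in> R" for m :: nat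
      proof (induction n arbitrary: m)
        case 0
        then show ?case using B C by simp
      next
        case (Suc n)
        have "t [^] B \<otimes> ((y \<oplus> r) [^] Suc n \<otimes> y [^] m)
            = t [^] B \<otimes> ((y \<oplus> r) [^] n \<otimes> y [^] Suc m) \<oplus> r \<otimes> (t [^] B \<otimes> ((y \<oplus> r) [^] n \<otimes> y [^] m))"
          using C tc by (simp add: r_distr l_distr m_ac)
        then show ?case using Suc[of m] Suc[of "Suc m"] r by (simp add: subringE(6,7)[OF R_sub])
      qed
      have "d \<oplus> t [^] k \<otimes> r = t [^] k \<otimes> (y \<oplus> r)" using y C tc by (simp add: r_distr)
      then have "(d \<oplus> t [^] k \<otimes> r) [^] n = t [^] (k * n) \<otimes> (y \<oplus> r) [^] n"
        using C tc nat_pow_distrib[of "t [^] k" "y \<oplus> r" n] by (simp add: nat_pow_pow)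
      then have "t [^] B \<otimes> (d \<oplus> t [^] k \<otimes> r) [^] n = (t [^] B \<otimes> (y \<oplus> r) [^] n) \<otimes> t [^] (k * n)"
        using C tc by (simp add: m_ac)
      moreover have "t [^] B \<otimes> (y \<oplus> r) [^] n \<in> R" using shift[of 0] C tc by simp
      ultimately show ?thesis by (auto simp: L.PIdl_mem)
    qed
    then show ?thesis by (intro exI[of _ B]) simp
  qed
  ultimately obtain k where k: "D k \<subseteq> L.tp 1"
    using L.decreasing_ideals_le_tp_1[OF red, of D] by metis
  have "t [^] k \<otimes> y \<in> R" if y: "y \<in> W" for y
  proof -
    define s where "s = (LEAST n. t [^] (n::nat) \<otimes> y \<in> R)"
    have s: "t [^] s \<otimes> y \<in> R" unfolding s_def using frac[OF Wc[OF y]] by (rule LeastI_ex)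
    have "s \<le> k"
    proof (rule ccontr)
      assume "\<not> s \<le> k"
      then have sk: "s = k + (s - k)" and s0: "s = Suc (s - 1)" by auto
      have "t [^] s \<otimes> y = t [^] k \<otimes> (t [^] (s - k) \<otimes> y)"
        using tc Wc[OF y] sk by (metis m_assoc nat_pow_closed nat_pow_mult)
      moreover have "t [^] (s - k) \<otimes> y \<in> W"
        using Wmult[OF _ y] RW subring_pow[OF R_sub tR] by blast
      ultimately have "t [^] s \<otimes> y \<in> D k" using s by (auto simp: D_def)
      then have "t [^] s \<otimes> y \<in> L.tp 1" using k by blast
      then obtain r where r: "r \<in> R" "t [^] s \<otimes> y = r \<otimes> t" using tc by (auto simp: L.PIdl_mem)
      have "t [^] s \<otimes> y = t \<otimes> (t [^] (s - 1) \<otimes> y)"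
        using tc Wc[OF y] by (subst s0) (simp add: m_ac)
      then have "t \<otimes> (t [^] (s - 1) \<otimes> y) = t \<otimes> r" using r tc R_carr by (simp add: m_comm)
      then have "t [^] (s - 1) \<otimes> y = r"
        using Units_l_cancel[OF t_unit] tc Wc[OF y] R_carr r by simp
      then have "t [^] (s - 1) \<otimes> y \<in> R" using r by simp
      then have "s \<le> s - 1" unfolding s_def by (rule Least_le)
      then show False using s0 by simp
    qed
    have "t [^] k \<otimes> y = t [^] (k - s) \<otimes> (t [^] s \<otimes> y)"
      using tc Wc[OF y] \<open>s \<le> k\<close> by (metis le_add_diff_inverse2 m_assoc nat_pow_closed nat_pow_mult)
    then show ?thesis using s subring_pow[OF R_sub tR] by (simp add: subringE(6)[OF R_sub])
  qed
  then show ?thesis unfolding W_def by blast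
qed

section \<open>Valuations and residues\<close>

lemma regular_in_R_unit: "s \<in> regular_elements (sub_ring Q R) \<Longrightarrow> s \<in> Units Q"
proof -
  assume s: "s \<in> regular_elements (sub_ring Q R)"
  then have sR: "s \<in> R" by (simp add: regular_elements_def)
  have "\<exists>m::nat. t [^]\<^bsub>sub_ring Q R\<^esub> m \<in> PIdl\<^bsub>sub_ring Q R\<^esub> s"
    by (rule L.t_pow_in_regular_ideal[OF L.cgenideal_ideal L.cgenideal_self])
      (use s in \<open>auto simp: regular_elements_def\<close>)
  then obtain m :: nat and r where r: "r \<in> R" "t [^] m = r \<otimes> s" by (auto simp: L.PIdl_mem)
  have "s \<otimes> (r \<otimes> inv t [^] m) = \<one>"
    using r t_inv_pow[of m] R_carr sR tc by (metis m_assoc m_comm m_closed nat_pow_closed)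
  then show ?thesis
    unfolding Units_def using r R_carr sR tc by (auto intro!: bexI[of _ "r \<otimes> inv t [^] m"] simp: m_comm)
qed

lemma regular_elements_Q: "regular_elements Q = Units Q"
proof
  show "Units Q \<subseteq> regular_elements Q"
  proof
    fix x assume x: "x \<in> Units Q"
    have "y = \<zero>" if "y \<in> carrier Q" "x \<otimes> y = \<zero>" for y
      using Units_l_cancel[OF x, of y \<zero>] that x by auto
    then show "x \<in> regular_elements Q" using x by (auto simp: regular_elements_def)
  qed
  show "regular_elements Q \<subseteq> Units Q"
  proof
    fix x assume x: "x \<in> regular_elements Q"
    then have xc: "x \<in> carrier Q" by (simp add: regular_elements_def)
    obtain n :: nat where n: "t [^] n \<otimes> x \<in> R" using frac[OF xc] by blast
    have "y = \<zero>" if y: "y \<in> R" "t [^] n \<otimes> x \<otimes> y = \<zero>" for y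
    proof -
      have "x \<otimes> (t [^] n \<otimes> y) = \<zero>" using y xc R_carr tc by (metis m_assoc m_comm m_closed nat_pow_closed)
      then have "t [^] n \<otimes> y = \<zero>" using x R_carr[OF y(1)] tc by (auto simp: regular_elements_def)
      then show ?thesis using L.t_pow_reg[of y n] y by simp
    qed
    then have "t [^] n \<otimes> x \<in> Units Q"
      using n by (intro regular_in_R_unit) (auto simp: regular_elements_def)
    then show "x \<in> Units Q" using xc tc by (metis m_comm nat_pow_closed unit_factor)
  qed
qed

end

text \<open>Depth equal to dimension one gives a regular sequence in \<open>M\<close> of positive
  length. Its first entry is a regular element, since the ideal generated by the empty set is zero;
  this entry is \<open>t\<close>.\<close>

lemma admissible_imp_frac_ring:
  fixes Q (structure)
  assumes "admissible Q R M"
  obtains t where "frac_ring Q R M t"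
proof -
  let ?S = "sub_ring Q R"
  interpret cring Q using assms by (simp add: admissible_def total_ring_of_fractions_def)
  have R: "subring R Q" and reg: "regular_elements ?S \<subseteq> Units Q"
    and frac: "\<And>q. q \<in> carrier Q \<Longrightarrow> \<exists>s\<in>regular_elements ?S. s \<otimes> q \<in> R"
    and loc: "is_local_ring ?S M" and noeth: "noetherian_ring ?S" and dim: "krull_dim ?S = 1"
    and cm: "cohen_macaulay ?S M"
    using assms by (auto simp: admissible_def total_ring_of_fractions_def)
  interpret S: cring ?S using loc by (simp add: is_local_ring_def)
  have chain: "\<not> P1 \<subset> P2" if P: "primeideal P0 ?S" "primeideal P1 ?S" "primeideal P2 ?S" "P0 \<subset> P1" for P0 P1 P2
  proof
    assume "P1 \<subset> P2"
    define P where "P i = (if i = 0 then P0 else if i = 1 then P1 else P2)" for i :: nat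
    have "\<forall>i\<le>2. primeideal (P i) ?S" "\<forall>i<2. P i \<subset> P (Suc i)"
      using P \<open>P1 \<subset> P2\<close> by (auto simp: P_def)
    then have "enat 2 \<le> krull_dim ?S" unfolding krull_dim_def by (intro Sup_upper) blast
    then show False using dim by (simp add: one_enat_def)
  qed
  have "0 < depth ?S M" using cm dim by (simp add: cohen_macaulay_def)
  then obtain xs where xs: "0 < length xs" "set xs \<subseteq> M" "regular_sequence ?S xs"
    unfolding depth_def less_Sup_iff by (auto simp: zero_enat_def)
  define t where "t = xs ! 0"
  have tM: "t \<in> M" using xs by (auto simp: t_def)
  have "genideal ?S {} = {\<zero>}"
    using S.genideal_minimal[OF S.zeroideal, of "{}"] S.ideal_zero[OF S.genideal_ideal[of "{}"]] by auto
  then have t_reg: "y = \<zero>" if "y \<in> R" "t \<otimes> y = \<zero>" for y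
    using xs that by (auto simp: regular_sequence_def t_def)
  have L: "local_dim_one ?S M t"
  proof (intro local_dim_one.intro local_dim_one_axioms.intro)
    show "maximalideal M ?S" "\<And>N. maximalideal N ?S \<Longrightarrow> N = M" using loc by (auto simp: is_local_ring_def)
    show "\<And>P0 P1 P2. primeideal P0 ?S \<Longrightarrow> primeideal P1 ?S \<Longrightarrow> primeideal P2 ?S \<Longrightarrow> P0 \<subset> P1 \<Longrightarrow> \<not> P1 \<subset> P2"
      by (rule chain)
    show "t \<in> M" by (rule tM)
    show "\<And>y. y \<in> carrier ?S \<Longrightarrow> t \<otimes>\<^bsub>?S\<^esub> y = \<zero>\<^bsub>?S\<^esub> \<Longrightarrow> y = \<zero>\<^bsub>?S\<^esub>" using t_reg by simp
  qed (rule S.is_cring noeth)+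
  then interpret L: local_dim_one ?S M t .
  have pw [simp]: "x [^]\<^bsub>?S\<^esub> (n::nat) = x [^] n" for x n by (induction n) auto
  have tR: "t \<in> R" using L.t_carr by simp
  show ?thesis
  proof (rule that, intro frac_ring.intro frac_ring_axioms.intro)
    show "cring Q" by (rule is_cring)
    show "local_dim_one ?S M t" by (rule L)
    show "subring R Q" by (rule R)
    show "t \<in> Units Q" using reg t_reg tR by (auto simp: regular_elements_def)
    fix q assume q: "q \<in> carrier Q"
    then obtain s where s: "s \<in> regular_elements ?S" "s \<otimes> q \<in> R" using frac by blast
    then have sR: "s \<in> R" by (simp add: regular_elements_def)
    have "\<exists>m::nat. t [^]\<^bsub>?S\<^esub> m \<in> PIdl\<^bsub>?S\<^esub> s"
      by (rule L.t_pow_in_regular_ideal[OF S.cgenideal_ideal S.cgenideal_self])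
        (use s in \<open>auto simp: regular_elements_def\<close>)
    then obtain m :: nat and r where r: "r \<in> R" "t [^] m = r \<otimes> s" by (auto simp: S.PIdl_mem)
    have "t [^] m \<otimes> q = r \<otimes> (s \<otimes> q)"
      using r sR q subringE(1)[OF R] by (simp add: m_assoc subset_iff)
    then show "\<exists>n::nat. t [^] n \<otimes> q \<in> R" using subringE(6)[OF R r(1) s(2)] by metis
  qed
qed

locale valued_frac_ring = frac_ring +
  fixes v :: "'n::finite \<Rightarrow> 'a \<Rightarrow> int extended"
  assumes val: "associated_valuations Q R v"
    and res: "residually_rational Q R M"
    and card: "valuation_rings_over Q R \<lesssim> carrier (sub_ring Q R Quot M)"
    and red: "reduced_ring (adic_completion (sub_ring Q R) M)"
begin

section \<open>Arithmetic of the valuations\<close>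

lemma dv: "discrete_valuation Q (v i)"
  using val by (simp add: associated_valuations_def)

lemma v_range: "x \<in> carrier Q \<Longrightarrow> v i x = Pinf \<or> (\<exists>a. v i x = Fin a)"
  using dv[of i] unfolding discrete_valuation_def by blast

lemma v_surj: obtains x where "x \<in> carrier Q" "v i x = Fin a"
proof -
  have "Fin a \<in> v i ` carrier Q" using dv[of i] unfolding discrete_valuation_def by blast
  then show ?thesis using that by (metis imageE)
qed

lemma v_mult: "x \<in> carrier Q \<Longrightarrow> y \<in> carrier Q \<Longrightarrow> v i (x \<otimes> y) = v i x + v i y"
  using dv[of i] unfolding discrete_valuation_def by blast

lemma v_zero [simp]: "v i \<zero> = Pinf" and v_one [simp]: "v i \<one> = Fin 0"
  using dv[of i] by (auto simp: discrete_valuation_def zero_extended_def)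

lemma v_add_ge:
  assumes "x \<in> carrier Q" "y \<in> carrier Q" "Fin a \<le> v i x" "Fin a \<le> v i y"
  shows "Fin a \<le> v i (x \<oplus> y)"
proof -
  have "min (v i x) (v i y) \<le> v i (x \<oplus> y)" using dv[of i] assms unfolding discrete_valuation_def by blast
  then show ?thesis using assms(3,4) by (auto simp: min_def split: if_splits)
qed

lemma v_mult_ge:
  assumes "x \<in> carrier Q" "y \<in> carrier Q" "Fin a \<le> v i x" "Fin b \<le> v i y"
  shows "Fin (a + b) \<le> v i (x \<otimes> y)"
  using assms v_mult[of x y i] v_range[of x i] v_range[of y i] by auto

lemma v_mult_eq:
  assumes "x \<in> carrier Q" "y \<in> carrier Q" "v i x = Fin a" "v i y = Fin b"
  shows "v i (x \<otimes> y) = Fin (a + b)"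
  using assms v_mult[of x y i] by simp

lemma v_uminus_one: "v i (\<ominus> \<one>) = Fin 0"
proof -
  have "v i (\<ominus> \<one>) + v i (\<ominus> \<one>) = Fin 0"
    using v_mult[of "\<ominus> \<one>" "\<ominus> \<one>" i] by (simp add: l_minus)
  then show ?thesis using v_range[of "\<ominus> \<one>" i] by auto
qed

lemma v_uminus [simp]: "x \<in> carrier Q \<Longrightarrow> v i (\<ominus> x) = v i x"
proof -
  assume x: "x \<in> carrier Q"
  then have "v i (\<ominus> x) = Fin 0 + v i x"
    using v_mult[of "\<ominus> \<one>" x i] v_uminus_one by (simp add: l_minus)
  then show ?thesis using x v_range[of x i] by auto
qed

lemma v_diff_ge:
  assumes "x \<in> carrier Q" "y \<in> carrier Q" "Fin a \<le> v i x" "Fin a \<le> v i y"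
  shows "Fin a \<le> v i (x \<ominus> y)"
  using v_add_ge[of x "\<ominus> y"] assms by (simp add: a_minus_def)

lemma v_le_trans: "Fin b \<le> v i x \<Longrightarrow> a \<le> b \<Longrightarrow> Fin a \<le> v i x"
  by (erule order_trans[rotated]) simp

lemma v_add_eq:
  assumes x: "x \<in> carrier Q" and y: "y \<in> carrier Q" and vx: "v i x = Fin a" and vy: "Fin (a + 1) \<le> v i y"
  shows "v i (x \<oplus> y) = Fin a"
proof -
  have ge: "Fin a \<le> v i (x \<oplus> y)" using v_add_ge[OF x y, of a i] vx v_le_trans[OF vy] by simp
  have "\<not> Fin (a + 1) \<le> v i (x \<oplus> y)"
  proof
    assume "Fin (a + 1) \<le> v i (x \<oplus> y)"
    then have "Fin (a + 1) \<le> v i ((x \<oplus> y) \<ominus> y)" using v_diff_ge[of "x \<oplus> y" y] x y vy by simp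
    moreover have "(x \<oplus> y) \<ominus> y = x" by (insert x y, simp add: ring_norm)
    ultimately show False using vx by simp
  qed
  then show ?thesis using ge x y v_range[of "x \<oplus> y" i] by auto
qed

lemma v_diff_eq:
  assumes "x \<in> carrier Q" "y \<in> carrier Q" "v i x = Fin a" "Fin (a + 1) \<le> v i y"
  shows "v i (x \<ominus> y) = Fin a"
  using v_add_eq[of x "\<ominus> y"] assms by (simp add: a_minus_def)

lemma v_lower_bound:
  assumes "x \<in> carrier Q" obtains a where "Fin a \<le> v i x"
  using v_range[OF assms, of i] that by (metis order_refl le_Pinf)

lemma v_pow_ge: "x \<in> carrier Q \<Longrightarrow> Fin a \<le> v i x \<Longrightarrow> Fin (int n * a) \<le> v i (x [^] (n::nat))"
proof (induction n)
  case (Suc n)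
  then show ?case using v_mult_ge[of "x [^] n" x "int n * a" i a] by (simp add: algebra_simps)
qed simp

lemma v_pow_eq: "x \<in> carrier Q \<Longrightarrow> v i x = Fin a \<Longrightarrow> v i (x [^] (n::nat)) = Fin (int n * a)"
proof (induction n)
  case (Suc n)
  then show ?case using v_mult_eq[of "x [^] n" x i "int n * a" a] by (simp add: algebra_simps)
qed simp

lemma v_unit:
  assumes "x \<in> Units Q" obtains a where "v i x = Fin a" "v i (inv x) = Fin (- a)"
proof -
  have "v i x + v i (inv x) = Fin 0" using v_mult[of x "inv x" i] assms Units_closed[OF assms] by simp
  then obtain a b where "v i x = Fin a" "v i (inv x) = Fin b" "a + b = 0"
    using v_range[OF Units_closed[OF assms], of i] v_range[OF Units_inv_closed[OF assms], of i] by auto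
  then show ?thesis using that by (metis add_eq_0_iff)
qed

lemma valuation_ring_mem: "x \<in> valuation_ring_of Q (v i) \<longleftrightarrow> x \<in> carrier Q \<and> Fin 0 \<le> v i x"
  by (simp add: valuation_ring_of_def zero_extended_def)

lemma valuation_ring_over: "valuation_ring_of Q (v i) \<in> valuation_rings_over Q R"
  using val unfolding associated_valuations_def by (metis UNIV_I bij_betwE)

lemma valuation_rings_over_cases:
  assumes "V \<in> valuation_rings_over Q R" obtains i where "V = valuation_ring_of Q (v i)"
  using val assms unfolding associated_valuations_def bij_betw_def by blast

lemma v_R: "x \<in> R \<Longrightarrow> Fin 0 \<le> v i x"
  using valuation_ring_over[of i] valuation_ring_mem unfolding valuation_rings_over_def by blast

text \<open>For the converse, some valuation ring contains an ideal \<open>N\<close> of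
  \<open>Q\<close> through the nonunit \<open>x\<close>. Were the corresponding value of
  \<open>x\<close> finite, a multiple of \<open>x\<close> would have value -1 and yet lie in
  \<open>N\<close>.\<close>

lemma unit_iff_finite:
  assumes x: "x \<in> carrier Q" shows "x \<in> Units Q \<longleftrightarrow> (\<forall>i. v i x \<noteq> Pinf)"
proof
  show "x \<in> Units Q \<Longrightarrow> \<forall>i. v i x \<noteq> Pinf" using v_unit by (metis extended.distinct(1))
next
  assume fin: "\<forall>i. v i x \<noteq> Pinf"
  show "x \<in> Units Q"
  proof (rule ccontr)
    assume "x \<notin> Units Q"
    then obtain V N where V: "V \<in> valuation_rings_over Q R" and N: "ideal N Q" "x \<in> N" "N \<subseteq> V"
      using nonunit_valuation_ring[OF x] by blast
    obtain i where i: "V = valuation_ring_of Q (v i)" using valuation_rings_over_cases[OF V] .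
    obtain a where a: "v i x = Fin a" using fin x v_range[of x i] by auto
    obtain q where q: "q \<in> carrier Q" "v i q = Fin (- a - 1)" by (rule v_surj)
    have "q \<otimes> x \<in> V" using ideal_l[OF N(1,2) q(1)] N(3) by blast
    then show False using v_mult_eq[OF q(1) x q(2) a] by (simp add: i valuation_ring_mem)
  qed
qed

lemma valuation_ideal_mem:
  "x \<in> valuation_ideal Q (valuation_ring_of Q (v i)) \<longleftrightarrow> x \<in> carrier Q \<and> Fin 1 \<le> v i x"
proof
  assume "x \<in> valuation_ideal Q (valuation_ring_of Q (v i))"
  then obtain y where x: "x \<in> carrier Q" "Fin 0 \<le> v i x" and y: "y \<in> carrier Q" "\<not> Fin 0 \<le> v i y"
    and xy: "Fin 0 \<le> v i (x \<otimes> y)"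
    by (auto simp: valuation_ideal_def valuation_ring_mem)
  obtain b where b: "v i y = Fin b" "b < 0" using y v_range[of y i] by auto
  show "x \<in> carrier Q \<and> Fin 1 \<le> v i x"
    using x xy b v_mult[OF x(1) y(1), of i] v_range[of x i] by auto
next
  assume x: "x \<in> carrier Q \<and> Fin 1 \<le> v i x"
  obtain y where y: "y \<in> carrier Q" "v i y = Fin (- 1)" by (rule v_surj)
  have "Fin 0 \<le> v i (x \<otimes> y)" using v_mult_ge[of x y 1 i "-1"] x y by simp
  then show "x \<in> valuation_ideal Q (valuation_ring_of Q (v i))"
    using x y v_le_trans[of 1 i x 0]
    by (auto simp: valuation_ideal_def valuation_ring_mem intro!: bexI[of _ y])
qed

lemma residue_map:
  defines "mm \<equiv> \<lambda>i. valuation_ideal Q (valuation_ring_of Q (v i))"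
  shows "(\<lambda>C. mm i <+> C) ` (a_rcosets\<^bsub>sub_ring Q R\<^esub> M)
    = a_rcosets\<^bsub>Q\<lparr>carrier := valuation_ring_of Q (v i)\<rparr>\<^esub> (mm i)"
  using res valuation_ring_over[of i]
  unfolding residually_rational_def ring_iso_def bij_betw_def FactRing_def mm_def by simp

lemma S_rcosets: "a_rcosets\<^bsub>Q\<lparr>carrier := V\<rparr>\<^esub> N = (\<lambda>a. {n \<oplus> a | n. n \<in> N}) ` V"
  unfolding A_RCOSETS_def' a_r_coset_def' by auto

text \<open>Domination comes out of residual rationality: the residue map sends the coset
  \<open>M\<close> to a coset of the valuation ideal. As this image contains zero, it is the
  valuation ideal itself, and it contains \<open>M\<close>.\<close>

lemma v_M: "x \<in> M \<Longrightarrow> Fin 1 \<le> v i x"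
proof -
  assume xM: "x \<in> M"
  let ?V = "valuation_ring_of Q (v i)"
  let ?m = "valuation_ideal Q ?V"
  have mem: "y \<in> ?m \<longleftrightarrow> y \<in> carrier Q \<and> Fin 1 \<le> v i y" for y by (rule valuation_ideal_mem)
  have MC: "\<And>m. m \<in> M \<Longrightarrow> m \<in> carrier Q" using M_subset_R R_carr by blast
  have zM: "\<zero> \<in> M" using L.ideal_zero[OF L.M_ideal] by simp
  have "M = {n \<oplus> \<zero> | n. n \<in> M}" using MC by (auto intro: r_zero[symmetric])
  then have "M \<in> a_rcosets\<^bsub>sub_ring Q R\<^esub> M"
    unfolding S_rcosets using subringE(2)[OF R_sub] by blast
  then have "?m <+> M \<in> a_rcosets\<^bsub>Q\<lparr>carrier := ?V\<rparr>\<^esub> ?m" using residue_map[of i] by blast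
  then obtain a where a: "a \<in> ?V" and eq: "?m <+> M = {n \<oplus> a | n. n \<in> ?m}" unfolding S_rcosets by blast
  have ac: "a \<in> carrier Q" using a valuation_ring_mem by simp
  have "\<zero> \<oplus> \<zero> \<in> ?m <+> M" unfolding ideal_sum_mem using zM by (metis mem v_zero le_Pinf zero_closed)
  then obtain n where n: "n \<in> ?m" "\<zero> \<oplus> \<zero> = n \<oplus> a" using eq by blast
  then have "a = \<ominus> n" using ac mem by (metis l_zero minus_equality minus_minus zero_closed a_comm)
  then have am: "a \<in> carrier Q" "Fin 1 \<le> v i a" using n(1) mem by auto
  have "\<zero> \<oplus> x \<in> ?m <+> M" unfolding ideal_sum_mem using xM by (metis mem v_zero le_Pinf zero_closed)
  then obtain n' where n': "n' \<in> ?m" "\<zero> \<oplus> x = n' \<oplus> a" using eq by blast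
  then show ?thesis using v_add_ge[of n' a 1 i] mem[of n'] am MC[OF xM] by simp
qed

lemma v_unit_R: "a \<in> R \<Longrightarrow> a \<notin> M \<Longrightarrow> v i a = Fin 0"
proof -
  assume a: "a \<in> R" "a \<notin> M"
  then obtain b where b: "b \<in> R" "a \<otimes> b = \<one>" by (rule unit_outside_M)
  have "v i a + v i b = Fin 0" using v_mult[of a b i] R_carr a b by simp
  then show ?thesis using v_R[OF a(1), of i] v_R[OF b(1), of i] R_carr a b v_range[of a i] v_range[of b i] by auto
qed

lemma residue:
  assumes x: "x \<in> carrier Q" "Fin 0 \<le> v i x"
  shows "\<exists>a\<in>R. Fin 1 \<le> v i (x \<ominus> a)"
proof -
  let ?V = "valuation_ring_of Q (v i)"
  let ?m = "valuation_ideal Q ?V"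
  have mem: "y \<in> ?m \<longleftrightarrow> y \<in> carrier Q \<and> Fin 1 \<le> v i y" for y by (rule valuation_ideal_mem)
  have zm: "\<zero> \<in> ?m" using mem by simp
  have zM: "\<zero> \<in> M" using L.ideal_zero[OF L.M_ideal] by simp
  have "{n \<oplus> x | n. n \<in> ?m} \<in> a_rcosets\<^bsub>Q\<lparr>carrier := ?V\<rparr>\<^esub> ?m"
    unfolding S_rcosets using x valuation_ring_mem by blast
  then obtain C where C: "C \<in> a_rcosets\<^bsub>sub_ring Q R\<^esub> M" "{n \<oplus> x | n. n \<in> ?m} = ?m <+> C"
    using residue_map[of i] by blast
  then obtain a where a: "a \<in> R" "C = {n \<oplus> a | n. n \<in> M}" unfolding S_rcosets by blast
  have "\<zero> \<oplus> (\<zero> \<oplus> a) \<in> ?m <+> C" unfolding ideal_sum_mem a(2) using zm zM by blast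
  then obtain n where n: "n \<in> ?m" "\<zero> \<oplus> (\<zero> \<oplus> a) = n \<oplus> x" using C(2) by blast
  have nc: "n \<in> carrier Q" using n mem by simp
  have an: "a = n \<oplus> x" using n(2) R_carr[OF a(1)] by simp
  have "x \<ominus> a = \<ominus> n" unfolding an by (insert nc x(1), simp add: ring_norm)
  then show ?thesis using a(1) n(1) mem[of n] by (intro bexI[of _ a]) auto
qed

text \<open>Multiplication by \<open>u\<close> of value \<open>-a\<close> makes both values
  nonnegative, and \<open>r\<close> is the quotient of the two residues, formed in \<open>R\<close>.
  Since \<open>u\<close> may have infinite value at other places, it is never inverted: the factor
  is removed by comparing values at \<open>i\<close>.\<close>

lemma residue_match:
  assumes x: "x \<in> carrier Q" "Fin a \<le> v i x" and y: "y \<in> carrier Q" "v i y = Fin a"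
  shows "\<exists>r\<in>R. Fin (a + 1) \<le> v i (x \<ominus> r \<otimes> y)"
proof -
  obtain u where u: "u \<in> carrier Q" "v i u = Fin (- a)" by (rule v_surj)
  have xu: "x \<otimes> u \<in> carrier Q" "Fin 0 \<le> v i (x \<otimes> u)" using v_mult_ge[of x u a i "-a"] x u by auto
  have yu: "y \<otimes> u \<in> carrier Q" "v i (y \<otimes> u) = Fin 0" using v_mult_eq[of y u i a "-a"] y u by auto
  obtain c where c: "c \<in> R" "Fin 1 \<le> v i (x \<otimes> u \<ominus> c)" using residue[OF xu] by blast
  obtain b where b: "b \<in> R" "Fin 1 \<le> v i (y \<otimes> u \<ominus> b)" using residue[OF yu(1), of i] yu(2) by auto
  have "b \<notin> M"
  proof
    assume "b \<in> M"
    then have "Fin 1 \<le> v i ((y \<otimes> u \<ominus> b) \<oplus> b)"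
      using v_add_ge[of "y \<otimes> u \<ominus> b" b 1 i] yu b R_carr v_M by simp
    moreover have "(y \<otimes> u \<ominus> b) \<oplus> b = y \<otimes> u"
      by (insert y(1) u(1) R_carr[OF b(1)], simp add: ring_norm)
    ultimately show False using yu by simp
  qed
  then obtain b' where b': "b' \<in> R" "b \<otimes> b' = \<one>" using unit_outside_M b by blast
  define r where "r = c \<otimes> b'"
  have rR: "r \<in> R" using c b' subringE(6)[OF R_sub] by (simp add: r_def)
  have rb: "r \<otimes> b = c"
    using b' R_carr[OF b(1)] R_carr[OF c(1)] R_carr[OF b'(1)] by (simp add: r_def m_assoc m_comm[of b' b])
  note C = x(1) y(1) u(1) R_carr[OF rR] R_carr[OF b(1)]
  have "(x \<ominus> r \<otimes> y) \<otimes> u = (x \<otimes> u \<ominus> r \<otimes> b) \<ominus> r \<otimes> (y \<otimes> u \<ominus> b)"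
    by (insert C, simp add: ring_norm)
  moreover have "Fin 1 \<le> v i \<dots>"
  proof (rule v_diff_ge)
    show "Fin 1 \<le> v i (r \<otimes> (y \<otimes> u \<ominus> b))"
      using v_mult_ge[OF R_carr[OF rR] _ v_R[OF rR, of i] b(2)] C by simp
    show "Fin 1 \<le> v i (x \<otimes> u \<ominus> r \<otimes> b)" using c(2) by (simp add: rb)
  qed (use C in auto)
  ultimately have "Fin 1 \<le> v i ((x \<ominus> r \<otimes> y) \<otimes> u)" by simp
  moreover have "v i ((x \<ominus> r \<otimes> y) \<otimes> u) = v i (x \<ominus> r \<otimes> y) + Fin (- a)"
    using v_mult[of "x \<ominus> r \<otimes> y" u i] C u(2) by simp
  ultimately have "Fin (a + 1) \<le> v i (x \<ominus> r \<otimes> y)"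
    using C v_range[of "x \<ominus> r \<otimes> y" i] by auto
  then show ?thesis using rR by blast
qed

text \<open>If \<open>v i x > 0\<close>, then \<open>x^n / t\<close> is in the \<open>i\<close>-th
  ring for \<open>n = v i t\<close>, hence in the \<open>j\<close>-th, so \<open>v j x > 0\<close>.
  An element of value 0 at \<open>i\<close> is congruent at \<open>i\<close>, hence at
  \<open>j\<close>, to a unit of \<open>R\<close>, so it has value 0 at \<open>j\<close> as well;
  this excludes a strict inclusion.\<close>

lemma valuation_rings_incomparable:
  assumes "\<And>x. x \<in> carrier Q \<Longrightarrow> Fin 0 \<le> v i x \<Longrightarrow> Fin 0 \<le> v j x"
  shows "i = j"
proof -
  have tm: "Fin 1 \<le> v k t" for k using v_M L.tM by blast
  have pos: "Fin 1 \<le> v j x" if x: "x \<in> carrier Q" "Fin 1 \<le> v i x" for x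
  proof -
    obtain e where e: "v i t = Fin e" "v i (inv t) = Fin (- e)" using v_unit[OF t_unit] .
    have "0 < e" using tm[of i] e by simp
    define n where "n = nat e"
    have n: "int n = e" using \<open>0 < e\<close> by (simp add: n_def)
    have "Fin (int n) \<le> v i (x [^] n)" using v_pow_ge[OF x(1,2), of n] by simp
    then have "Fin 0 \<le> v i (x [^] n \<otimes> inv t)"
      using v_mult_ge[of "x [^] n" "inv t" "int n" i "- e"] x(1) tc e n by simp
    then have "Fin 0 \<le> v j (x [^] n \<otimes> inv t)" using assms x tc by simp
    then have "Fin (0 + 1) \<le> v j ((x [^] n \<otimes> inv t) \<otimes> t)"
      using x tc tm by (intro v_mult_ge) auto
    moreover have "(x [^] n \<otimes> inv t) \<otimes> t = x [^] n" using x tc t_unit by (simp add: m_assoc)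
    ultimately have xn: "Fin 1 \<le> v j (x [^] n)" by simp
    have "Fin 0 \<le> v j x" using assms[OF x(1)] v_le_trans[OF x(2)] by simp
    show ?thesis
    proof (rule ccontr)
      assume "\<not> ?thesis"
      then have "v j x = Fin 0" using \<open>Fin 0 \<le> v j x\<close> x(1) v_range[of x j] by auto
      then show False using v_pow_eq[OF x(1), of j 0 n] xn by simp
    qed
  qed
  have "Fin 0 \<le> v i x" if x: "x \<in> carrier Q" "Fin 0 \<le> v j x" for x
  proof (rule ccontr)
    assume "\<not> ?thesis"
    then obtain b where b: "v i x = Fin b" "b < 0" using x v_range[of x i] by auto
    obtain y where y: "y \<in> carrier Q" "v i y = Fin (- b)" by (rule v_surj)
    have "Fin 1 \<le> v j y" using pos y b by simp
    then have xyj: "Fin 1 \<le> v j (x \<otimes> y)" using v_mult_ge[OF x(1) y(1) x(2)] by fastforce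
    have xyi: "v i (x \<otimes> y) = Fin 0" using v_mult_eq[OF x(1) y(1) b(1) y(2)] by simp
    then obtain a where a: "a \<in> R" "Fin 1 \<le> v i (x \<otimes> y \<ominus> a)"
      using residue[of "x \<otimes> y" i] x y by auto
    note C = x(1) y(1) R_carr[OF a(1)]
    have eq: "x \<otimes> y \<ominus> (x \<otimes> y \<ominus> a) = a"
      by (insert C, simp add: ring_norm)
    have "v i a = Fin 0" using v_diff_eq[of "x \<otimes> y" "x \<otimes> y \<ominus> a" i 0] xyi a C eq by simp
    then have "a \<notin> M" using v_M[of a i] by auto
    then have "v j a = Fin 0" using v_unit_R a by blast
    moreover have "Fin 1 \<le> v j (x \<otimes> y \<ominus> a)" using pos[OF _ a(2)] C by simp
    then have "Fin 1 \<le> v j (x \<otimes> y \<ominus> (x \<otimes> y \<ominus> a))" using v_diff_ge[OF _ _ xyj] C by simp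
    ultimately show False unfolding eq by simp
  qed
  then have "valuation_ring_of Q (v i) = valuation_ring_of Q (v j)"
    using assms by (auto simp: valuation_ring_mem)
  moreover have "inj (\<lambda>i. valuation_ring_of Q (v i))"
    using val by (simp add: associated_valuations_def bij_betw_def)
  ultimately show ?thesis by (auto dest: injD)
qed

text \<open>This is where the size of the residue field enters: the classes to be avoided come from
  all indices but \<open>j\<close>, one fewer than the number of valuation rings, so at least one
  class is left.\<close>

lemma avoid_residues:
  fixes a :: "'n \<Rightarrow> 'a"
  assumes "\<And>k. a k \<in> R"
  shows "\<exists>b\<in>R. \<forall>k. k \<noteq> j \<longrightarrow> b \<ominus> a k \<notin> M"
proof (rule ccontr)
  assume not: "\<not> ?thesis"
  define cl where "cl a = {m \<oplus> a | m. m \<in> M}" for a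
  have MC: "\<And>m. m \<in> M \<Longrightarrow> m \<in> carrier Q" using M_subset_R R_carr by blast
  have eq: "cl b \<subseteq> cl c" if "b \<in> R" "c \<in> R" "b \<ominus> c \<in> M" for b c
  proof
    fix x assume "x \<in> cl b"
    then obtain m where m: "m \<in> M" "x = m \<oplus> b" by (auto simp: cl_def)
    note C = MC[OF m(1)] R_carr[OF that(1)] R_carr[OF that(2)]
    have "x = (m \<oplus> (b \<ominus> c)) \<oplus> c" unfolding m by (insert C, simp add: ring_norm)
    moreover have "m \<oplus> (b \<ominus> c) \<in> M" using L.ideal_add[OF L.M_ideal m(1) that(3)] by simp
    ultimately show "x \<in> cl c" by (auto simp: cl_def)
  qed
  have "carrier (sub_ring Q R Quot M) \<subseteq> (\<lambda>k. cl (a k)) ` (UNIV - {j})"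
  proof
    fix C assume "C \<in> carrier (sub_ring Q R Quot M)"
    then obtain b where b: "b \<in> R" "C = cl b" unfolding FactRing_def cl_def by (auto simp: S_rcosets)
    then obtain k where k: "k \<noteq> j" "b \<ominus> a k \<in> M" using not by blast
    note C = R_carr[OF b(1)] R_carr[OF assms[of k]]
    define p where "p = a k"
    have "p \<in> carrier Q" "b \<in> carrier Q" using C by (auto simp: p_def)
    then have "p \<ominus> b = \<ominus> (b \<ominus> p)" by (simp add: a_minus_def minus_add a_comm)
    moreover have "\<ominus> (b \<ominus> a k) \<in> M"
      using L.ideal_uminus[OF L.M_ideal k(2)] S_minus[of "b \<ominus> a k"] k(2) M_subset_R by auto
    ultimately have "a k \<ominus> b \<in> M" by (simp add: p_def)
    then have "C = cl (a k)" using eq[OF b(1) assms k(2)] eq[OF assms b(1), of k] b(2) by blast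
    then show "C \<in> (\<lambda>k. cl (a k)) ` (UNIV - {j})" using k by blast
  qed
  moreover obtain f where "inj_on f (valuation_rings_over Q R)"
    "f ` valuation_rings_over Q R \<subseteq> carrier (sub_ring Q R Quot M)"
    using card unfolding lepoll_def by blast
  ultimately have f: "inj_on f (valuation_rings_over Q R)"
    "f ` valuation_rings_over Q R \<subseteq> (\<lambda>k. cl (a k)) ` (UNIV - {j})" by auto
  have "bij_betw (\<lambda>i. valuation_ring_of Q (v i)) UNIV (valuation_rings_over Q R)"
    using val by (simp add: associated_valuations_def)
  then have "CARD('n) = Finite_Set.card (valuation_rings_over Q R)" by (rule bij_betw_same_card)
  also have "\<dots> \<le> Finite_Set.card ((\<lambda>k. cl (a k)) ` (UNIV - {j}))" using f by (intro card_inj_on_le) auto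
  also have "\<dots> \<le> Finite_Set.card (UNIV - {j})" by (rule card_image_le) simp
  also have "\<dots> < CARD('n)" by (rule psubset_card_mono) auto
  finally show False by simp
qed

text \<open>Take \<open>x\<close> in the \<open>i\<close>-th ring with a pole at \<open>j\<close>
  and subtract some \<open>b\<close> in \<open>R\<close> that differs from the residue of
  \<open>x\<close> wherever \<open>x\<close> has one. Then \<open>x - b\<close> has value 0 there
  and keeps its poles, so it is a unit of \<open>Q\<close> without positive values, and its inverse
  is the element sought. As \<open>j\<close> is a pole, only the other places impose a
  condition.\<close>

lemma separate_two:
  assumes "i \<noteq> j"
  shows "\<exists>u\<in>carrier Q. (\<forall>k. Fin 0 \<le> v k u) \<and> v i u = Fin 0 \<and> Fin 1 \<le> v j u"
proof -
  obtain x where x: "x \<in> carrier Q" "Fin 0 \<le> v i x" "\<not> Fin 0 \<le> v j x"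
    using valuation_rings_incomparable assms by blast
  have "\<exists>a\<in>R. Fin 0 \<le> v k x \<longrightarrow> Fin 1 \<le> v k (x \<ominus> a)" for k
    using residue[OF x(1), of k] subringE(2)[OF R_sub] by blast
  then obtain a where a: "\<And>k. a k \<in> R" "\<And>k. Fin 0 \<le> v k x \<Longrightarrow> Fin 1 \<le> v k (x \<ominus> a k)" by metis
  obtain b where b: "b \<in> R" "\<And>k. k \<noteq> j \<Longrightarrow> b \<ominus> a k \<notin> M" using avoid_residues[of a j] a(1) by blast
  define z where "z = x \<ominus> b"
  have zc: "z \<in> carrier Q" using x R_carr b by (simp add: z_def)
  have nonneg: "v k z = Fin 0" if k: "Fin 0 \<le> v k x" for k
  proof -
    define p where "p = a k"
    have pR: "p \<in> R" using a by (simp add: p_def)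
    have bp: "b \<ominus> p \<in> R" using subring_minus[OF R_sub b(1) pR] .
    note C = x(1) R_carr[OF b(1)] R_carr[OF pR]
    have "k \<noteq> j" using k x(3) by blast
    then have "v k (b \<ominus> p) = Fin 0" using v_unit_R[OF bp] b(2) by (simp add: p_def)
    moreover have "Fin 1 \<le> v k (x \<ominus> p)" using a(2)[OF k] by (simp add: p_def)
    ultimately have "v k ((b \<ominus> p) \<ominus> (x \<ominus> p)) = Fin 0"
      using v_diff_eq[of "b \<ominus> p" "x \<ominus> p" k 0] C by simp
    moreover have "z = \<ominus> ((b \<ominus> p) \<ominus> (x \<ominus> p))" unfolding z_def by (insert C, simp add: ring_norm)
    ultimately show ?thesis using C by simp
  qed
  have neg: "v k z = Fin c" if k: "v k x = Fin c" "c < 0" for k c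
    unfolding z_def using v_diff_eq[OF x(1) R_carr[OF b(1)] k(1)] v_le_trans[OF v_R[OF b(1)]] k(2) by simp
  have le0: "\<exists>c\<le>0. v k z = Fin c" for k
  proof (cases "Fin 0 \<le> v k x")
    case False
    then obtain c where "v k x = Fin c" "c < 0" using x(1) v_range[of x k] by auto
    then show ?thesis using neg by (metis less_imp_le)
  qed (use nonneg in auto)
  then have "v k z \<noteq> Pinf" for k by (metis extended.distinct(1))
  then have zu: "z \<in> Units Q" using unit_iff_finite[OF zc] by blast
  have vinv: "v k (inv z) = Fin (- c)" if "v k z = Fin c" for k c
    using v_unit[OF zu, of k] that by (metis extended.inject)
  have "Fin 0 \<le> v k (inv z)" for k using le0[of k] vinv[of k] by fastforce
  moreover have "v i (inv z) = Fin 0" using vinv[OF nonneg[OF x(2)]] by simp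
  moreover obtain c where c: "v j x = Fin c" "c < 0" using x(1,3) v_range[of x j] by auto
  then have "Fin 1 \<le> v j (inv z)" using vinv[OF neg[OF c]] by simp
  ultimately show ?thesis using zu by blast
qed

lemma separate_all:
  "\<exists>u\<in>carrier Q. (\<forall>k. Fin 0 \<le> v k u) \<and> v i u = Fin 0 \<and> (\<forall>j. j \<noteq> i \<longrightarrow> Fin 1 \<le> v j u)"
proof -
  have "\<exists>u\<in>carrier Q. (\<forall>k. Fin 0 \<le> v k u) \<and> v i u = Fin 0 \<and> (\<forall>j\<in>J. Fin 1 \<le> v j u)"
    if "finite J" "i \<notin> J" for J
    using that
  proof (induction J rule: finite_induct)
    case empty
    then show ?case by (intro bexI[of _ \<one>]) auto
  next
    case (insert j J)
    then obtain u where u: "u \<in> carrier Q" "\<And>k. Fin 0 \<le> v k u" "v i u = Fin 0" "\<And>j. j \<in> J \<Longrightarrow> Fin 1 \<le> v j u"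
      by blast
    obtain w where w: "w \<in> carrier Q" "\<And>k. Fin 0 \<le> v k w" "v i w = Fin 0" "Fin 1 \<le> v j w"
      using separate_two[of i j] insert by blast
    have "Fin 0 \<le> v k (u \<otimes> w)" for k using v_mult_ge[OF u(1) w(1) u(2) w(2)] by simp
    moreover have "v i (u \<otimes> w) = Fin 0" using v_mult_eq[OF u(1) w(1) u(3) w(3)] by simp
    moreover have "Fin 1 \<le> v k (u \<otimes> w)" if "k \<in> insert j J" for k
      using that v_mult_ge[OF u(1) w(1) u(2)[of j] w(4)] v_mult_ge[OF u(1) w(1) u(4)[of k] w(2)] by auto
    ultimately show ?case using u w by blast
  qed
  from this[of "UNIV - {i}"] show ?thesis by auto
qed

text \<open>Outside \<open>F\<close> the values are kept strictly above the target, so the term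
  added for the next index decides the value at that index and disturbs no value already
  fixed.\<close>

lemma approximation: "\<exists>y\<in>carrier Q. \<forall>i. v i y = Fin (\<alpha> i)"
proof -
  have "\<exists>y\<in>carrier Q. (\<forall>i\<in>F. v i y = Fin (\<alpha> i)) \<and> (\<forall>i. i \<notin> F \<longrightarrow> Fin (\<alpha> i + 1) \<le> v i y)"
    if "finite F" for F
    using that
  proof (induction F rule: finite_induct)
    case empty
    then show ?case by (intro bexI[of _ \<zero>]) auto
  next
    case (insert j F)
    then obtain y where y: "y \<in> carrier Q" "\<And>i. i \<in> F \<Longrightarrow> v i y = Fin (\<alpha> i)"
      "\<And>i. i \<notin> F \<Longrightarrow> Fin (\<alpha> i + 1) \<le> v i y" by blast
    obtain u where u: "u \<in> carrier Q" "v j u = Fin 0" "\<And>k. k \<noteq> j \<Longrightarrow> Fin 1 \<le> v k u"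
      using separate_all[of j] by blast
    obtain x where x: "x \<in> carrier Q" "v j x = Fin (\<alpha> j)" by (rule v_surj)
    have "\<exists>b. Fin b \<le> v k x" for k using v_lower_bound[OF x(1)] by metis
    then obtain b where b: "\<And>k. Fin (b k) \<le> v k x" by metis
    \<comment> \<open>The sum dominates each single deficit, so \<open>u^n x\<close> exceeds the
      target at every \<open>k\<close> other than \<open>j\<close>.\<close>
    define n where "n = nat (\<Sum>k\<in>UNIV. \<bar>\<alpha> k + 1 - b k\<bar>)"
    have n: "\<alpha> k + 1 \<le> int n + b k" for k
    proof -
      have "\<bar>\<alpha> k + 1 - b k\<bar> \<le> (\<Sum>k\<in>UNIV. \<bar>\<alpha> k + 1 - b k\<bar>)" by (rule member_le_sum) auto
      then show ?thesis unfolding n_def by linarith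
    qed
    define w where "w = u [^] n \<otimes> x"
    have wc: "w \<in> carrier Q" using u x by (simp add: w_def)
    have wj: "v j w = Fin (\<alpha> j)"
      using v_mult_eq[OF _ x(1) v_pow_eq[OF u(1,2), of n] x(2)] u by (simp add: w_def)
    have wk: "Fin (\<alpha> k + 1) \<le> v k w" if "k \<noteq> j" for k
      using v_mult_ge[OF _ x(1) v_pow_ge[OF u(1) u(3)[OF that], of n] b] u n[of k]
      by (auto simp: w_def intro: v_le_trans)
    have "v k (y \<oplus> w) = Fin (\<alpha> k)" if "k \<in> insert j F" for k
    proof (cases "k = j")
      case True
      then show ?thesis using v_add_eq[OF wc y(1) wj y(3)] insert wc y(1) by (simp add: a_comm)
    next
      case False
      then show ?thesis using v_add_eq[OF y(1) wc y(2) wk] that by blast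
    qed
    moreover have "Fin (\<alpha> k + 1) \<le> v k (y \<oplus> w)" if "k \<notin> insert j F" for k
      using v_add_ge[OF y(1) wc y(3) wk] that by blast
    ultimately show ?case using y(1) wc by (intro bexI[of _ "y \<oplus> w"]) auto
  qed
  from this[of UNIV] show ?thesis by simp
qed

section \<open>Fractional ideals and conductors\<close>

definition rsubmodule :: "'a set \<Rightarrow> bool" where
  "rsubmodule Y \<longleftrightarrow> Y \<subseteq> carrier Q \<and> \<zero> \<in> Y \<and> (\<forall>x\<in>Y. \<forall>y\<in>Y. x \<oplus> y \<in> Y) \<and> (\<forall>a\<in>R. \<forall>x\<in>Y. a \<otimes> x \<in> Y)"

lemma rsubmoduleD:
  assumes "rsubmodule Y"
  shows "x \<in> Y \<Longrightarrow> x \<in> carrier Q" "\<zero> \<in> Y" "x \<in> Y \<Longrightarrow> y \<in> Y \<Longrightarrow> x \<oplus> y \<in> Y"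
    "a \<in> R \<Longrightarrow> x \<in> Y \<Longrightarrow> a \<otimes> x \<in> Y"
  using assms by (auto simp: rsubmodule_def)

lemma rsubmodule_uminus: "rsubmodule Y \<Longrightarrow> x \<in> Y \<Longrightarrow> \<ominus> x \<in> Y"
  using rsubmoduleD(4)[of Y "\<ominus> \<one>" x] rsubmoduleD(1)[of Y x] subringE(3,5)[OF R_sub]
  by (simp add: l_minus)

lemma rsubmodule_diff: "rsubmodule Y \<Longrightarrow> x \<in> Y \<Longrightarrow> y \<in> Y \<Longrightarrow> x \<ominus> y \<in> Y"
  by (simp add: a_minus_def rsubmoduleD(3) rsubmodule_uminus)

lemma submodule_iff: "submodule Y (sub_ring Q R) (ring_module Q) \<longleftrightarrow> rsubmodule Y"
proof
  assume "submodule Y (sub_ring Q R) (ring_module Q)"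
  then interpret submodule Y "sub_ring Q R" "ring_module Q" .
  show "rsubmodule Y"
    using subset one_closed m_closed smult_closed
    by (auto simp: rsubmodule_def ring_module_def)
next
  assume Y: "rsubmodule Y"
  have inv: "inv\<^bsub>add_monoid (ring_module Q)\<^esub> x = \<ominus> x" for x
    by (simp add: a_inv_def m_inv_def ring_module_def)
  show "submodule Y (sub_ring Q R) (ring_module Q)"
    by (intro submodule.intro subgroup.intro submodule_axioms.intro)
      (auto simp: inv[unfolded ring_module_def, simplified] ring_module_def intro: rsubmodule_uminus[OF Y] rsubmoduleD[OF Y])
qed

section \<open>Truncations of the whole ring \<open>Q\<close>\<close>

abbreviation QQ :: "int ^ 'n \<Rightarrow> 'a set" where "QQ \<alpha> \<equiv> truncation v (carrier Q) \<alpha>"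

lemma truncation_mem: "x \<in> truncation v Y \<alpha> \<longleftrightarrow> x \<in> Y \<and> (\<forall>i. Fin (\<alpha> $ i) \<le> v i x)"
  by (simp add: truncation_def)

lemma rsubmodule_truncation:
  assumes Y: "rsubmodule Y" shows "rsubmodule (truncation v Y \<alpha>)"
  unfolding rsubmodule_def
proof (intro conjI ballI)
  show "truncation v Y \<alpha> \<subseteq> carrier Q" using rsubmoduleD(1)[OF Y] by (auto simp: truncation_mem)
  show "\<zero> \<in> truncation v Y \<alpha>" using rsubmoduleD(2)[OF Y] by (simp add: truncation_mem)
next
  fix x y assume "x \<in> truncation v Y \<alpha>" "y \<in> truncation v Y \<alpha>"
  then show "x \<oplus> y \<in> truncation v Y \<alpha>"
    using rsubmoduleD(1,3)[OF Y] by (auto simp: truncation_mem intro: v_add_ge)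
next
  fix a x assume a: "a \<in> R" and x: "x \<in> truncation v Y \<alpha>"
  have "Fin (\<alpha> $ i) \<le> v i (a \<otimes> x)" for i
    using v_mult_ge[OF R_carr[OF a] _ v_R[OF a, of i], of x "\<alpha> $ i"] x rsubmoduleD(1)[OF Y]
    by (auto simp: truncation_mem)
  then show "a \<otimes> x \<in> truncation v Y \<alpha>"
    using x a rsubmoduleD(4)[OF Y] by (auto simp: truncation_mem)
qed

lemma rsubmodule_carrier: "rsubmodule (carrier Q)"
  using R_carr by (auto simp: rsubmodule_def)

lemma rsubmodule_QQ: "rsubmodule (QQ \<alpha>)"
  by (rule rsubmodule_truncation[OF rsubmodule_carrier])

lemma QQ_mult: "x \<in> QQ \<alpha> \<Longrightarrow> y \<in> QQ \<beta> \<Longrightarrow> x \<otimes> y \<in> QQ (\<alpha> + \<beta>)"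
  by (auto simp: truncation_mem intro: v_mult_ge)

lemma QQ_antimono: "\<alpha> \<le> \<beta> \<Longrightarrow> QQ \<beta> \<subseteq> QQ \<alpha>"
  unfolding truncation_mem less_eq_vec_def subset_iff using v_le_trans by blast

lemma unit_value:
  assumes "x \<in> Units Q"
  obtains \<alpha> :: "int ^ 'n" where "\<And>i. v i x = Fin (\<alpha> $ i)" "\<And>i. v i (inv x) = Fin ((- \<alpha>) $ i)"
proof -
  have "\<forall>i. \<exists>a. v i x = Fin a \<and> v i (inv x) = Fin (- a)" using v_unit[OF assms] by metis
  then obtain a where a: "\<And>i. v i x = Fin (a i)" "\<And>i. v i (inv x) = Fin (- a i)" by metis
  show ?thesis by (rule that[of "\<chi> i. a i"]) (simp_all add: a)
qed

lemma unit_of_value: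
  obtains x where "x \<in> Units Q" "\<And>i. v i x = Fin ((\<alpha> :: int ^ 'n) $ i)"
proof -
  obtain x where x: "x \<in> carrier Q" "\<And>i. v i x = Fin (\<alpha> $ i)" using approximation[of "\<lambda>i. \<alpha> $ i"] by blast
  then have "x \<in> Units Q" using unit_iff_finite[OF x(1)] by simp
  then show ?thesis using that x by blast
qed

lemma QQ_subset_R: "\<exists>\<gamma>. QQ \<gamma> \<subseteq> R"
proof -
  obtain k :: nat where k: "\<And>y. y \<in> carrier Q \<Longrightarrow> (\<And>V. V \<in> valuation_rings_over Q R \<Longrightarrow> y \<in> V) \<Longrightarrow> t [^] k \<otimes> y \<in> R"
    using valuation_rings_conductor[OF red] by blast
  have tk: "t [^] k \<in> Units Q" using t_unit by (rule Units_pow_closed)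
  obtain \<gamma> where \<gamma>: "\<And>i. v i (inv (t [^] k)) = Fin ((- \<gamma>) $ i)" using unit_value[OF tk] by metis
  have "x \<in> R" if x: "x \<in> QQ \<gamma>" for x
  proof -
    have xc: "x \<in> carrier Q" using x by (simp add: truncation_mem)
    have ge: "Fin 0 \<le> v i (inv (t [^] k) \<otimes> x)" for i
      using v_mult_ge[of "inv (t [^] k)" x "- \<gamma> $ i" i "\<gamma> $ i"] x \<gamma>[of i] tk by (auto simp: truncation_mem)
    have "t [^] k \<otimes> (inv (t [^] k) \<otimes> x) \<in> R"
    proof (rule k)
      show "inv (t [^] k) \<otimes> x \<in> carrier Q" using xc tk by simp
      fix V assume "V \<in> valuation_rings_over Q R"
      then obtain i where "V = valuation_ring_of Q (v i)" by (rule valuation_rings_over_cases)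
      then show "inv (t [^] k) \<otimes> x \<in> V" using ge[of i] xc tk by (simp add: valuation_ring_mem)
    qed
    then show ?thesis using xc tk tc by (simp flip: m_assoc)
  qed
  then show ?thesis by blast
qed

lemma regular_elements_S: "regular_elements (sub_ring Q R) = R \<inter> Units Q"
proof
  show "regular_elements (sub_ring Q R) \<subseteq> R \<inter> Units Q"
    using regular_in_R_unit by (auto simp: regular_elements_def)
  show "R \<inter> Units Q \<subseteq> regular_elements (sub_ring Q R)"
    using regular_elements_Q R_carr by (auto simp: regular_elements_def)
qed

text \<open>From here on a regular fractional ideal is a submodule squeezed between two of the
  modules \<open>QQ\<close>. The outer one comes from a common denominator, the inner one from a
  regular element \<open>j\<close> of \<open>Y\<close>, because \<open>j\<close> multiplies some
  \<open>QQ \<gamma> \<subseteq> R\<close> into \<open>Y\<close>.\<close>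

lemma regular_fractional_ideal_iff:
  "regular_fractional_ideal Q R Y \<longleftrightarrow> rsubmodule Y \<and> (\<exists>\<delta>. Y \<subseteq> QQ \<delta>) \<and> (\<exists>\<gamma>. QQ \<gamma> \<subseteq> Y)"
proof
  assume "regular_fractional_ideal Q R Y"
  then obtain d j where Y: "rsubmodule Y" and d: "d \<in> Units Q" "\<And>x. x \<in> Y \<Longrightarrow> d \<otimes> x \<in> R"
    and j: "j \<in> Y" "j \<in> Units Q"
    unfolding regular_fractional_ideal_def fractional_ideal_def submodule_iff regular_elements_S regular_elements_Q
    by blast
  obtain \<delta> where \<delta>: "\<And>i. v i (inv d) = Fin ((- \<delta>) $ i)" using unit_value[OF d(1)] by metis
  have "x \<in> QQ (- \<delta>)" if x: "x \<in> Y" for x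
  proof -
    have xc: "x \<in> carrier Q" using rsubmoduleD(1)[OF Y x] .
    have eq: "inv d \<otimes> (d \<otimes> x) = x" 
      using xc d(1) by (metis Units_closed Units_inv_closed Units_l_inv l_one m_assoc)
    have "Fin ((- \<delta>) $ i) \<le> v i x" for i
      using v_mult_ge[of "inv d" "d \<otimes> x" "(- \<delta>) $ i" i 0] \<delta>[of i] v_R[OF d(2)[OF x]] xc d(1) Units_closed[OF d(1)] eq by simp
    then show ?thesis using xc by (simp add: truncation_mem)
  qed
  moreover obtain \<gamma> where \<gamma>: "QQ \<gamma> \<subseteq> R" using QQ_subset_R by blast
  obtain \<epsilon> where \<epsilon>: "\<And>i. v i (inv j) = Fin ((- \<epsilon>) $ i)" using unit_value[OF j(2)] by metis
  have "x \<in> Y" if x: "x \<in> QQ (\<gamma> + \<epsilon>)" for x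
  proof -
    have "inv j \<in> QQ (- \<epsilon>)" using \<epsilon> j by (simp add: truncation_mem)
    then have "inv j \<otimes> x \<in> R" using QQ_mult[of "inv j" "- \<epsilon>" x "\<gamma> + \<epsilon>"] x \<gamma> by auto
    moreover have "(inv j \<otimes> x) \<otimes> j = x" 
      using x j(2) Units_closed[OF j(2)] by (simp add: truncation_mem m_comm[of "inv j"] m_assoc)
    ultimately show ?thesis using rsubmoduleD(4)[OF Y _ j(1)] by metis
  qed
  ultimately show "rsubmodule Y \<and> (\<exists>\<delta>. Y \<subseteq> QQ \<delta>) \<and> (\<exists>\<gamma>. QQ \<gamma> \<subseteq> Y)" using Y by blast
next
  assume "rsubmodule Y \<and> (\<exists>\<delta>. Y \<subseteq> QQ \<delta>) \<and> (\<exists>\<gamma>. QQ \<gamma> \<subseteq> Y)"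
  then obtain \<delta> \<gamma> where Y: "rsubmodule Y" and \<delta>: "Y \<subseteq> QQ \<delta>" and \<gamma>: "QQ \<gamma> \<subseteq> Y" by blast
  obtain j where "j \<in> Units Q" "\<And>i. v i j = Fin (\<gamma> $ i)" using unit_of_value[of "\<gamma>"] by blast
  then have "j \<in> QQ \<gamma>" "j \<in> Units Q" by (simp_all add: truncation_mem Units_closed)
  then have "j \<in> Y \<inter> Units Q" using \<gamma> by blast
  moreover obtain \<epsilon> where \<epsilon>: "QQ \<epsilon> \<subseteq> R" using QQ_subset_R by blast
  \<comment> \<open>The denominator \<open>d\<close> must itself lie in
    \<open>QQ \<epsilon> \<subseteq> R\<close> and must also move \<open>QQ \<delta>\<close> into
    \<open>QQ \<epsilon>\<close>; the maximum serves both.\<close>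
  define \<phi> :: "int ^ 'n" where "\<phi> = (\<chi> i. max (\<epsilon> $ i) (\<epsilon> $ i - \<delta> $ i))"
  obtain d where d: "d \<in> Units Q" "\<And>i. v i d = Fin (\<phi> $ i)" using unit_of_value[of "\<phi>"] by blast
  have "d \<in> QQ \<epsilon>" using d by (simp add: truncation_mem Units_closed \<phi>_def)
  then have "d \<in> R" using \<epsilon> by blast
  have "d \<otimes> x \<in> R" if "x \<in> Y" for x
  proof -
    have "d \<in> QQ (\<epsilon> - \<delta>)" using d by (simp add: truncation_mem Units_closed \<phi>_def)
    then show ?thesis using QQ_mult[of d "\<epsilon> - \<delta>" x \<delta>] \<delta> \<epsilon> that by auto
  qed
  ultimately show "regular_fractional_ideal Q R Y"
    unfolding regular_fractional_ideal_def fractional_ideal_def submodule_iff regular_elements_S regular_elements_Q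
    using Y \<open>d \<in> R\<close> d(1) by blast
qed

lemma axis_nth: "(axis i 1 :: int ^ 'n) $ k = (if k = i then 1 else 0)"
  by (simp add: axis_def)

text \<open>
  Elements of \<open>Y\<close> are moved into \<open>J\<close> by raising one value at a time, subtracting
  multiples of elements of \<open>J\<close> with the same value.
\<close>

lemma truncation_subset_raise:
  fixes \<alpha> \<delta> :: "int ^ 'n"
  assumes J: "rsubmodule J" and Y: "rsubmodule Y" and JY: "J \<subseteq> Y" and le: "\<alpha> \<le> \<delta>"
    and top: "truncation v Y \<delta> \<subseteq> J"
    and step: "\<And>a i x. \<alpha> \<le> a \<Longrightarrow> a \<le> \<delta> \<Longrightarrow> a $ i < \<delta> $ i \<Longrightarrow> x \<in> truncation v Y a \<Longrightarrow> v i x = Fin (a $ i) \<Longrightarrow>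
        \<exists>y\<in>truncation v J a. v i y = Fin (a $ i)"
  shows "truncation v Y \<alpha> \<subseteq> J"
proof -
  have "truncation v Y a \<subseteq> J" if "\<alpha> \<le> a" "a \<le> \<delta>" "nat (\<Sum>i\<in>UNIV. \<delta> $ i - a $ i) = n" for n a
    using that
  proof (induction n arbitrary: a rule: less_induct)
    case (less n a)
    show ?case
    proof (cases "a = \<delta>")
      case True
      then show ?thesis using top by simp
    next
      case False
      then obtain i where i: "a $ i < \<delta> $ i"
        using less.prems(2) by (metis less_eq_vec_def order_le_less vec_eq_iff)
      define a' where "a' = a + axis i 1"
      have a': "a' $ k = a $ k + (if k = i then 1 else 0)" for k by (simp add: a'_def axis_nth)
      have aa': "\<alpha> \<le> a'" "a' \<le> \<delta>"
        using less.prems(1,2) i by (auto simp: less_eq_vec_def a' intro: order_trans)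
      have "(\<Sum>k\<in>UNIV. \<delta> $ k - a' $ k) < (\<Sum>k\<in>UNIV. \<delta> $ k - a $ k)"
        by (rule sum_strict_mono_ex1) (auto simp: a')
      moreover have "0 \<le> (\<Sum>k\<in>UNIV. \<delta> $ k - a' $ k)"
        using aa'(2) by (intro sum_nonneg) (auto simp: less_eq_vec_def)
      ultimately have IH: "truncation v Y a' \<subseteq> J"
        using less.IH[OF _ aa' refl] less.prems(3) by linarith
      show ?thesis
      proof
        fix x assume x: "x \<in> truncation v Y a"
        then have xY: "x \<in> Y" and xv: "\<And>k. Fin (a $ k) \<le> v k x" by (auto simp: truncation_mem)
        have xc: "x \<in> carrier Q" using rsubmoduleD(1)[OF Y xY] .
        show "x \<in> J"
        proof (cases "Fin (a $ i + 1) \<le> v i x")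
          case True
          then have "x \<in> truncation v Y a'" using x by (auto simp: truncation_mem a')
          then show ?thesis using IH by blast
        next
          case False
          then have vi: "v i x = Fin (a $ i)" using xv[of i] v_range[OF xc, of i] by auto
          from step[OF less.prems(1,2) i x this] obtain y where y: "y \<in> truncation v J a" "v i y = Fin (a $ i)" by blast
          have yJ: "y \<in> J" using y by (simp add: truncation_mem)
          have yc: "y \<in> carrier Q" using rsubmoduleD(1)[OF J yJ] .
          obtain r where r: "r \<in> R" "Fin (a $ i + 1) \<le> v i (x \<ominus> r \<otimes> y)"
            using residue_match[OF xc xv yc y(2)] by blast
          have ry: "r \<otimes> y \<in> truncation v J a"
            using rsubmoduleD(4)[OF rsubmodule_truncation[OF J] r(1) y(1)] .
          then have ryJ: "r \<otimes> y \<in> J" by (simp add: truncation_mem)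
          then have "r \<otimes> y \<in> truncation v Y a" using ry JY by (auto simp: truncation_mem)
          then have "x \<ominus> r \<otimes> y \<in> truncation v Y a"
            using rsubmodule_diff[OF rsubmodule_truncation[OF Y] x] by blast
          then have "x \<ominus> r \<otimes> y \<in> truncation v Y a'" using r(2) by (auto simp: truncation_mem a')
          then have "x \<ominus> r \<otimes> y \<in> J" using IH by blast
          then have "(x \<ominus> r \<otimes> y) \<oplus> r \<otimes> y \<in> J" using rsubmoduleD(3)[OF J _ ryJ] by blast
          moreover have "(x \<ominus> r \<otimes> y) \<oplus> r \<otimes> y = x"
            by (insert xc yc R_carr[OF r(1)], simp add: ring_norm)
          ultimately show ?thesis by simp
        qed
      qed
    qed
  qed
  from this[OF order_refl le refl] show ?thesis .
qed

text \<open>Raising the value at \<open>i\<close> needs an element of \<open>J\<close> with exact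
  value \<open>c $ i\<close> there, while its other values may be as large as the maximum. With
  \<open>\<epsilon>\<close> so chosen, \<open>\<gamma> \<le> \<epsilon>\<close> or
  \<open>\<gamma>' \<le> \<epsilon>\<close>, according to which of the two is at most
  \<open>c\<close> at the single place \<open>i\<close>.\<close>

lemma QQ_min_subset:
  assumes J: "rsubmodule J" and a: "QQ \<gamma> \<subseteq> J" and b: "QQ \<gamma>' \<subseteq> J"
  shows "QQ (\<chi> i. min (\<gamma> $ i) (\<gamma>' $ i)) \<subseteq> J"
proof -
  let ?\<delta> = "(\<chi> i. max (\<gamma> $ i) (\<gamma>' $ i)) :: int ^ 'n"
  show ?thesis
  proof (rule truncation_subset_raise[OF J rsubmodule_carrier])
    show "J \<subseteq> carrier Q" using rsubmoduleD(1)[OF J] by blast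
    show "(\<chi> i. min (\<gamma> $ i) (\<gamma>' $ i)) \<le> ?\<delta>"
      by (simp add: less_eq_vec_def min_le_iff_disj)
    have "\<gamma> \<le> ?\<delta>" by (simp add: less_eq_vec_def)
    then show "QQ ?\<delta> \<subseteq> J" using QQ_antimono a by blast
  next
    fix c i x
    assume c: "(\<chi> i. min (\<gamma> $ i) (\<gamma>' $ i)) \<le> c" "c \<le> ?\<delta>" and i: "c $ i < ?\<delta> $ i"
      and x: "x \<in> QQ c" "v i x = Fin (c $ i)"
    define \<epsilon> :: "int ^ 'n" where "\<epsilon> = (\<chi> k. if k = i then c $ i else ?\<delta> $ k)"
    obtain y where y: "y \<in> Units Q" "\<And>k. v k y = Fin (\<epsilon> $ k)" using unit_of_value[of "\<epsilon>"] by blast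
    have "c $ k \<le> \<epsilon> $ k" for k using c(2) by (simp add: \<epsilon>_def less_eq_vec_def)
    moreover have "\<gamma> $ i \<le> c $ i \<or> \<gamma>' $ i \<le> c $ i"
      using c(1) by (auto simp: less_eq_vec_def min_le_iff_disj)
    then have "\<gamma> \<le> \<epsilon> \<or> \<gamma>' \<le> \<epsilon>" by (auto simp: less_eq_vec_def \<epsilon>_def)
    then have "y \<in> QQ \<gamma> \<or> y \<in> QQ \<gamma>'"
      using Units_closed[OF y(1)] by (simp add: truncation_mem less_eq_vec_def y(2))
    then have "y \<in> J" using a b by blast
    ultimately show "\<exists>y\<in>truncation v J c. v i y = Fin (c $ i)"
      using y by (intro bexI[of _ y]) (auto simp: truncation_mem \<epsilon>_def)
  qed
qed

text \<open>An element of \<open>J\<close> with exact value vector \<open>c \<ge> \<gamma>\<close>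
  supplies the correction needed at \<open>c\<close> in \<open>truncation_subset_raise\<close>, for
  all \<open>i\<close> at once. Through this equivalence the conductor becomes a statement about
  submodules.\<close>

lemma conductor_condition_iff:
  assumes J: "regular_fractional_ideal Q R J"
  shows "\<gamma> \<in> value_set Q v J \<and> (\<forall>\<delta>\<ge>0. \<gamma> + \<delta> \<in> value_set Q v J) \<longleftrightarrow> QQ \<gamma> \<subseteq> J"
proof
  assume sub: "QQ \<gamma> \<subseteq> J"
  have "\<gamma> + \<delta> \<in> value_set Q v J" if "0 \<le> \<delta>" for \<delta>
  proof -
    obtain y where y: "y \<in> Units Q" "\<And>k. v k y = Fin ((\<gamma> + \<delta>) $ k)" using unit_of_value[of "(\<gamma> + \<delta>)"] by blast
    then have "y \<in> QQ \<gamma>" using that by (simp add: truncation_mem less_eq_vec_def Units_closed)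
    then have "y \<in> J" using sub by blast
    then show ?thesis unfolding value_set_def regular_elements_Q using y by blast
  qed
  from this this[of 0] show "\<gamma> \<in> value_set Q v J \<and> (\<forall>\<delta>\<ge>0. \<gamma> + \<delta> \<in> value_set Q v J)" by simp
next
  assume *: "\<gamma> \<in> value_set Q v J \<and> (\<forall>\<delta>\<ge>0. \<gamma> + \<delta> \<in> value_set Q v J)"
  have J': "rsubmodule J" using J by (simp add: regular_fractional_ideal_iff)
  obtain \<epsilon> where \<epsilon>: "QQ \<epsilon> \<subseteq> J" using J regular_fractional_ideal_iff by blast
  let ?\<delta> = "(\<chi> i. max (\<gamma> $ i) (\<epsilon> $ i)) :: int ^ 'n"
  show "QQ \<gamma> \<subseteq> J"
  proof (rule truncation_subset_raise[OF J' rsubmodule_carrier])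
    show "J \<subseteq> carrier Q" using rsubmoduleD(1)[OF J'] by blast
    show "\<gamma> \<le> ?\<delta>" by (simp add: less_eq_vec_def)
    have "\<epsilon> \<le> ?\<delta>" by (simp add: less_eq_vec_def)
    then show "QQ ?\<delta> \<subseteq> J" using QQ_antimono \<epsilon> by blast
  next
    fix c i x assume "\<gamma> \<le> c"
    then have "0 \<le> c - \<gamma>" by (simp add: less_eq_vec_def)
    then have "c \<in> value_set Q v J" using * by (metis add.commute diff_add_cancel)
    then show "\<exists>y\<in>truncation v J c. v i y = Fin (c $ i)" by (auto simp: value_set_def truncation_mem)
  qed
qed

text \<open>Closure under minima turns a \<open>\<gamma>\<close> with smallest coordinate sum into a
  least one. The sum is measured from a lower bound \<open>\<delta>\<close> for the values on
  \<open>J\<close>, so it is nonnegative and \<open>nat\<close> loses nothing.\<close>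

lemma conductor_least:
  assumes J: "regular_fractional_ideal Q R J"
  shows "QQ (conductor Q v J) \<subseteq> J" "QQ \<gamma> \<subseteq> J \<Longrightarrow> conductor Q v J \<le> \<gamma>"
proof -
  have J': "rsubmodule J" using J by (simp add: regular_fractional_ideal_iff)
  obtain \<epsilon> \<delta> where \<epsilon>: "QQ \<epsilon> \<subseteq> J" and \<delta>: "J \<subseteq> QQ \<delta>" using J regular_fractional_ideal_iff by blast
  have low: "\<delta> $ i \<le> \<gamma> $ i" if "QQ \<gamma> \<subseteq> J" for \<gamma> i
  proof -
    obtain y where y: "y \<in> Units Q" "\<And>k. v k y = Fin (\<gamma> $ k)" using unit_of_value[of "\<gamma>"] by blast
    then have "y \<in> QQ \<gamma>" by (simp add: truncation_mem Units_closed)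
    then have "y \<in> QQ \<delta>" using that \<delta> by blast
    then show ?thesis using y(2)[of i] by (auto simp: truncation_mem dest: spec[of _ i])
  qed
  obtain c where c: "QQ c \<subseteq> J" and min: "\<And>\<gamma>. QQ \<gamma> \<subseteq> J \<Longrightarrow>
      nat (\<Sum>i\<in>UNIV. c $ i - \<delta> $ i) \<le> nat (\<Sum>i\<in>UNIV. \<gamma> $ i - \<delta> $ i)"
    using ex_has_least_nat[of "\<lambda>\<gamma>. QQ \<gamma> \<subseteq> J" \<epsilon> "\<lambda>\<gamma>. nat (\<Sum>i\<in>UNIV. \<gamma> $ i - \<delta> $ i)"] \<epsilon> by blast
  have least: "c \<le> \<gamma>" if \<gamma>: "QQ \<gamma> \<subseteq> J" for \<gamma>
  proof (rule ccontr)
    assume "\<not> c \<le> \<gamma>"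
    then obtain i where i: "\<gamma> $ i < c $ i" by (auto simp: less_eq_vec_def not_le)
    let ?m = "(\<chi> i. min (c $ i) (\<gamma> $ i)) :: int ^ 'n"
    have m: "QQ ?m \<subseteq> J" by (rule QQ_min_subset[OF J' c \<gamma>])
    have "(\<Sum>k\<in>UNIV. ?m $ k - \<delta> $ k) < (\<Sum>k\<in>UNIV. c $ k - \<delta> $ k)"
      by (rule sum_strict_mono_ex1) (use i in \<open>auto intro!: exI[of _ i]\<close>)
    moreover have "0 \<le> (\<Sum>k\<in>UNIV. ?m $ k - \<delta> $ k)" using low[OF m] by (intro sum_nonneg) auto
    ultimately show False using min[OF m] by linarith
  qed
  have "conductor Q v J = c"
    unfolding conductor_def conductor_condition_iff[OF J] using c least by (rule Least_equality)
  then show "QQ (conductor Q v J) \<subseteq> J" "QQ \<gamma> \<subseteq> J \<Longrightarrow> conductor Q v J \<le> \<gamma>" using c least by auto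
qed

section \<open>Lengths\<close>

text \<open>By \<open>simple\<close>, every nonzero class generates the quotient, so its submodules
  are zero and everything, and a strict chain has at most one step.\<close>

lemma module_length_quot:
  assumes A: "rsubmodule A" and N: "rsubmodule N" and NA: "N \<subseteq> A"
    and simple: "\<And>x y. x \<in> A \<Longrightarrow> x \<notin> N \<Longrightarrow> y \<in> A \<Longrightarrow> \<exists>r\<in>R. y \<ominus> r \<otimes> x \<in> N"
  shows "module_length (sub_ring Q R) (quot_module ((ring_module Q)\<lparr>carrier := A\<rparr>) N) = (if A = N then 0 else 1)"
proof -
  define cl where "cl x = {n \<oplus> x | n. n \<in> N}" for x
  define U where "U = quot_module ((ring_module Q)\<lparr>carrier := A\<rparr>) N"
  note Ac = rsubmoduleD(1)[OF A] and Nc = rsubmoduleD(1)[OF N]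
  have cl_r: "N +>\<^bsub>(ring_module Q)\<lparr>carrier := A\<rparr>\<^esub> x = cl x" for x
    by (auto simp: a_r_coset_def' ring_module_def cl_def)
  have self: "x \<in> cl x" if "x \<in> A" for x
    using rsubmoduleD(2)[OF N] Ac[OF that] by (auto simp: cl_def intro!: exI[of _ \<zero>])
  have cl_eqI: "cl x = cl y" if x: "x \<in> A" and y: "y \<in> A" and xy: "x \<ominus> y \<in> N" for x y
  proof -
    have sub: "cl x \<subseteq> cl y" if "x \<in> A" "y \<in> A" "x \<ominus> y \<in> N" for x y
    proof
      fix z assume "z \<in> cl x"
      then obtain n where n: "n \<in> N" "z = n \<oplus> x" by (auto simp: cl_def)
      note C = Nc[OF n(1)] Ac[OF that(1)] Ac[OF that(2)]
      have "z = (n \<oplus> (x \<ominus> y)) \<oplus> y" unfolding n by (insert C, simp add: ring_norm)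
      then show "z \<in> cl y" using rsubmoduleD(3)[OF N n(1) that(3)] by (auto simp: cl_def)
    qed
    note C = Ac[OF x] Ac[OF y]
    have "y \<ominus> x = \<ominus> (x \<ominus> y)" by (insert C, simp add: ring_norm)
    then have "y \<ominus> x \<in> N" using rsubmodule_uminus[OF N xy] by simp
    then show ?thesis using sub x y xy by blast
  qed
  have cl_eqD: "x \<ominus> y \<in> N" if x: "x \<in> A" and y: "y \<in> A" and eq: "cl x = cl y" for x y
  proof -
    obtain n where n: "n \<in> N" "x = n \<oplus> y" using self[OF x] unfolding eq by (auto simp: cl_def)
    note C = Nc[OF n(1)] Ac[OF y]
    have "x \<ominus> y = n" unfolding n by (insert C, simp add: ring_norm)
    then show ?thesis using n by simp
  qed
  have cl_zero: "cl \<zero> = N" using Nc by (force simp: cl_def)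
  have zA: "\<zero> \<in> A" using rsubmoduleD(2)[OF A] .
  have cl_N: "cl x = N \<longleftrightarrow> x \<in> N" if "x \<in> A" for x
    using cl_eqI[OF that zA] cl_eqD[OF that zA] cl_zero Ac[OF that] by (auto simp: a_minus_def)
  have cU: "carrier U = cl ` A"
    unfolding U_def quot_module_def by (auto simp: A_RCOSETS_def' a_r_coset_def' ring_module_def cl_def)
  have zU: "\<zero>\<^bsub>U\<^esub> = N" by (simp add: U_def quot_module_def)
  have aU: "cl x \<oplus>\<^bsub>U\<^esub> cl y = cl (x \<oplus> y)" if x: "x \<in> A" and y: "y \<in> A" for x y
  proof -
    have "cl x \<oplus>\<^bsub>U\<^esub> cl y = (\<Union>a\<in>cl x. \<Union>b\<in>cl y. {a \<oplus> b})"
      by (simp add: U_def quot_module_def set_add_def' ring_module_def)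
    also have "\<dots> = cl (x \<oplus> y)"
    proof
      show "(\<Union>a\<in>cl x. \<Union>b\<in>cl y. {a \<oplus> b}) \<subseteq> cl (x \<oplus> y)"
      proof
        fix z assume "z \<in> (\<Union>a\<in>cl x. \<Union>b\<in>cl y. {a \<oplus> b})"
        then obtain n m where n: "n \<in> N" "m \<in> N" "z = (n \<oplus> x) \<oplus> (m \<oplus> y)" by (auto simp: cl_def)
        note C = Nc[OF n(1)] Nc[OF n(2)] Ac[OF x] Ac[OF y]
        have "z = (n \<oplus> m) \<oplus> (x \<oplus> y)" unfolding n by (insert C, simp add: ring_norm)
        then show "z \<in> cl (x \<oplus> y)" using rsubmoduleD(3)[OF N n(1,2)] by (auto simp: cl_def)
      qed
      show "cl (x \<oplus> y) \<subseteq> (\<Union>a\<in>cl x. \<Union>b\<in>cl y. {a \<oplus> b})"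
      proof
        fix z assume "z \<in> cl (x \<oplus> y)"
        then obtain n where n: "n \<in> N" "z = n \<oplus> (x \<oplus> y)" by (auto simp: cl_def)
        have "z = (n \<oplus> x) \<oplus> y" using n Nc Ac x y by (simp add: a_assoc)
        moreover have "n \<oplus> x \<in> cl x" using n by (auto simp: cl_def)
        ultimately show "z \<in> (\<Union>a\<in>cl x. \<Union>b\<in>cl y. {a \<oplus> b})" using self[OF y] by blast
      qed
    qed
    finally show ?thesis .
  qed
  have sU: "a \<odot>\<^bsub>U\<^esub> cl x = cl (a \<otimes> x)" if a: "a \<in> R" and x: "x \<in> A" for a x
  proof -
    have "a \<odot>\<^bsub>U\<^esub> cl x = (\<Union>z\<in>cl x. cl (a \<otimes> z))"
      unfolding U_def quot_module_def by (simp add: cl_r) (simp add: ring_module_def)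
    also have "\<dots> = cl (a \<otimes> x)"
    proof -
      have "cl (a \<otimes> z) = cl (a \<otimes> x)" if z: "z \<in> cl x" for z
      proof -
        obtain n where n: "n \<in> N" "z = n \<oplus> x" using z by (auto simp: cl_def)
        have zA: "z \<in> A" using n NA rsubmoduleD(3)[OF A _ x] by blast
        note C = Nc[OF n(1)] Ac[OF x] R_carr[OF a]
        have "a \<otimes> z \<ominus> a \<otimes> x = a \<otimes> n" unfolding n by (insert C, simp add: ring_norm)
        then have "a \<otimes> z \<ominus> a \<otimes> x \<in> N" using rsubmoduleD(4)[OF N a n(1)] by simp
        then show ?thesis using cl_eqI rsubmoduleD(4)[OF A a zA] rsubmoduleD(4)[OF A a x] by blast
      qed
      then show ?thesis using self[OF x] by blast
    qed
    finally show ?thesis .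
  qed
  have grp: "group (add_monoid U)"
  proof (rule groupI)
    show "\<one>\<^bsub>add_monoid U\<^esub> \<in> carrier (add_monoid U)" using zU cU cl_zero zA by (simp add: image_iff) blast
  next
    fix x y assume "x \<in> carrier (add_monoid U)" "y \<in> carrier (add_monoid U)"
    then show "x \<otimes>\<^bsub>add_monoid U\<^esub> y \<in> carrier (add_monoid U)"
      using aU rsubmoduleD(3)[OF A] by (auto simp: cU)
  next
    fix x y z assume "x \<in> carrier (add_monoid U)" "y \<in> carrier (add_monoid U)" "z \<in> carrier (add_monoid U)"
    then show "x \<otimes>\<^bsub>add_monoid U\<^esub> y \<otimes>\<^bsub>add_monoid U\<^esub> z = x \<otimes>\<^bsub>add_monoid U\<^esub> (y \<otimes>\<^bsub>add_monoid U\<^esub> z)"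
      using aU rsubmoduleD(3)[OF A] Ac by (auto simp: cU a_assoc)
  next
    fix x assume "x \<in> carrier (add_monoid U)"
    then obtain a where a: "a \<in> A" "x = cl a" by (auto simp: cU)
    have "cl \<zero> \<oplus>\<^bsub>U\<^esub> cl a = cl a" using aU[OF zA a(1)] Ac[OF a(1)] by simp
    then show "\<one>\<^bsub>add_monoid U\<^esub> \<otimes>\<^bsub>add_monoid U\<^esub> x = x" using a zU cl_zero by simp
    have "cl (\<ominus> a) \<oplus>\<^bsub>U\<^esub> cl a = N" using aU[OF rsubmodule_uminus[OF A a(1)] a(1)] Ac[OF a(1)] cl_zero by (simp add: l_neg)
    then show "\<exists>y\<in>carrier (add_monoid U). y \<otimes>\<^bsub>add_monoid U\<^esub> x = \<one>\<^bsub>add_monoid U\<^esub>"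
      using rsubmodule_uminus[OF A a(1)] a(2) zU cU by auto
  qed
  have full: "submodule (carrier U) (sub_ring Q R) U"
    using group.subgroup_self[OF grp] sU rsubmoduleD(4)[OF A]
    by (auto intro!: submodule.intro submodule_axioms.intro simp: cU)
  have triv: "submodule {N} (sub_ring Q R) U"
  proof (intro submodule.intro submodule_axioms.intro)
    show "subgroup {N} (add_monoid U)" using group.triv_subgroup[OF grp] zU by simp
    fix a x assume "a \<in> carrier (sub_ring Q R)" "x \<in> {N}"
    then show "a \<odot>\<^bsub>U\<^esub> x \<in> {N}" using sU[OF _ zA, of a] cl_zero R_carr by simp
  qed
  have dich: "C = {N} \<or> C = carrier U" if C: "submodule C (sub_ring Q R) U" for C
  proof (rule disjCI)
    interpret C: submodule C "sub_ring Q R" U by (rule C)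
    have NC: "N \<in> C" using C.one_closed zU by simp
    have CU: "C \<subseteq> carrier U" using C.subset by simp
    assume "C \<noteq> carrier U"
    show "C = {N}"
    proof (rule ccontr)
      assume "C \<noteq> {N}"
      then obtain D where D: "D \<in> C" "D \<noteq> N" using NC by blast
      moreover from this obtain x where "x \<in> A" "D = cl x" using CU cU by blast
      ultimately have x: "x \<in> A" "cl x \<in> C" "cl x \<noteq> N" by auto
      then have "x \<notin> N" using cl_N by blast
      have "cl y \<in> C" if y: "y \<in> A" for y
      proof -
        obtain r where r: "r \<in> R" "y \<ominus> r \<otimes> x \<in> N" using simple[OF x(1) \<open>x \<notin> N\<close> y] by blast
        then have "cl y = cl (r \<otimes> x)" using cl_eqI[OF y rsubmoduleD(4)[OF A r(1) x(1)]] by blast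
        also have "\<dots> = r \<odot>\<^bsub>U\<^esub> cl x" using sU[OF r(1) x(1)] by simp
        also have "\<dots> \<in> C" using C.smult_closed[of r "cl x"] r x by simp
        finally show ?thesis .
      qed
      then have "carrier U \<subseteq> C" unfolding cU by blast
      then show False using CU \<open>C \<noteq> carrier U\<close> by blast
    qed
  qed
  have NU: "N \<in> carrier U" using cU cl_zero zA by blast
  let ?S = "{enat n | n C. (\<forall>i\<le>n. submodule (C i) (sub_ring Q R) U) \<and> (\<forall>i<n. C i \<subset> C (Suc i))}"
  have AN: "carrier U = {N} \<longleftrightarrow> A = N"
  proof
    assume "carrier U = {N}"
    then have "x \<in> N" if "x \<in> A" for x using cl_N[OF that] cU that by blast
    then show "A = N" using NA by blast
  next
    assume "A = N"
    then have "cl x = N" if "x \<in> A" for x using cl_N that by blast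
    then show "carrier U = {N}" using NU cU by auto
  qed
  have "Sup ?S = (if A = N then 0 else 1)"
  proof (cases "A = N")
    case True
    then have C: "C = {N}" if "submodule C (sub_ring Q R) U" for C using dich[OF that] AN by blast
    have "x \<le> 0" if "x \<in> ?S" for x
    proof -
      from that obtain n C where n: "x = enat n" and sub: "\<forall>i\<le>n. submodule (C i) (sub_ring Q R) U"
        and str: "\<forall>i<n. C i \<subset> C (Suc i)" by (elim CollectE exE conjE)
      have "n = 0"
      proof (rule ccontr)
        assume "n \<noteq> 0"
        then have "C 0 \<subset> C (Suc 0)" "C 0 = {N}" "C (Suc 0) = {N}" using str sub C by auto
        then show False by simp
      qed
      then show ?thesis using n by (simp add: zero_enat_def)
    qed
    then have "Sup ?S \<le> 0" by (rule Sup_least)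
    then show ?thesis using True by simp
  next
    case False
    have "x \<le> 1" if "x \<in> ?S" for x
    proof -
      from that obtain n C where n: "x = enat n" and sub: "\<forall>i\<le>n. submodule (C i) (sub_ring Q R) U"
        and str: "\<forall>i<n. C i \<subset> C (Suc i)" by (elim CollectE exE conjE)
      have "n \<le> 1"
      proof (rule ccontr)
        assume "\<not> n \<le> 1"
        then have n2: "0 < n" "1 < n" "2 \<le> n" by auto
        have s: "C 0 \<subset> C 1" "C 1 \<subset> C 2" using str n2 by (auto simp: numeral_2_eq_2)
        have d: "C k = {N} \<or> C k = carrier U" if "k \<le> 2" for k using dich sub that n2 by auto
        show False using s d[of 0] d[of 1] d[of 2] NU by auto
      qed
      then show ?thesis using n by (simp add: one_enat_def)
    qed
    then have "Sup ?S \<le> 1" by (rule Sup_least)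
    moreover have "enat 1 \<in> ?S"
    proof -
      define C where "C i = (if i = 0 then {N} else carrier U)" for i :: nat
      have "\<forall>i\<le>1. submodule (C i) (sub_ring Q R) U" using triv full by (auto simp: C_def)
      moreover have "\<forall>i<1. C i \<subset> C (Suc i)" using NU AN False by (auto simp: C_def)
      ultimately show ?thesis by blast
    qed
    then have "1 \<le> Sup ?S" unfolding one_enat_def by (rule Sup_upper)
    ultimately show ?thesis using False by simp
  qed
  then show ?thesis unfolding module_length_def U_def .
qed

definition jump :: "'a set \<Rightarrow> int ^ 'n \<Rightarrow> 'n \<Rightarrow> bool" where
  "jump Y \<alpha> i \<longleftrightarrow> (\<exists>x\<in>truncation v Y \<alpha>. v i x = Fin (\<alpha> $ i))"

lemma truncation_axis_mem:
  assumes Y: "rsubmodule Y"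
  shows "x \<in> truncation v Y (\<alpha> + axis i 1) \<longleftrightarrow> x \<in> truncation v Y \<alpha> \<and> v i x \<noteq> Fin (\<alpha> $ i)"
proof
  assume x: "x \<in> truncation v Y (\<alpha> + axis i 1)"
  then have "Fin ((\<alpha> + axis i 1) $ k) \<le> v k x" for k by (simp add: truncation_mem)
  then have "Fin (\<alpha> $ k) \<le> v k x" for k
    by (rule v_le_trans) (simp add: axis_nth)
  moreover have "Fin (\<alpha> $ i + 1) \<le> v i x" using x by (auto simp: truncation_mem axis_nth dest: spec[of _ i])
  ultimately show "x \<in> truncation v Y \<alpha> \<and> v i x \<noteq> Fin (\<alpha> $ i)" using x by (auto simp: truncation_mem)
next
  assume x: "x \<in> truncation v Y \<alpha> \<and> v i x \<noteq> Fin (\<alpha> $ i)"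
  then have xc: "x \<in> carrier Q" and ge: "\<And>k. Fin (\<alpha> $ k) \<le> v k x"
    using rsubmoduleD(1)[OF Y] by (auto simp: truncation_mem)
  have "Fin (\<alpha> $ i + 1) \<le> v i x" using ge[of i] x v_range[OF xc, of i] by auto
  then show "x \<in> truncation v Y (\<alpha> + axis i 1)" using x ge by (auto simp: truncation_mem axis_nth)
qed

text \<open>An element outside the smaller truncation has value exactly \<open>\<alpha> $ i\<close>
  at \<open>i\<close>; by \<open>residue_match\<close> a multiple of it corrects any other element,
  so the quotient is zero or simple.\<close>

lemma truncation_quot_length_jump:
  assumes Y: "rsubmodule Y"
  shows "truncation_quot_length Q R v Y \<alpha> (\<alpha> + axis i 1) = (if jump Y \<alpha> i then 1 else 0)"
proof -
  have "truncation v Y \<alpha> = truncation v Y (\<alpha> + axis i 1) \<longleftrightarrow> \<not> jump Y \<alpha> i"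
    unfolding jump_def set_eq_iff truncation_axis_mem[OF Y] by blast
  moreover have "\<exists>r\<in>R. y \<ominus> r \<otimes> x \<in> truncation v Y (\<alpha> + axis i 1)"
    if x: "x \<in> truncation v Y \<alpha>" "x \<notin> truncation v Y (\<alpha> + axis i 1)" and y: "y \<in> truncation v Y \<alpha>" for x y
  proof -
    note TY = rsubmodule_truncation[OF Y]
    have vx: "v i x = Fin (\<alpha> $ i)" using x truncation_axis_mem[OF Y] by blast
    have vy: "Fin (\<alpha> $ i) \<le> v i y" using y by (simp add: truncation_mem)
    obtain r where r: "r \<in> R" "Fin (\<alpha> $ i + 1) \<le> v i (y \<ominus> r \<otimes> x)"
      using residue_match[OF rsubmoduleD(1)[OF TY y] vy rsubmoduleD(1)[OF TY x(1)] vx] by blast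
    have "y \<ominus> r \<otimes> x \<in> truncation v Y \<alpha>"
      using rsubmodule_diff[OF TY y rsubmoduleD(4)[OF TY r(1) x(1)]] .
    then show ?thesis using r truncation_axis_mem[OF Y] by force
  qed
  ultimately show ?thesis
    unfolding truncation_quot_length_def
    using module_length_quot[OF rsubmodule_truncation[OF Y, of \<alpha>] rsubmodule_truncation[OF Y, of "\<alpha> + axis i 1"]]
      truncation_axis_mem[OF Y] by (simp add: subset_iff)
qed

section \<open>Duality\<close>

lemma colon_mem: "x \<in> colon Q J I \<longleftrightarrow> x \<in> carrier Q \<and> (\<forall>y\<in>I. x \<otimes> y \<in> J)"
  by (simp add: colon_def)

lemma regular_fractional_ideal_colon:
  assumes J: "regular_fractional_ideal Q R J" and I: "regular_fractional_ideal Q R I"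
  shows "regular_fractional_ideal Q R (colon Q J I)"
proof -
  obtain \<delta> \<gamma> where J': "rsubmodule J" and \<delta>: "J \<subseteq> QQ \<delta>" and \<gamma>: "QQ \<gamma> \<subseteq> J"
    using J regular_fractional_ideal_iff by blast
  obtain \<delta>' \<gamma>' where I': "rsubmodule I" and \<delta>': "I \<subseteq> QQ \<delta>'" and \<gamma>': "QQ \<gamma>' \<subseteq> I"
    using I regular_fractional_ideal_iff by blast
  note Ic = rsubmoduleD(1)[OF I']
  have "rsubmodule (colon Q J I)"
    unfolding rsubmodule_def
  proof (intro conjI ballI)
    show "colon Q J I \<subseteq> carrier Q" by (auto simp: colon_mem)
    show "\<zero> \<in> colon Q J I" using Ic rsubmoduleD(2)[OF J'] by (auto simp: colon_mem)
  next
    fix x y assume "x \<in> colon Q J I" "y \<in> colon Q J I"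
    then show "x \<oplus> y \<in> colon Q J I" using Ic rsubmoduleD(3)[OF J'] by (auto simp: colon_mem l_distr)
  next
    fix a x assume "a \<in> R" "x \<in> colon Q J I"
    then show "a \<otimes> x \<in> colon Q J I"
      using Ic rsubmoduleD(4)[OF J'] R_carr by (auto simp: colon_mem m_assoc)
  qed
  moreover have "QQ (\<gamma> - \<delta>') \<subseteq> colon Q J I"
  proof
    fix x assume x: "x \<in> QQ (\<gamma> - \<delta>')"
    have "x \<otimes> y \<in> J" if "y \<in> I" for y
      using QQ_mult[OF x, of y \<delta>'] that \<delta>' \<gamma> by auto
    then show "x \<in> colon Q J I" using x by (simp add: colon_mem truncation_mem)
  qed
  moreover have "colon Q J I \<subseteq> QQ (\<delta> - \<gamma>')"
  proof
    fix x assume x: "x \<in> colon Q J I"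
    obtain y where y: "y \<in> Units Q" "\<And>i. v i y = Fin (\<gamma>' $ i)" using unit_of_value[of \<gamma>'] by blast
    have "y \<in> QQ \<gamma>'" using y by (simp add: truncation_mem Units_closed)
    then have "x \<otimes> y \<in> J" using x \<gamma>' by (auto simp: colon_mem)
    then have xy: "x \<otimes> y \<in> QQ \<delta>" using \<delta> by blast
    have xc: "x \<in> carrier Q" using x by (simp add: colon_mem)
    have "Fin ((\<delta> - \<gamma>') $ i) \<le> v i x" for i
    proof -
      have "Fin (\<delta> $ i) \<le> v i x + Fin (\<gamma>' $ i)"
        using xy unfolding truncation_mem v_mult[OF xc Units_closed[OF y(1)]] y(2) by blast
      then show ?thesis using v_range[OF xc, of i] by auto
    qed
    then show "x \<in> QQ (\<delta> - \<gamma>')" using xc by (simp add: truncation_mem)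
  qed
  ultimately show ?thesis using regular_fractional_ideal_iff by blast
qed

lemma sum_QQ_mem: "x \<in> I <+> QQ \<alpha> \<longleftrightarrow> (\<exists>a\<in>I. \<exists>b\<in>QQ \<alpha>. x = a \<oplus> b)"
  by (rule ideal_sum_mem)

lemma regular_fractional_ideal_sum_QQ:
  assumes I: "regular_fractional_ideal Q R I"
  shows "regular_fractional_ideal Q R (I <+> QQ \<alpha>)"
proof -
  obtain \<delta> where I': "rsubmodule I" and \<delta>: "I \<subseteq> QQ \<delta>" using I regular_fractional_ideal_iff by blast
  note q = rsubmodule_QQ[of \<alpha>]
  have "rsubmodule (I <+> QQ \<alpha>)"
    unfolding rsubmodule_def
  proof (intro conjI ballI)
    show "I <+> QQ \<alpha> \<subseteq> carrier Q"
      using rsubmoduleD(1)[OF I'] rsubmoduleD(1)[OF q] by (auto simp: sum_QQ_mem)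
    have "\<zero> = \<zero> \<oplus> \<zero>" by simp
    then show "\<zero> \<in> I <+> QQ \<alpha>" unfolding sum_QQ_mem using rsubmoduleD(2)[OF I'] rsubmoduleD(2)[OF q] by blast
  next
    fix x y assume "x \<in> I <+> QQ \<alpha>" "y \<in> I <+> QQ \<alpha>"
    then obtain a b c d where *: "a \<in> I" "b \<in> QQ \<alpha>" "x = a \<oplus> b" "c \<in> I" "d \<in> QQ \<alpha>" "y = c \<oplus> d"
      unfolding sum_QQ_mem by blast
    note C = rsubmoduleD(1)[OF I' *(1)] rsubmoduleD(1)[OF I' *(4)] rsubmoduleD(1)[OF q *(2)] rsubmoduleD(1)[OF q *(5)]
    have "x \<oplus> y = (a \<oplus> c) \<oplus> (b \<oplus> d)" unfolding * by (insert C, simp add: ring_norm)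
    then show "x \<oplus> y \<in> I <+> QQ \<alpha>"
      unfolding sum_QQ_mem using rsubmoduleD(3)[OF I' *(1,4)] rsubmoduleD(3)[OF q *(2,5)] by blast
  next
    fix r x assume r: "r \<in> R" and "x \<in> I <+> QQ \<alpha>"
    then obtain a b where *: "a \<in> I" "b \<in> QQ \<alpha>" "x = a \<oplus> b" unfolding sum_QQ_mem by blast
    have "r \<otimes> x = r \<otimes> a \<oplus> r \<otimes> b"
      using rsubmoduleD(1)[OF I' *(1)] rsubmoduleD(1)[OF q *(2)] R_carr[OF r] by (simp add: * r_distr)
    then show "r \<otimes> x \<in> I <+> QQ \<alpha>"
      unfolding sum_QQ_mem using rsubmoduleD(4)[OF I' r *(1)] rsubmoduleD(4)[OF q r *(2)] by blast
  qed
  moreover have "I <+> QQ \<alpha> \<subseteq> QQ (\<chi> i. min (\<delta> $ i) (\<alpha> $ i))"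
  proof
    fix x assume "x \<in> I <+> QQ \<alpha>"
    then obtain a b where *: "a \<in> I" "b \<in> QQ \<alpha>" "x = a \<oplus> b" unfolding sum_QQ_mem by blast
    have "QQ \<delta> \<subseteq> QQ (\<chi> i. min (\<delta> $ i) (\<alpha> $ i))" "QQ \<alpha> \<subseteq> QQ (\<chi> i. min (\<delta> $ i) (\<alpha> $ i))"
      by (intro QQ_antimono; simp add: less_eq_vec_def)+
    then show "x \<in> QQ (\<chi> i. min (\<delta> $ i) (\<alpha> $ i))"
      using * \<delta> rsubmoduleD(3)[OF rsubmodule_QQ] by blast
  qed
  moreover have "QQ \<alpha> \<subseteq> I <+> QQ \<alpha>"
  proof
    fix x assume x: "x \<in> QQ \<alpha>"
    then have "x = \<zero> \<oplus> x" by (simp add: truncation_mem)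
    then show "x \<in> I <+> QQ \<alpha>" unfolding sum_QQ_mem using x rsubmoduleD(2)[OF I'] by blast
  qed
  ultimately show ?thesis using regular_fractional_ideal_iff by blast
qed

text \<open>For the inclusion from left to right let \<open>y\<close> have value
  \<open>\<alpha>\<close> and put \<open>w = x y\<close>, so that \<open>w\<close> multiplies
  \<open>QQ 0\<close> into \<open>J\<close>. If \<open>w\<close> is a unit of value
  \<open>g\<close>, then \<open>QQ g \<subseteq> J\<close>, hence \<open>c \<le> g\<close> by
  minimality of the conductor. Infinite values of \<open>w\<close> are removed by adding some
  \<open>q\<close> in \<open>QQ c\<close>, with values above the finite ones of \<open>w\<close> so
  that those do not change.\<close>

lemma colon_QQ:
  assumes J: "regular_fractional_ideal Q R J"
  shows "colon Q J (QQ \<alpha>) = QQ (conductor Q v J - \<alpha>)"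
proof
  let ?c = "conductor Q v J"
  have J': "rsubmodule J" using J by (simp add: regular_fractional_ideal_iff)
  note c = conductor_least[OF J]
  show "QQ (?c - \<alpha>) \<subseteq> colon Q J (QQ \<alpha>)"
  proof
    fix x assume x: "x \<in> QQ (?c - \<alpha>)"
    have "x \<otimes> y \<in> J" if "y \<in> QQ \<alpha>" for y
      using QQ_mult[OF x that] c(1) by auto
    then show "x \<in> colon Q J (QQ \<alpha>)" using x by (simp add: colon_mem truncation_mem)
  qed
  show "colon Q J (QQ \<alpha>) \<subseteq> QQ (?c - \<alpha>)"
  proof
    fix x assume x: "x \<in> colon Q J (QQ \<alpha>)"
    then have xc: "x \<in> carrier Q" by (simp add: colon_mem)
    obtain y where y: "y \<in> Units Q" "\<And>i. v i y = Fin (\<alpha> $ i)" using unit_of_value[of \<alpha>] by blast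
    have yc: "y \<in> carrier Q" and yQ: "y \<in> QQ \<alpha>" using y by (simp_all add: truncation_mem Units_closed)
    define w where "w = x \<otimes> y"
    have wc: "w \<in> carrier Q" using xc yc by (simp add: w_def)
    have wO: "w \<otimes> z \<in> J" if z: "z \<in> QQ 0" for z
    proof -
      have zc: "z \<in> carrier Q" using z by (simp add: truncation_mem)
      have "y \<otimes> z \<in> QQ \<alpha>" using QQ_mult[OF yQ z] by simp
      then have "x \<otimes> (y \<otimes> z) \<in> J" using x by (simp add: colon_mem)
      then show ?thesis using xc yc zc by (simp add: w_def m_assoc)
    qed
    text \<open>An element of \<open>QQ c\<close> is added to make all values finite.\<close>
    define \<epsilon> :: "int ^ 'n" where
      "\<epsilon> = (\<chi> k. case v k w of Fin a \<Rightarrow> max (?c $ k) (a + 1) | _ \<Rightarrow> ?c $ k)"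
    obtain q where q: "q \<in> Units Q" "\<And>k. v k q = Fin (\<epsilon> $ k)" using unit_of_value[of \<epsilon>] by blast
    have qc: "q \<in> carrier Q" using Units_closed[OF q(1)] .
    have "?c $ k \<le> \<epsilon> $ k" for k using v_range[OF wc, of k] by (auto simp: \<epsilon>_def)
    then have qQ: "q \<in> QQ ?c" using qc q(2) by (simp add: truncation_mem)
    have wq_fin: "v k (w \<oplus> q) = Fin a" if "v k w = Fin a" for k a
      using v_add_eq[OF wc qc that] q(2)[of k] that by (simp add: \<epsilon>_def)
    have "v k (w \<oplus> q) \<noteq> Pinf" for k
    proof (cases "v k w = Pinf")
      case True
      then have "v k (q \<oplus> w) = Fin (\<epsilon> $ k)" using v_add_eq[OF qc wc q(2)] by simp
      then show ?thesis using qc wc by (simp add: a_comm)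
    next
      case False
      then show ?thesis using wq_fin v_range[OF wc, of k] by auto
    qed
    then have wu: "w \<oplus> q \<in> Units Q" using unit_iff_finite wc qc by simp
    obtain g where g: "\<And>k. v k (w \<oplus> q) = Fin (g $ k)" "\<And>k. v k (inv (w \<oplus> q)) = Fin ((- g) $ k)"
      by (rule unit_value[OF wu]) (rule that)
    have "QQ g \<subseteq> J"
    proof
      fix z assume z: "z \<in> QQ g"
      then have zc: "z \<in> carrier Q" by (simp add: truncation_mem)
      define o' where "o' = inv (w \<oplus> q) \<otimes> z"
      have "inv (w \<oplus> q) \<in> QQ (- g)" using g(2) wu by (simp add: truncation_mem)
      then have oQ: "o' \<in> QQ 0" using QQ_mult[of _ "- g" z g] z by (simp add: o'_def)
      then have oc: "o' \<in> carrier Q" by (simp add: truncation_mem)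
      have "w \<otimes> o' \<oplus> q \<otimes> o' \<in> J"
        using rsubmoduleD(3)[OF J' wO[OF oQ]] QQ_mult[OF qQ oQ] c(1) by auto
      moreover have "w \<otimes> o' \<oplus> q \<otimes> o' = (w \<oplus> q) \<otimes> o'" using wc qc oc by (simp add: l_distr)
      moreover have "\<dots> = z" unfolding o'_def using wu zc by (metis Units_closed Units_inv_closed Units_r_inv l_one m_assoc)
      ultimately show "z \<in> J" by simp
    qed
    then have cg: "?c \<le> g" by (rule c(2))
    have "Fin ((?c - \<alpha>) $ i) \<le> v i x" for i
    proof (rule ccontr)
      assume not: "\<not> Fin ((?c - \<alpha>) $ i) \<le> v i x"
      then obtain b where b: "v i x = Fin b" "b < ?c $ i - \<alpha> $ i" using v_range[OF xc, of i] by auto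
      then have "v i w = Fin (b + \<alpha> $ i)" unfolding w_def using v_mult_eq[OF xc yc b(1) y(2)] by simp
      from wq_fin[OF this] have "g $ i = b + \<alpha> $ i" using g(1)[of i] by simp
      moreover have "?c $ i \<le> g $ i" using cg by (simp add: less_eq_vec_def)
      ultimately show False using b by simp
    qed
    then show "x \<in> QQ (?c - \<alpha>)" using xc by (simp add: truncation_mem)
  qed
qed

text \<open>The product \<open>z\<close> has value exactly one below the conductor at
  \<open>i\<close>. Subtracting a multiple of \<open>z\<close> moves any element of
  \<open>QQ (c - e_i)\<close> into \<open>QQ c \<subseteq> J\<close>, against the minimality of
  \<open>c\<close>.\<close>

lemma jump_exclusive:
  assumes J: "regular_fractional_ideal Q R J" and I: "rsubmodule I"
    and c: "\<alpha> + \<beta> = conductor Q v J" and 1: "jump I \<alpha> i" and 2: "jump (colon Q J I) (\<beta> - axis i 1) i"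
  shows False
proof -
  have J': "rsubmodule J" using J by (simp add: regular_fractional_ideal_iff)
  note cl = conductor_least[OF J]
  have cc: "conductor Q v J $ k = \<alpha> $ k + \<beta> $ k" for k using c by (metis vector_add_component)
  obtain x where x: "x \<in> truncation v I \<alpha>" "v i x = Fin (\<alpha> $ i)" using 1 by (auto simp: jump_def)
  obtain y where y: "y \<in> truncation v (colon Q J I) (\<beta> - axis i 1)" "v i y = Fin ((\<beta> - axis i 1) $ i)"
    using 2 by (auto simp: jump_def)
  have xI: "x \<in> I" and yK: "y \<in> colon Q J I" using x y by (auto simp: truncation_mem)
  have xc: "x \<in> carrier Q" and yc: "y \<in> carrier Q" using rsubmoduleD(1)[OF I xI] yK by (auto simp: colon_mem)
  define z where "z = y \<otimes> x"
  have zJ: "z \<in> J" using xI yK by (simp add: z_def colon_mem)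
  have zc: "z \<in> carrier Q" using xc yc by (simp add: z_def)
  let ?d = "conductor Q v J - axis i 1"
  have "x \<in> QQ \<alpha>" "y \<in> QQ (\<beta> - axis i 1)" using x y xc yc by (auto simp: truncation_mem)
  from QQ_mult[OF this(2,1)] have zQ: "z \<in> QQ ?d" using c by (simp add: z_def algebra_simps)
  have zi: "v i z = Fin (?d $ i)" using v_mult_eq[OF yc xc y(2) x(2)] by (simp add: z_def cc axis_nth)
  have "QQ ?d \<subseteq> J"
  proof
    fix h assume h: "h \<in> QQ ?d"
    then have hc: "h \<in> carrier Q" and hi: "Fin (?d $ i) \<le> v i h" unfolding truncation_mem by blast+
    obtain r where r: "r \<in> R" "Fin (?d $ i + 1) \<le> v i (h \<ominus> r \<otimes> z)"
      using residue_match[OF hc hi zc zi] by blast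
    have hr: "h \<ominus> r \<otimes> z \<in> QQ ?d"
      using rsubmodule_diff[OF rsubmodule_QQ h rsubmoduleD(4)[OF rsubmodule_QQ r(1) zQ]] .
    have "Fin (conductor Q v J $ k) \<le> v k (h \<ominus> r \<otimes> z)" for k
      using hr r(2) by (cases "k = i") (auto simp: truncation_mem axis_nth dest: spec[of _ k])
    then have "h \<ominus> r \<otimes> z \<in> QQ (conductor Q v J)" using hr by (simp add: truncation_mem)
    then have "(h \<ominus> r \<otimes> z) \<oplus> r \<otimes> z \<in> J"
      using cl(1) rsubmoduleD(3)[OF J' _ rsubmoduleD(4)[OF J' r(1) zJ]] by blast
    moreover have "(h \<ominus> r \<otimes> z) \<oplus> r \<otimes> z = h"
      by (insert hc zc R_carr[OF r(1)], simp add: ring_norm)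
    ultimately show "h \<in> J" by simp
  qed
  from cl(2)[OF this] show False by (auto simp: less_eq_vec_def axis_nth dest: spec[of _ i])
qed

lemma jump_exhaustive:
  assumes J: "canonical_ideal Q R J" and I: "regular_fractional_ideal Q R I"
    and c: "\<alpha> + \<beta> = conductor Q v J" and not: "\<not> jump (colon Q J I) (\<beta> - axis i 1) i"
  shows "jump I \<alpha> i"
proof -
  have Jr: "regular_fractional_ideal Q R J"
    and dual: "\<And>I. regular_fractional_ideal Q R I \<Longrightarrow> colon Q J (colon Q J I) = I"
    using J by (auto simp: canonical_ideal_def)
  have I': "rsubmodule I" using I by (simp add: regular_fractional_ideal_iff)
  have J': "rsubmodule J" using Jr by (simp add: regular_fractional_ideal_iff)
  have K: "rsubmodule (colon Q J I)"
    using regular_fractional_ideal_colon[OF Jr I] by (simp add: regular_fractional_ideal_iff)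
  have colon_sum: "colon Q J (I <+> QQ a) = colon Q J I \<inter> QQ (conductor Q v J - a)" for a
  proof -
    have "colon Q J (I <+> QQ a) = colon Q J I \<inter> colon Q J (QQ a)"
    proof (intro equalityI subsetI)
      fix x assume x: "x \<in> colon Q J (I <+> QQ a)"
      have "y \<in> I <+> QQ a" if "y \<in> I" for y
        unfolding sum_QQ_mem using that rsubmoduleD(2)[OF rsubmodule_QQ] rsubmoduleD(1)[OF I' that] by (metis r_zero)
      moreover have "y \<in> I <+> QQ a" if "y \<in> QQ a" for y
        unfolding sum_QQ_mem using that rsubmoduleD(2)[OF I'] rsubmoduleD(1)[OF rsubmodule_QQ that] by (metis l_zero)
      ultimately show "x \<in> colon Q J I \<inter> colon Q J (QQ a)" using x by (auto simp: colon_mem)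
    next
      fix x assume x: "x \<in> colon Q J I \<inter> colon Q J (QQ a)"
      have "x \<otimes> y \<in> J" if y: "y \<in> I <+> QQ a" for y
      proof -
        obtain b d where bd: "b \<in> I" "d \<in> QQ a" "y = b \<oplus> d" using y unfolding sum_QQ_mem by blast
        have "x \<otimes> y = x \<otimes> b \<oplus> x \<otimes> d"
          using bd x rsubmoduleD(1)[OF I' bd(1)] rsubmoduleD(1)[OF rsubmodule_QQ bd(2)] by (simp add: colon_mem r_distr)
        then show ?thesis using x bd rsubmoduleD(3)[OF J'] by (simp add: colon_mem)
      qed
      then show "x \<in> colon Q J (I <+> QQ a)" using x by (simp add: colon_mem)
    qed
    then show ?thesis using colon_QQ[OF Jr] by simp
  qed
  have b1: "conductor Q v J - (\<alpha> + axis i 1) = \<beta> - axis i 1" and b0: "conductor Q v J - \<alpha> = \<beta>"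
    using c by (auto simp: algebra_simps)
  \<comment> \<open>The two sides are \<open>J : I\<close> cut down to
    \<open>QQ (\<beta> - e_i)\<close> and to \<open>QQ \<beta>\<close>; an element of the first but
    not of the second would be a jump of \<open>J : I\<close>.\<close>
  have "colon Q J (I <+> QQ (\<alpha> + axis i 1)) = colon Q J (I <+> QQ \<alpha>)"
    unfolding colon_sum b1 b0
  proof (intro equalityI subsetI)
    fix x assume x: "x \<in> colon Q J I \<inter> QQ (\<beta> - axis i 1)"
    then have "x \<in> truncation v (colon Q J I) (\<beta> - axis i 1)" by (auto simp: truncation_mem)
    moreover from this have "v i x \<noteq> Fin ((\<beta> - axis i 1) $ i)" using not by (auto simp: jump_def)
    ultimately have "x \<in> truncation v (colon Q J I) (\<beta> - axis i 1 + axis i 1)"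
      using truncation_axis_mem[OF K] by blast
    then show "x \<in> colon Q J I \<inter> QQ \<beta>" using x by (auto simp: truncation_mem)
  next
    fix x assume x: "x \<in> colon Q J I \<inter> QQ \<beta>"
    have "\<beta> - axis i 1 \<le> \<beta>" by (simp add: less_eq_vec_def axis_nth)
    then show "x \<in> colon Q J I \<inter> QQ (\<beta> - axis i 1)" using x QQ_antimono by blast
  qed
  then have eq: "I <+> QQ (\<alpha> + axis i 1) = I <+> QQ \<alpha>"
    using dual[OF regular_fractional_ideal_sum_QQ[OF I]] by metis
  \<comment> \<open>\<open>q\<close> has value exactly \<open>\<alpha>\<close>. When it is
    decomposed along the smaller module, the part \<open>q'\<close> has larger value at
    \<open>i\<close>, so the part in \<open>I\<close> inherits the value
    \<open>\<alpha> $ i\<close>.\<close>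
  obtain q where q: "q \<in> Units Q" "\<And>k. v k q = Fin (\<alpha> $ k)" using unit_of_value[of \<alpha>] by blast
  have qc: "q \<in> carrier Q" and qQ: "q \<in> QQ \<alpha>" using q by (simp_all add: truncation_mem Units_closed)
  have "q = \<zero> \<oplus> q" using qc by simp
  then have "q \<in> I <+> QQ \<alpha>" unfolding sum_QQ_mem using qQ rsubmoduleD(2)[OF I'] by blast
  then obtain x q' where x: "x \<in> I" and q': "q' \<in> QQ (\<alpha> + axis i 1)" and qe: "q = x \<oplus> q'"
    unfolding eq[symmetric] sum_QQ_mem by blast
  have xc: "x \<in> carrier Q" using rsubmoduleD(1)[OF I' x] .
  have q'c: "q' \<in> carrier Q" using q' by (simp add: truncation_mem)
  have xe: "x = q \<ominus> q'" unfolding qe by (insert xc q'c, simp add: ring_norm)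
  have "\<alpha> \<le> \<alpha> + axis i 1" by (simp add: less_eq_vec_def axis_nth)
  then have "q' \<in> QQ \<alpha>" using q' QQ_antimono by blast
  then have "x \<in> QQ \<alpha>" unfolding xe using rsubmodule_diff[OF rsubmodule_QQ qQ] by blast
  moreover have "Fin (\<alpha> $ i + 1) \<le> v i q'" using q' by (auto simp: truncation_mem axis_nth dest: spec[of _ i])
  then have "v i x = Fin (\<alpha> $ i)" unfolding xe using v_diff_eq[OF qc q'c q(2)] by blast
  ultimately show ?thesis unfolding jump_def using x by (auto simp: truncation_mem)
qed

lemma canonical_if_jumps:
  assumes J: "regular_fractional_ideal Q R J"
    and jumps: "\<And>I \<alpha> \<beta> i. regular_fractional_ideal Q R I \<Longrightarrow> \<alpha> + \<beta> = conductor Q v J \<Longrightarrow>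
      jump I \<alpha> i \<longleftrightarrow> \<not> jump (colon Q J I) (\<beta> - axis i 1) i"
  shows "canonical_ideal Q R J"
  unfolding canonical_ideal_def
proof (intro conjI allI impI J)
  fix I assume I: "regular_fractional_ideal Q R I"
  let ?K = "colon Q J I" and ?I = "colon Q J (colon Q J I)"
  have K: "regular_fractional_ideal Q R ?K" by (rule regular_fractional_ideal_colon[OF J I])
  have I2: "regular_fractional_ideal Q R ?I" by (rule regular_fractional_ideal_colon[OF J K])
  have I': "rsubmodule I" and I2': "rsubmodule ?I" using I I2 by (simp_all add: regular_fractional_ideal_iff)
  have sub: "I \<subseteq> ?I"
  proof
    fix x assume x: "x \<in> I"
    have xc: "x \<in> carrier Q" using rsubmoduleD(1)[OF I' x] .
    have "x \<otimes> y \<in> J" if y: "y \<in> ?K" for y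
    proof -
      have "y \<otimes> x \<in> J" "y \<in> carrier Q" using y x by (auto simp: colon_mem)
      then show ?thesis using xc by (simp add: m_comm)
    qed
    then show "x \<in> ?I" using xc by (simp add: colon_mem)
  qed
  have jmp: "jump I \<alpha> i" if "jump ?I \<alpha> i" for \<alpha> i
  proof -
    define \<beta> where "\<beta> = conductor Q v J - \<alpha>"
    \<comment> \<open>The hypothesis for \<open>J : I\<close> is read at the pair
      \<open>\<beta> - e_i\<close>, \<open>\<alpha> + e_i\<close>, which has the same sum; its dual
      term then sits at \<open>\<alpha>\<close>.\<close>
    have "jump ?K (\<beta> - axis i 1) i \<longleftrightarrow> \<not> jump ?I ((\<alpha> + axis i 1) - axis i 1) i"
      by (rule jumps[OF K]) (simp add: \<beta>_def)
    moreover have "jump I \<alpha> i \<longleftrightarrow> \<not> jump ?K (\<beta> - axis i 1) i"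
      by (rule jumps[OF I]) (simp add: \<beta>_def)
    ultimately show ?thesis using that by simp
  qed
  obtain \<gamma> where \<gamma>: "QQ \<gamma> \<subseteq> I" using I regular_fractional_ideal_iff by blast
  obtain \<delta> where \<delta>: "?I \<subseteq> QQ \<delta>" using I2 regular_fractional_ideal_iff by blast
  let ?m = "(\<chi> i. max (\<gamma> $ i) (\<delta> $ i)) :: int ^ 'n"
  have "truncation v ?I \<delta> \<subseteq> I"
  proof (rule truncation_subset_raise[OF I' I2' sub])
    show "\<delta> \<le> ?m" by (simp add: less_eq_vec_def)
    have "\<gamma> \<le> ?m" by (simp add: less_eq_vec_def)
    then have "QQ ?m \<subseteq> I" using QQ_antimono \<gamma> by blast
    then show "truncation v ?I ?m \<subseteq> I" using rsubmoduleD(1)[OF I2'] by (auto simp: truncation_mem)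
    fix a i x assume "x \<in> truncation v ?I a" "v i x = Fin (a $ i)"
    then have "jump ?I a i" unfolding jump_def by blast
    then show "\<exists>y\<in>truncation v I a. v i y = Fin (a $ i)" using jmp unfolding jump_def by blast
  qed
  moreover have "?I \<subseteq> truncation v ?I \<delta>" using \<delta> by (auto simp: truncation_mem)
  ultimately show "?I = I" using sub by blast
qed

end

theorem theorem5:
  fixes Q :: "('a, 'm) ring_scheme"
    and R M J :: "'a set"
    and v :: "'n::finite \<Rightarrow> 'a \<Rightarrow> int extended"
  assumes "admissible Q R M"
    and "associated_valuations Q R v"
    and "regular_fractional_ideal Q R J"
  shows
    "(\<forall>I \<alpha> \<beta>. regular_fractional_ideal Q R I \<longrightarrow> \<alpha> + \<beta> = conductor Q v J \<longrightarrow>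
        (\<forall>i. truncation_quot_length Q R v I \<alpha> (\<alpha> + axis i 1)
              + truncation_quot_length Q R v (colon Q J I) (\<beta> - axis i 1) \<beta> \<le> 1))
     \<and>
     ((\<forall>I \<alpha> \<beta>. regular_fractional_ideal Q R I \<longrightarrow> \<alpha> + \<beta> = conductor Q v J \<longrightarrow>
        (\<forall>i. truncation_quot_length Q R v I \<alpha> (\<alpha> + axis i 1)
              + truncation_quot_length Q R v (colon Q J I) (\<beta> - axis i 1) \<beta> = 1))
      \<longleftrightarrow> canonical_ideal Q R J)"
proof -
  obtain t where "frac_ring Q R M t" using admissible_imp_frac_ring[OF assms(1)] .
  then interpret valued_frac_ring Q R M t v
    using assms(1,2) by (intro valued_frac_ring.intro valued_frac_ring_axioms.intro) (auto simp: admissible_def)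
  have len: "truncation_quot_length Q R v I \<alpha> (\<alpha> + axis i 1)
      + truncation_quot_length Q R v (colon Q J I) (\<beta> - axis i 1) \<beta>
      = (if jump I \<alpha> i then 1 else 0) + (if jump (colon Q J I) (\<beta> - axis i 1) i then 1 else 0)"
    if "regular_fractional_ideal Q R I" for I \<alpha> \<beta> i
    using truncation_quot_length_jump[of I \<alpha> i] truncation_quot_length_jump[of "colon Q J I" "\<beta> - axis i 1" i]
      that regular_fractional_ideal_colon[OF assms(3) that]
    by (simp add: regular_fractional_ideal_iff)
  have excl: "\<not> (jump I \<alpha> i \<and> jump (colon Q J I) (\<beta> - axis i 1) i)"
    if "regular_fractional_ideal Q R I" "\<alpha> + \<beta> = conductor Q v J" for I \<alpha> \<beta> i
    using jump_exclusive[OF assms(3) _ that(2)] that(1) by (auto simp: regular_fractional_ideal_iff)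
  have iff: "(\<forall>I \<alpha> \<beta>. regular_fractional_ideal Q R I \<longrightarrow> \<alpha> + \<beta> = conductor Q v J \<longrightarrow>
      (\<forall>i. jump I \<alpha> i \<longleftrightarrow> \<not> jump (colon Q J I) (\<beta> - axis i 1) i)) \<longleftrightarrow> canonical_ideal Q R J"
    (is "?jumps \<longleftrightarrow> _")
  proof
    assume ?jumps
    then show "canonical_ideal Q R J" by (intro canonical_if_jumps[OF assms(3)]) metis
  next
    assume can: "canonical_ideal Q R J"
    show ?jumps
    proof (intro allI impI)
      fix I \<alpha> \<beta> i
      assume I: "regular_fractional_ideal Q R I" and c: "\<alpha> + \<beta> = conductor Q v J"
      show "jump I \<alpha> i \<longleftrightarrow> \<not> jump (colon Q J I) (\<beta> - axis i 1) i"
        using jump_exhaustive[OF can I c] excl[OF I c] by metis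
    qed
  qed
  have le: "((if p then 1 else 0) + (if q then 1 else 0) \<le> (1::enat)) \<longleftrightarrow> \<not> (p \<and> q)" for p q
    by (cases p; cases q) (simp_all add: one_add_one one_enat_def numeral_eq_enat enat_0_iff)
  have eq: "((if p then 1 else 0) + (if q then 1 else 0) = (1::enat)) \<longleftrightarrow> (p \<longleftrightarrow> \<not> q)" for p q
    by (cases p; cases q) (simp_all add: one_add_one one_enat_def numeral_eq_enat enat_0_iff)
  show ?thesis
    unfolding iff[symmetric]
  proof (intro conjI allI impI)
    fix I \<alpha> \<beta> i
    assume I: "regular_fractional_ideal Q R I" and c: "\<alpha> + \<beta> = conductor Q v J"
    show "truncation_quot_length Q R v I \<alpha> (\<alpha> + axis i 1)
        + truncation_quot_length Q R v (colon Q J I) (\<beta> - axis i 1) \<beta> \<le> 1"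
      unfolding len[OF I] le by (rule excl[OF I c])
  qed (simp add: len eq cong: imp_cong)
qed

end
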